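(* Let $\phi=\phi_1\times\phi_2: M=M_1\times_f M_2\to N=N_1\times_\rho N_2$ be a Riemannian warped product map between two Riemannian warped product manifolds, and let $\gamma=(\gamma_1,\gamma_2)$ be a regular curve on $M$, where $\gamma_1,\gamma_2$ are the projections of $\gamma$ onto $M_1$ and $M_2$. Write $\dot\gamma=(\dot\gamma_1,\dot\gamma_2)$, $\mathcal V_1\dot\gamma_1=U_1$, $\mathcal H_1\dot\gamma_1=Y_1$, $\mathcal V_2\dot\gamma_2=U_2$, $\mathcal H_2\dot\gamma_2=Y_2$. Then: (i) If $\dot\gamma$ is vertical, then $\gamma$ is a geodesic of $M$ if and only if $$\hat\nabla^1_{U_1}U_1+2\frac{U_1(f)}{f}U_2+\hat\nabla^2_{U_2}U_2-g_M(U_2,U_2)(\mathcal V\nabla^M\ln f)=0$$ and $$T_1(U_1,U_1)+T_2(U_2,U_2)-g_M(U_2,U_2)(\mathcal H\nabla^M\ln f)=0.$$ (ii) If $\dot\gamma$ is horizontal, then $\gamma$ is a geodesic of $M$ if and only if $$A_1(Y_1,Y_1)+A_2(Y_2,Y_2)-g_M(Y_2,Y_2)(\mathcal V\nabla^M\ln f)=0$$ and $$\mathcal H_1\nabla^{M_1}_{Y_1}Y_1+2\frac{Y_1(f)}{f}Y_2+\mathcal H_2\nabla^{M_2}_{Y_2}Y_2-g_M(Y_2,Y_2)(\mathcal H\nabla^M\ln f)=0.$$ (iii) If $\dot\gamma$ is arbitrary, then $\gamma$ is a geodesic of $M$ if and only if $$\begin{aligned}&\hat\nabla^1_{U_1}U_1+T_1(U_1,Y_1)+\mathcal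 V_1\nabla^{M_1}_{Y_1}U_1+A_1(Y_1,Y_1)+2\frac{U_1(f)}{f}U_2+2\frac{Y_1(f)}{f}U_2\\&-g_M(U_2,U_2)(\mathcal V\nabla^M\ln f)-g_M(Y_2,Y_2)(\mathcal V\nabla^M\ln f)\\&+\hat\nabla^2_{U_2}U_2+T_2(U_2,Y_2)+A_2(Y_2,Y_2)+\mathcal V_2\nabla^{M_2}_{Y_2}U_2=0\end{aligned}$$ and $$\begin{aligned}&T_1(U_1,U_1)+T_2(U_2,U_2)+\mathcal H_1\nabla^{M_1}_{U_1}Y_1+\mathcal H_2\nabla^{M_2}_{U_2}Y_2+A_1(Y_1,U_1)+A_2(Y_2,U_2)\\&+\mathcal H_1\nabla^{M_1}_{Y_1}Y_1+\mathcal H_2\nabla^{M_2}_{Y_2}Y_2+2\frac{U_1(f)}{f}Y_2+2\frac{Y_1(f)}{f}Y_2\\&-g_M(U_2,U_2)(\mathcal H\nabla^M\ln f)-g_M(Y_2,Y_2)(\mathcal H\nabla^M\ln f)=0.\end{aligned}$$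
   Context: Let $(M_i,g_{M_i})$, $(N_i,g_{N_i})$, $i=1,2$, be Riemannian manifolds and $f:M_1\to(0,\infty)$, $\rho:N_1\to(0,\infty)$ smooth. The warped product $M=M_1\times_fM_2$ is $M_1\times M_2$ with metric $g_M=\pi_1^*g_{M_1}+(f\circ\pi_1)^2\pi_2^*g_{M_2}$, where $\pi_i$ are the projections; similarly $N=N_1\times_\rho N_2$ with $g_N=g_{N_1}+\rho^2g_{N_2}$. Vector fields on $M_i$ are identified with their lifts to $M$. A smooth map $\phi_i:M_i\to N_i$ with $0<\operatorname{rank}\phi_i\le\min\{\dim M_i,\dim N_i\}$ is a Riemannian map if at every point $\phi_{i*}$ restricts to a linear isometry from $(\ker\phi_{i*})^\perp$ onto $\operatorname{range}\phi_{i*}$. If $\phi_1,\phi_2$ are Riemannian maps, $\phi=\phi_1\times\phi_2:M\to N$, $\phi(p_1,p_2)=(\phi_1(p_1),\phi_2(p_2))$, is called a Riemannian warped product map. Vertical means tangent to $\ker\phi_{*}=\ker\phi_{1*}\oplus\ker\phi_{2*}$, horizontal means tangent to its orthogonal complement $(\ker\phi_{1*})^\perp\oplus(\ker\phi_{2*})^\perp$. $\mathcal V,\mathcal H$ are the corresponding orthogonal projections on $TM$, and $\mathcal V_i,\mathcal H_i$ the projections of $TM_i$ onto $\ker\phi_{i*}$ and $(\ker\phi_{i*})^\perp$. $\nabla^M,\nabla^{M_i}$ are the Levi-Civita connections; $\nabla^M\ln f$ is the gradient of $\ln f$. For each $i$, the O'Neill tensors of $\phi_i$ are $$T_i(E,F)=\mathcal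 H_i\nabla^{M_i}_{\mathcal V_iE}\mathcal V_iF+\mathcal V_i\nabla^{M_i}_{\mathcal V_iE}\mathcal H_iF,\qquad A_i(E,F)=\mathcal H_i\nabla^{M_i}_{\mathcal H_iE}\mathcal V_iF+\mathcal V_i\nabla^{M_i}_{\mathcal H_iE}\mathcal H_iF,$$ and $\hat\nabla^i_UW=\mathcal V_i\nabla^{M_i}_UW$ for vertical $U,W$. The components $U_i,Y_i$ of $\dot\gamma_i$ are treated as (local) vector fields on $M_i$ when covariant derivatives are taken. A geodesic is a curve with $\nabla^M_{\dot\gamma}\dot\gamma=0$. *)

theory Defs
  imports "HOL-Analysis.Analysis"
begin

section \<open>Smooth functions on open subsets of Euclidean spaces\<close>

primrec Ck_on :: "nat \<Rightarrow> ('a::euclidean_space \<Rightarrow> 'b::real_normed_vector) \<Rightarrow> 'a set \<Rightarrow> bool" where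
  "Ck_on 0 F S \<longleftrightarrow> continuous_on S F"
| "Ck_on (Suc k) F S \<longleftrightarrow>
     (\<forall>x\<in>S. F differentiable (at x)) \<and>
     (\<forall>v. Ck_on k (\<lambda>x. frechet_derivative F (at x) v) S)"

text \<open>Only used for open sets \<open>S\<close>.\<close>

definition smooth_on :: "('a::euclidean_space \<Rightarrow> 'b::real_normed_vector) \<Rightarrow> 'a set \<Rightarrow> bool" where
  "smooth_on F S \<longleftrightarrow> (\<forall>k. Ck_on k F S)"


section \<open>Smooth manifolds\<close>

text \<open>
  The point set of a manifold is a whole (Hausdorff, second countable) type; the model space is a
  Euclidean space type. Only the values of \<open>cmap\<close> on \<open>cdom\<close> and of \<open>cinv\<close> on the image of \<open>cdom\<close> matter.
\<close>

datatype ('m, 'e) chart = Chart (cdom: "'m set") (cmap: "'m \<Rightarrow> 'e") (cinv: "'e \<Rightarrow> 'm")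

definition cimage :: "('m, 'e) chart \<Rightarrow> 'm set \<Rightarrow> 'e set" where
  "cimage c W = cmap c ` (W \<inter> cdom c)"

definition is_chart :: "('m::topological_space, 'e::euclidean_space) chart \<Rightarrow> bool" where
  "is_chart c \<longleftrightarrow> open (cdom c) \<and> open (cimage c UNIV) \<and>
     homeomorphism (cdom c) (cimage c UNIV) (cmap c) (cinv c)"

text \<open>
  Every point \<open>p\<close> carries a preferred chart \<open>chart_at M p\<close>. The tangent space at \<open>p\<close> is identified with
  the model space \<open>'e\<close> through the coordinates of the preferred chart; the components of a tangent
  vector in any other chart are obtained from the derivative of the transition map (\<open>tcoord\<close> below).
  A vector field is thus a function \<open>'m \<Rightarrow> 'e\<close>. There is no smoothness (nor continuity) in the choice of
  the preferred chart, so smoothness of vector fields is expressed through \<open>tcoord\<close>.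
\<close>

record ('m, 'e) manifold =
  atlas :: "('m, 'e) chart set"
  chart_at :: "'m \<Rightarrow> ('m, 'e) chart"

definition smooth_manifold ::
  "('m::{t2_space,second_countable_topology}, 'e::euclidean_space, 'z) manifold_scheme \<Rightarrow> bool" where
  "smooth_manifold M \<longleftrightarrow>
     (\<forall>c\<in>atlas M. is_chart c) \<and>
     (\<forall>c\<in>atlas M. \<forall>d\<in>atlas M. smooth_on (\<lambda>x. cmap d (cinv c x)) (cimage c (cdom d))) \<and>
     (\<forall>p. chart_at M p \<in> atlas M \<and> p \<in> cdom (chart_at M p))"

text \<open>\<open>tcoord M c p\<close> sends a tangent vector at \<open>p\<close> to its components in the chart \<open>c\<close>;
  \<open>tvec M c p\<close> is the inverse of this map.\<close>

definition tcoord :: "('m, 'e::euclidean_space, 'z) manifold_scheme \<Rightarrow> ('m, 'e) chart \<Rightarrow> 'm \<Rightarrow> 'e \<Rightarrow> 'e" where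
  "tcoord M c p v =
     frechet_derivative (\<lambda>x. cmap c (cinv (chart_at M p) x)) (at (cmap (chart_at M p) p)) v"

definition tvec :: "('m, 'e::euclidean_space, 'z) manifold_scheme \<Rightarrow> ('m, 'e) chart \<Rightarrow> 'm \<Rightarrow> 'e \<Rightarrow> 'e" where
  "tvec M c p u = frechet_derivative (\<lambda>x. cmap (chart_at M p) (cinv c x)) (at (cmap c p)) u"

definition smooth_fun :: "('m, 'e::euclidean_space, 'z) manifold_scheme \<Rightarrow> 'm set \<Rightarrow> ('m \<Rightarrow> real) \<Rightarrow> bool" where
  "smooth_fun M W h \<longleftrightarrow> (\<forall>c\<in>atlas M. smooth_on (\<lambda>x. h (cinv c x)) (cimage c W))"

definition smooth_vf :: "('m, 'e::euclidean_space, 'z) manifold_scheme \<Rightarrow> 'm set \<Rightarrow> ('m \<Rightarrow> 'e) \<Rightarrow> bool" where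
  "smooth_vf M W X \<longleftrightarrow>
     (\<forall>c\<in>atlas M. smooth_on (\<lambda>x. tcoord M c (cinv c x) (X (cinv c x))) (cimage c W))"

text \<open>\<open>dfun M h p v\<close> is the directional derivative \<open>v(h)\<close> for \<open>v\<close> tangent at \<open>p\<close>.\<close>

definition dfun :: "('m, 'e::euclidean_space, 'z) manifold_scheme \<Rightarrow> ('m \<Rightarrow> real) \<Rightarrow> 'm \<Rightarrow> 'e \<Rightarrow> real" where
  "dfun M h p v = frechet_derivative (\<lambda>x. h (cinv (chart_at M p) x)) (at (cmap (chart_at M p) p)) v"

definition smooth_map ::
  "('m::topological_space, 'e::euclidean_space, 'z) manifold_scheme \<Rightarrow>
   ('n::topological_space, 'd::euclidean_space, 'y) manifold_scheme \<Rightarrow> ('m \<Rightarrow> 'n) \<Rightarrow> bool" where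
  "smooth_map M N \<phi> \<longleftrightarrow> continuous_on UNIV \<phi> \<and>
     (\<forall>c\<in>atlas M. \<forall>d\<in>atlas N. smooth_on (\<lambda>x. cmap d (\<phi> (cinv c x))) (cimage c (\<phi> -` cdom d)))"

definition tmap ::
  "('m, 'e::euclidean_space, 'z) manifold_scheme \<Rightarrow> ('n, 'd::euclidean_space, 'y) manifold_scheme \<Rightarrow>
   ('m \<Rightarrow> 'n) \<Rightarrow> 'm \<Rightarrow> 'e \<Rightarrow> 'd" where
  "tmap M N \<phi> p v =
     frechet_derivative (\<lambda>x. cmap (chart_at N (\<phi> p)) (\<phi> (cinv (chart_at M p) x)))
       (at (cmap (chart_at M p) p)) v"


section \<open>Riemannian manifolds and warped products\<close>

record ('m, 'e) riemannian = "('m, 'e) manifold" +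
  gmetric :: "'m \<Rightarrow> 'e \<Rightarrow> 'e \<Rightarrow> real"

definition riemannian_manifold ::
  "('m::{t2_space,second_countable_topology}, 'e::euclidean_space) riemannian \<Rightarrow> bool" where
  "riemannian_manifold M \<longleftrightarrow> smooth_manifold M \<and>
     (\<forall>p. bilinear (gmetric M p) \<and>
          (\<forall>u v. gmetric M p u v = gmetric M p v u) \<and>
          (\<forall>u. u \<noteq> 0 \<longrightarrow> 0 < gmetric M p u u)) \<and>
     (\<forall>c\<in>atlas M. \<forall>u v.
        smooth_on (\<lambda>x. gmetric M (cinv c x) (tvec M c (cinv c x) u) (tvec M c (cinv c x) v))
          (cimage c UNIV))"

definition grad :: "('m, 'e::euclidean_space) riemannian \<Rightarrow> ('m \<Rightarrow> real) \<Rightarrow> 'm \<Rightarrow> 'e" where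
  "grad M h p = (THE v. \<forall>w. gmetric M p v w = dfun M h p w)"

definition prod_chart ::
  "('m1, 'e1) chart \<Rightarrow> ('m2, 'e2) chart \<Rightarrow> ('m1 \<times> 'm2, 'e1 \<times> 'e2) chart" where
  "prod_chart c1 c2 =
     Chart (cdom c1 \<times> cdom c2) (map_prod (cmap c1) (cmap c2)) (map_prod (cinv c1) (cinv c2))"

text \<open>
  Since the preferred chart at \<open>(p, q)\<close> is the product of the preferred charts at \<open>p\<close> and \<open>q\<close>, the
  tangent space at \<open>(p, q)\<close> is \<open>'e1 \<times> 'e2\<close> and the differentials of the two projections are \<open>fst\<close> and
  \<open>snd\<close> (see \<open>tmap_fst\<close>, \<open>tmap_snd\<close> below), which are the maps occurring in the pulled back metrics.
\<close>

definition warped_product ::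
  "('m1, 'e1) riemannian \<Rightarrow> ('m1 \<Rightarrow> real) \<Rightarrow> ('m2, 'e2) riemannian \<Rightarrow>
   ('m1 \<times> 'm2, 'e1 \<times> 'e2) riemannian" where
  "warped_product M1 f M2 =
     \<lparr> atlas = {prod_chart c1 c2 | c1 c2. c1 \<in> atlas M1 \<and> c2 \<in> atlas M2},
       chart_at = (\<lambda>p. prod_chart (chart_at M1 (fst p)) (chart_at M2 (snd p))),
       gmetric = (\<lambda>p u v. gmetric M1 (fst p) (fst u) (fst v)
                    + (f (fst p))\<^sup>2 * gmetric M2 (snd p) (snd u) (snd v)) \<rparr>"

text \<open>The lifts of tangent vectors of the factors to the product.\<close>

abbreviation lift1 :: "'e1 \<Rightarrow> 'e1 \<times> ('e2::zero)" where "lift1 u \<equiv> (u, 0)"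
abbreviation lift2 :: "'e2 \<Rightarrow> ('e1::zero) \<times> 'e2" where "lift2 u \<equiv> (0, u)"

lemma chart_interior:
  assumes "smooth_manifold M"
  shows "open (cimage (chart_at M p) UNIV)"
    and "cmap (chart_at M p) p \<in> cimage (chart_at M p) UNIV"
    and "x \<in> cimage (chart_at M p) UNIV \<Longrightarrow> cmap (chart_at M p) (cinv (chart_at M p) x) = x"
proof -
  let ?c = "chart_at M p"
  have c: "is_chart ?c" and p: "p \<in> cdom ?c"
    using assms by (auto simp: smooth_manifold_def)
  show "open (cimage ?c UNIV)"
    using c by (simp add: is_chart_def)
  show "cmap ?c p \<in> cimage ?c UNIV"
    using p by (simp add: cimage_def)
  show "cmap ?c (cinv ?c x) = x" if "x \<in> cimage ?c UNIV"
    using c that by (simp add: is_chart_def homeomorphism_def)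
qed

lemma tmap_fst:
  fixes M1 :: "('m1::{t2_space,second_countable_topology}, 'e1::euclidean_space) riemannian"
    and M2 :: "('m2::{t2_space,second_countable_topology}, 'e2::euclidean_space) riemannian"
  assumes M1: "smooth_manifold M1" and M2: "smooth_manifold M2"
  shows "tmap (warped_product M1 f M2) M1 fst p v = fst v"
proof -
  let ?c = "chart_at M1 (fst p)" and ?d = "chart_at M2 (snd p)"
  let ?S = "cimage ?c UNIV \<times> (UNIV :: 'e2 set)"
  have "((\<lambda>x. cmap ?c (cinv ?c (fst x))) has_derivative fst)
          (at (cmap ?c (fst p), cmap ?d (snd p)))"
  proof (rule has_derivative_transform_within_open)
    show "(fst has_derivative fst) (at (cmap ?c (fst p), cmap ?d (snd p)))"
      by (intro bounded_linear_imp_has_derivative bounded_linear_fst)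
    show "open ?S"
      by (intro open_Times chart_interior(1)[OF M1]) simp
    show "(cmap ?c (fst p), cmap ?d (snd p)) \<in> ?S"
      using chart_interior(2)[OF M1] by simp
    show "fst x = cmap ?c (cinv ?c (fst x))" if "x \<in> ?S" for x
      using that chart_interior(3)[OF M1, of "fst x"] by auto
  qed
  then have "frechet_derivative (\<lambda>x. cmap ?c (cinv ?c (fst x)))
               (at (cmap ?c (fst p), cmap ?d (snd p))) = fst"
    by (rule frechet_derivative_at[symmetric])
  then show ?thesis
    by (cases p) (simp add: tmap_def warped_product_def prod_chart_def)
qed

lemma tmap_snd:
  fixes M1 :: "('m1::{t2_space,second_countable_topology}, 'e1::euclidean_space) riemannian"
    and M2 :: "('m2::{t2_space,second_countable_topology}, 'e2::euclidean_space) riemannian"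
  assumes M1: "smooth_manifold M1" and M2: "smooth_manifold M2"
  shows "tmap (warped_product M1 f M2) M2 snd p v = snd v"
proof -
  let ?c = "chart_at M1 (fst p)" and ?d = "chart_at M2 (snd p)"
  let ?S = "(UNIV :: 'e1 set) \<times> cimage ?d UNIV"
  have "((\<lambda>x. cmap ?d (cinv ?d (snd x))) has_derivative snd)
          (at (cmap ?c (fst p), cmap ?d (snd p)))"
  proof (rule has_derivative_transform_within_open)
    show "(snd has_derivative snd) (at (cmap ?c (fst p), cmap ?d (snd p)))"
      by (intro bounded_linear_imp_has_derivative bounded_linear_snd)
    show "open ?S"
      by (intro open_Times chart_interior(1)[OF M2]) simp
    show "(cmap ?c (fst p), cmap ?d (snd p)) \<in> ?S"
      using chart_interior(2)[OF M2] by simp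
    show "snd x = cmap ?d (cinv ?d (snd x))" if "x \<in> ?S" for x
      using that chart_interior(3)[OF M2, of "snd x"] by auto
  qed
  then have "frechet_derivative (\<lambda>x. cmap ?d (cinv ?d (snd x)))
               (at (cmap ?c (fst p), cmap ?d (snd p))) = snd"
    by (rule frechet_derivative_at[symmetric])
  then show ?thesis
    by (cases p) (simp add: tmap_def warped_product_def prod_chart_def)
qed


section \<open>The Levi-Civita connection\<close>

text \<open>
  A connection is an operator on vector fields. To have it act on vector fields defined on an arbitrary
  open set \<open>W\<close>, it is given on all functions \<open>'m \<Rightarrow> 'e\<close>, and the axioms are required, for every open \<open>W\<close>,
  at the points of \<open>W\<close> for fields and functions that are smooth on \<open>W\<close>. The axioms imply that
  \<open>D X Y p\<close> depends only on the germs of \<open>X\<close> and \<open>Y\<close> at \<open>p\<close> if these are smooth near \<open>p\<close>: multiply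
  by a function which is constantly 0 on \<open>W\<close> and 1 outside \<open>W\<close>.
\<close>

definition affine_connection ::
  "('m::topological_space, 'e::euclidean_space, 'z) manifold_scheme \<Rightarrow>
   (('m \<Rightarrow> 'e) \<Rightarrow> ('m \<Rightarrow> 'e) \<Rightarrow> 'm \<Rightarrow> 'e) \<Rightarrow> bool" where
  "affine_connection M D \<longleftrightarrow>
     (\<forall>W X X' Y Y' h. open W \<and> smooth_vf M W X \<and> smooth_vf M W X' \<and> smooth_vf M W Y \<and>
        smooth_vf M W Y' \<and> smooth_fun M W h \<longrightarrow>
        smooth_vf M W (D X Y) \<and>
        (\<forall>p\<in>W.
          D (\<lambda>q. X q + X' q) Y p = D X Y p + D X' Y p \<and>
          D (\<lambda>q. h q *\<^sub>R X q) Y p = h p *\<^sub>R D X Y p \<and>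
          D X (\<lambda>q. Y q + Y' q) p = D X Y p + D X Y' p \<and>
          D X (\<lambda>q. h q *\<^sub>R Y q) p = dfun M h p (X p) *\<^sub>R Y p + h p *\<^sub>R D X Y p))"

text \<open>\<open>Z\<close> is the Lie bracket \<open>[X, Y]\<close> on \<open>W\<close>.\<close>

definition is_lie_bracket ::
  "('m::topological_space, 'e::euclidean_space, 'z) manifold_scheme \<Rightarrow> 'm set \<Rightarrow>
   ('m \<Rightarrow> 'e) \<Rightarrow> ('m \<Rightarrow> 'e) \<Rightarrow> ('m \<Rightarrow> 'e) \<Rightarrow> bool" where
  "is_lie_bracket M W X Y Z \<longleftrightarrow>
     (\<forall>W' h. open W' \<and> W' \<subseteq> W \<and> smooth_fun M W' h \<longrightarrow>
        (\<forall>p\<in>W'. dfun M h p (Z p) =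
           dfun M (\<lambda>q. dfun M h q (Y q)) p (X p) - dfun M (\<lambda>q. dfun M h q (X q)) p (Y p)))"

definition levi_civita ::
  "('m::topological_space, 'e::euclidean_space) riemannian \<Rightarrow>
   (('m \<Rightarrow> 'e) \<Rightarrow> ('m \<Rightarrow> 'e) \<Rightarrow> 'm \<Rightarrow> 'e) \<Rightarrow> bool" where
  "levi_civita M D \<longleftrightarrow> affine_connection M D \<and>
     (\<forall>W X Y. open W \<and> smooth_vf M W X \<and> smooth_vf M W Y \<longrightarrow>
        is_lie_bracket M W X Y (\<lambda>p. D X Y p - D Y X p)) \<and>
     (\<forall>W X Y Z. open W \<and> smooth_vf M W X \<and> smooth_vf M W Y \<and> smooth_vf M W Z \<longrightarrow>
        (\<forall>p\<in>W. dfun M (\<lambda>q. gmetric M q (X q) (Y q)) p (Z p) =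
           gmetric M p (D Z X p) (Y p) + gmetric M p (X p) (D Z Y p)))"


section \<open>Curves and geodesics\<close>

definition smooth_curve ::
  "('m::topological_space, 'e::euclidean_space, 'z) manifold_scheme \<Rightarrow> real set \<Rightarrow> (real \<Rightarrow> 'm) \<Rightarrow> bool" where
  "smooth_curve M I \<gamma> \<longleftrightarrow> continuous_on I \<gamma> \<and>
     (\<forall>c\<in>atlas M. smooth_on (\<lambda>t. cmap c (\<gamma> t)) (I \<inter> \<gamma> -` cdom c))"

definition velocity :: "('m, 'e::euclidean_space, 'z) manifold_scheme \<Rightarrow> (real \<Rightarrow> 'm) \<Rightarrow> real \<Rightarrow> 'e" where
  "velocity M \<gamma> t = vector_derivative (\<lambda>s. cmap (chart_at M (\<gamma> t)) (\<gamma> s)) (at t)"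

definition regular_curve ::
  "('m::topological_space, 'e::euclidean_space, 'z) manifold_scheme \<Rightarrow> real set \<Rightarrow> (real \<Rightarrow> 'm) \<Rightarrow> bool" where
  "regular_curve M I \<gamma> \<longleftrightarrow> smooth_curve M I \<gamma> \<and> (\<forall>t\<in>I. velocity M \<gamma> t \<noteq> 0)"

text \<open>
  Covariant derivative at \<open>t\<close> of a vector field \<open>V\<close> along \<open>\<gamma>\<close>, computed in a chart \<open>c\<close> around \<open>\<gamma> t\<close>:
  if \<open>V = (\<Sum>b. y\<^sub>b \<partial>\<^sub>b)\<close> then \<open>D\<^sub>t V = (\<Sum>b. y\<^sub>b' \<partial>\<^sub>b + y\<^sub>b \<nabla>\<^bsub>\<gamma>'\<^esub> \<partial>\<^sub>b)\<close>, where \<open>\<gamma>' = (\<Sum>a. x\<^sub>a' \<partial>\<^sub>a)\<close>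
  and the coordinate field \<open>\<partial>\<^sub>a\<close> of \<open>c\<close> is \<open>\<lambda>q. tvec M c q a\<close>.
\<close>

definition cov_along ::
  "('m, 'e::euclidean_space, 'z) manifold_scheme \<Rightarrow> (('m \<Rightarrow> 'e) \<Rightarrow> ('m \<Rightarrow> 'e) \<Rightarrow> 'm \<Rightarrow> 'e) \<Rightarrow>
   ('m, 'e) chart \<Rightarrow> (real \<Rightarrow> 'm) \<Rightarrow> (real \<Rightarrow> 'e) \<Rightarrow> real \<Rightarrow> 'e" where
  "cov_along M D c \<gamma> V t =
     (let x' = vector_derivative (\<lambda>s. cmap c (\<gamma> s)) (at t);
          y = (\<lambda>s. tcoord M c (\<gamma> s) (V s))
      in tvec M c (\<gamma> t) (vector_derivative y (at t)) +
         (\<Sum>a\<in>Basis. \<Sum>b\<in>Basis. ((x' \<bullet> a) * (y t \<bullet> b)) *\<^sub>R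
             D (\<lambda>q. tvec M c q a) (\<lambda>q. tvec M c q b) (\<gamma> t)))"

definition geodesic ::
  "('m::topological_space, 'e::euclidean_space, 'z) manifold_scheme \<Rightarrow>
   (('m \<Rightarrow> 'e) \<Rightarrow> ('m \<Rightarrow> 'e) \<Rightarrow> 'm \<Rightarrow> 'e) \<Rightarrow> real set \<Rightarrow> (real \<Rightarrow> 'm) \<Rightarrow> bool" where
  "geodesic M D I \<gamma> \<longleftrightarrow> smooth_curve M I \<gamma> \<and>
     (\<forall>t\<in>I. \<forall>c\<in>atlas M. \<gamma> t \<in> cdom c \<longrightarrow> cov_along M D c \<gamma> (velocity M \<gamma>) t = 0)"


section \<open>Riemannian maps and O'Neill tensors\<close>

definition vertical_space ::
  "('m, 'e::euclidean_space) riemannian \<Rightarrow> ('n, 'd::euclidean_space) riemannian \<Rightarrow> ('m \<Rightarrow> 'n) \<Rightarrow>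
   'm \<Rightarrow> 'e set" where
  "vertical_space M N \<phi> p = {v. tmap M N \<phi> p v = 0}"

definition horizontal_space ::
  "('m, 'e::euclidean_space) riemannian \<Rightarrow> ('n, 'd::euclidean_space) riemannian \<Rightarrow> ('m \<Rightarrow> 'n) \<Rightarrow>
   'm \<Rightarrow> 'e set" where
  "horizontal_space M N \<phi> p = {v. \<forall>w\<in>vertical_space M N \<phi> p. gmetric M p v w = 0}"

definition orth_proj :: "('e::real_vector \<Rightarrow> 'e \<Rightarrow> real) \<Rightarrow> 'e set \<Rightarrow> 'e \<Rightarrow> 'e" where
  "orth_proj g S v = (THE u. u \<in> S \<and> (\<forall>w\<in>S. g (v - u) w = 0))"

definition vproj ::
  "('m, 'e::euclidean_space) riemannian \<Rightarrow> ('n, 'd::euclidean_space) riemannian \<Rightarrow> ('m \<Rightarrow> 'n) \<Rightarrow>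
   'm \<Rightarrow> 'e \<Rightarrow> 'e" where
  "vproj M N \<phi> p = orth_proj (gmetric M p) (vertical_space M N \<phi> p)"

definition hproj ::
  "('m, 'e::euclidean_space) riemannian \<Rightarrow> ('n, 'd::euclidean_space) riemannian \<Rightarrow> ('m \<Rightarrow> 'n) \<Rightarrow>
   'm \<Rightarrow> 'e \<Rightarrow> 'e" where
  "hproj M N \<phi> p = orth_proj (gmetric M p) (horizontal_space M N \<phi> p)"

definition riemannian_map ::
  "('m::topological_space, 'e::euclidean_space) riemannian \<Rightarrow>
   ('n::topological_space, 'd::euclidean_space) riemannian \<Rightarrow> ('m \<Rightarrow> 'n) \<Rightarrow> bool" where
  "riemannian_map M N \<phi> \<longleftrightarrow> smooth_map M N \<phi> \<and>
     (\<forall>p. 0 < dim (range (tmap M N \<phi> p)) \<and>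
          dim (range (tmap M N \<phi> p)) \<le> min DIM('e) DIM('d) \<and>
          bij_betw (tmap M N \<phi> p) (horizontal_space M N \<phi> p) (range (tmap M N \<phi> p)) \<and>
          (\<forall>u\<in>horizontal_space M N \<phi> p. \<forall>v\<in>horizontal_space M N \<phi> p.
             gmetric N (\<phi> p) (tmap M N \<phi> p u) (tmap M N \<phi> p v) = gmetric M p u v))"

definition riemannian_warped_product_map ::
  "('m1::{t2_space,second_countable_topology}, 'e1::euclidean_space) riemannian \<Rightarrow> ('m1 \<Rightarrow> real) \<Rightarrow>
   ('m2::{t2_space,second_countable_topology}, 'e2::euclidean_space) riemannian \<Rightarrow>
   ('n1::{t2_space,second_countable_topology}, 'd1::euclidean_space) riemannian \<Rightarrow> ('n1 \<Rightarrow> real) \<Rightarrow>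
   ('n2::{t2_space,second_countable_topology}, 'd2::euclidean_space) riemannian \<Rightarrow>
   ('m1 \<Rightarrow> 'n1) \<Rightarrow> ('m2 \<Rightarrow> 'n2) \<Rightarrow> ('m1 \<times> 'm2 \<Rightarrow> 'n1 \<times> 'n2) \<Rightarrow> bool" where
  "riemannian_warped_product_map M1 f M2 N1 \<rho> N2 \<phi>1 \<phi>2 \<phi> \<longleftrightarrow>
     riemannian_manifold M1 \<and> riemannian_manifold M2 \<and>
     riemannian_manifold N1 \<and> riemannian_manifold N2 \<and>
     smooth_fun M1 UNIV f \<and> (\<forall>p. 0 < f p) \<and>
     smooth_fun N1 UNIV \<rho> \<and> (\<forall>p. 0 < \<rho> p) \<and>
     riemannian_map M1 N1 \<phi>1 \<and> riemannian_map M2 N2 \<phi>2 \<and>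
     \<phi> = map_prod \<phi>1 \<phi>2"

definition oneill_T ::
  "('m, 'e::euclidean_space) riemannian \<Rightarrow> ('n, 'd::euclidean_space) riemannian \<Rightarrow> ('m \<Rightarrow> 'n) \<Rightarrow>
   (('m \<Rightarrow> 'e) \<Rightarrow> ('m \<Rightarrow> 'e) \<Rightarrow> 'm \<Rightarrow> 'e) \<Rightarrow> ('m \<Rightarrow> 'e) \<Rightarrow> ('m \<Rightarrow> 'e) \<Rightarrow> 'm \<Rightarrow> 'e" where
  "oneill_T M N \<phi> D E F p =
     (let V = (\<lambda>X q. vproj M N \<phi> q (X q)); H = (\<lambda>X q. hproj M N \<phi> q (X q))
      in H (D (V E) (V F)) p + V (D (V E) (H F)) p)"

definition oneill_A ::
  "('m, 'e::euclidean_space) riemannian \<Rightarrow> ('n, 'd::euclidean_space) riemannian \<Rightarrow> ('m \<Rightarrow> 'n) \<Rightarrow>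
   (('m \<Rightarrow> 'e) \<Rightarrow> ('m \<Rightarrow> 'e) \<Rightarrow> 'm \<Rightarrow> 'e) \<Rightarrow> ('m \<Rightarrow> 'e) \<Rightarrow> ('m \<Rightarrow> 'e) \<Rightarrow> 'm \<Rightarrow> 'e" where
  "oneill_A M N \<phi> D E F p =
     (let V = (\<lambda>X q. vproj M N \<phi> q (X q)); H = (\<lambda>X q. hproj M N \<phi> q (X q))
      in H (D (H E) (V F)) p + V (D (H E) (H F)) p)"

text \<open>\<open>vnabla\<close> is the connection \<open>\<V>\<nabla>\<close> (for vertical fields: the induced connection on the fibres),
  \<open>hnabla\<close> is \<open>\<H>\<nabla>\<close>.\<close>

definition vnabla ::
  "('m, 'e::euclidean_space) riemannian \<Rightarrow> ('n, 'd::euclidean_space) riemannian \<Rightarrow> ('m \<Rightarrow> 'n) \<Rightarrow>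
   (('m \<Rightarrow> 'e) \<Rightarrow> ('m \<Rightarrow> 'e) \<Rightarrow> 'm \<Rightarrow> 'e) \<Rightarrow> ('m \<Rightarrow> 'e) \<Rightarrow> ('m \<Rightarrow> 'e) \<Rightarrow> 'm \<Rightarrow> 'e" where
  "vnabla M N \<phi> D X Y p = vproj M N \<phi> p (D X Y p)"

definition hnabla ::
  "('m, 'e::euclidean_space) riemannian \<Rightarrow> ('n, 'd::euclidean_space) riemannian \<Rightarrow> ('m \<Rightarrow> 'n) \<Rightarrow>
   (('m \<Rightarrow> 'e) \<Rightarrow> ('m \<Rightarrow> 'e) \<Rightarrow> 'm \<Rightarrow> 'e) \<Rightarrow> ('m \<Rightarrow> 'e) \<Rightarrow> ('m \<Rightarrow> 'e) \<Rightarrow> 'm \<Rightarrow> 'e" where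
  "hnabla M N \<phi> D X Y p = hproj M N \<phi> p (D X Y p)"

text \<open>
  The local vector field \<open>X\<close>, a smooth section of the distribution \<open>S\<close> on a neighbourhood of \<open>\<gamma> t\<close>,
  extends the vector field \<open>Z\<close> along \<open>\<gamma>\<close> near the parameter \<open>t\<close>.
\<close>

definition local_extension ::
  "('m::topological_space, 'e::euclidean_space, 'z) manifold_scheme \<Rightarrow> ('m \<Rightarrow> 'e set) \<Rightarrow>
   (real \<Rightarrow> 'm) \<Rightarrow> (real \<Rightarrow> 'e) \<Rightarrow> real \<Rightarrow> ('m \<Rightarrow> 'e) \<Rightarrow> bool" where
  "local_extension M S \<gamma> Z t X \<longleftrightarrow>
     (\<exists>W K. open W \<and> \<gamma> t \<in> W \<and> smooth_vf M W X \<and> (\<forall>q\<in>W. X q \<in> S q) \<and>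
        open K \<and> t \<in> K \<and> (\<forall>s\<in>K. X (\<gamma> s) = Z s))"

text \<open>
  All components \<open>U\<^sub>i = \<V>\<^sub>i \<gamma>\<^sub>i'\<close> and \<open>Y\<^sub>i = \<H>\<^sub>i \<gamma>\<^sub>i'\<close> of the velocity of a curve in a product are treated as
  local vector fields on the factors near the parameter \<open>t\<close>.
\<close>

definition component_fields ::
  "('m::topological_space, 'e::euclidean_space) riemannian \<Rightarrow> ('n, 'd::euclidean_space) riemannian \<Rightarrow>
   ('m \<Rightarrow> 'n) \<Rightarrow> (real \<Rightarrow> 'm) \<Rightarrow> real \<Rightarrow> ('m \<Rightarrow> 'e) \<Rightarrow> ('m \<Rightarrow> 'e) \<Rightarrow> bool" where
  "component_fields M N \<phi> \<gamma> t U Y \<longleftrightarrow>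
     local_extension M (vertical_space M N \<phi>) \<gamma> (\<lambda>s. vproj M N \<phi> (\<gamma> s) (velocity M \<gamma> s)) t U \<and>
     local_extension M (horizontal_space M N \<phi>) \<gamma> (\<lambda>s. hproj M N \<phi> (\<gamma> s) (velocity M \<gamma> s)) t Y"

end

theory Submission
  imports Defs
begin

text \<open>
  In coordinate fields the Koszul formula determines both \<open>\<nabla>\<^sup>M\<close> and the connections of the factors; comparing
  the two gives the acceleration of \<open>\<gamma>\<close> as
  \<open>(\<nabla>\<^sub>1 - f\<^sup>2 g\<^sub>2(v\<^sub>2, v\<^sub>2) grad ln f, \<nabla>\<^sub>2 + 2 (v\<^sub>1(f) / f) v\<^sub>2)\<close>, where \<open>v\<^sub>i\<close> is the velocity of \<open>\<gamma>\<^sub>i\<close> and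
  \<open>\<nabla>\<^sub>i\<close> its acceleration in \<open>M\<^sub>i\<close>. At a parameter where local extensions \<open>U\<^sub>i\<close>, \<open>Y\<^sub>i\<close> exist, \<open>\<nabla>\<^sub>i\<close> is the
  covariant derivative of \<open>U\<^sub>i + Y\<^sub>i\<close> along itself, and its four terms have the O'Neill tensors as vertical
  and horizontal parts. Since the acceleration is continuous, its vanishing on the dense set \<open>J\<close>
  suffices.
\<close>


subsection \<open>Calculus of smooth maps\<close>

text \<open>Coordinate fields suffice because the covariant derivative along a curve evaluates the
  connection on nothing else. Their brackets vanish, so only derivatives of the metric coefficients
  \<open>g1 + f^2 g2\<close> remain, and the product rule reduces these to the coefficients of the
  factors and the derivative of \<open>f\<close>. The set \<open>J\<close> answers a real obstacle.
  Where the extensions exist, the factor curve is near \<open>t\<close> an integral curve of the sum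
  of its two component fields, so it is constant near \<open>t\<close> as soon as it stops at
  \<open>t\<close>. A factor of a regular curve may stop or turn back at an isolated parameter, like
  \<open>s^2\<close> at 0; no extension exists there, yet the geodesic equation is demanded there. A
  second obstacle is formal: a connection acts on total functions, and a tangent vector is given in
  a preferred chart that may jump from point to point. Hence fields are exchanged through locality
  of the connection, and continuity and differentiability are stated for components in a fixed
  chart.\<close>

text \<open>Functions that agree on an open set have the same derivatives there in the sense of
  \<open>has_derivative\<close>, so the choice made by \<open>frechet_derivative\<close> agrees too,
  even where no derivative exists. This feeds the induction, in which both functions vary.\<close>

lemma Ck_on_cong:
  assumes "open S" "\<And>x. x \<in> S \<Longrightarrow> F x = G x"
  shows "Ck_on k F S \<longleftrightarrow> Ck_on k G S"
  using assms(2)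
proof (induction k arbitrary: F G)
  case 0
  then show ?case by (auto intro: continuous_on_cong)
next
  case (Suc k)
  have D: "F differentiable (at x) \<longleftrightarrow> G differentiable (at x)" if "x \<in> S" for x
  proof -
    have "(F has_derivative L) (at x) \<longleftrightarrow> (G has_derivative L) (at x)" for L
      using has_derivative_transform_within_open[OF _ assms(1) that, of F L UNIV G]
        has_derivative_transform_within_open[OF _ assms(1) that, of G L UNIV F] Suc.prems by auto
    then show ?thesis by (auto simp: differentiable_def)
  qed
  have E: "frechet_derivative F (at x) = frechet_derivative G (at x)" if "x \<in> S" for x
  proof -
    have "(F has_derivative L) (at x) \<longleftrightarrow> (G has_derivative L) (at x)" for L
      using has_derivative_transform_within_open[OF _ assms(1) that, of F L UNIV G]
        has_derivative_transform_within_open[OF _ assms(1) that, of G L UNIV F] Suc.prems by auto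
    then show ?thesis by (simp add: frechet_derivative_def)
  qed
  have "Ck_on k (\<lambda>x. frechet_derivative F (at x) v) S \<longleftrightarrow> Ck_on k (\<lambda>x. frechet_derivative G (at x) v) S" for v
    by (rule Suc.IH) (simp add: E)
  with D show ?case by simp
qed

lemma Ck_on_subset: "Ck_on k F S \<Longrightarrow> T \<subseteq> S \<Longrightarrow> Ck_on k F T"
  by (induction k arbitrary: F) (auto intro: continuous_on_subset)

lemma Ck_on_Suc_imp: "Ck_on (Suc k) F S \<Longrightarrow> Ck_on k F S"
proof (induction k arbitrary: F)
  case 0
  then show ?case
    by (auto intro!: differentiable_imp_continuous_on
        simp: differentiable_on_def differentiable_at_withinI)
next
  case (Suc k)
  then show ?case by (metis Ck_on.simps(2))
qed

text \<open>The closure proofs below all run through this rule: an explicit derivative is exhibited,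
  and \<open>frechet_derivative\<close> never has to be computed.\<close>

lemma Ck_on_SucI:
  assumes "open S" "\<And>x. x \<in> S \<Longrightarrow> (F has_derivative F' x) (at x)"
    and "\<And>v. Ck_on k (\<lambda>x. F' x v) S"
  shows "Ck_on (Suc k) F S"
proof -
  have "frechet_derivative F (at x) = F' x" if "x \<in> S" for x
    using assms(2)[OF that] by (rule frechet_derivative_at[symmetric])
  then have "Ck_on k (\<lambda>x. frechet_derivative F (at x) v) S" for v
    using Ck_on_cong[OF assms(1), of "\<lambda>x. frechet_derivative F (at x) v" "\<lambda>x. F' x v"] assms(3) by auto
  with assms(2) show ?thesis by (auto simp: differentiable_def)
qed

lemma Ck_on_Suc_has_derivative:
  "Ck_on (Suc k) F S \<Longrightarrow> x \<in> S \<Longrightarrow> (F has_derivative frechet_derivative F (at x)) (at x)"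
  by (simp add: frechet_derivative_works)

text \<open>Differentiability at a point is local and the induction passes to directional
  derivatives. It serves to glue pieces of a curve in one factor, each obtained from a different
  product chart.\<close>

lemma Ck_on_locally:
  assumes "\<And>x. x \<in> S \<Longrightarrow> \<exists>T. open T \<and> x \<in> T \<and> Ck_on k F T"
  shows "Ck_on k F S"
  using assms
proof (induction k arbitrary: F)
  case 0
  then show ?case
    by (metis Ck_on.simps(1) continuous_at_imp_continuous_on continuous_on_eq_continuous_at)
next
  case (Suc k)
  have "F differentiable (at x)" if "x \<in> S" for x
    using Suc.prems[OF that] by auto
  moreover have "Ck_on k (\<lambda>x. frechet_derivative F (at x) v) S" for v
    by (rule Suc.IH) (use Suc.prems in fastforce)
  ultimately show ?case by simp
qed

lemma Ck_on_const: "open S \<Longrightarrow> Ck_on k (\<lambda>x. a) S"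
proof (induction k arbitrary: a)
  case (Suc k)
  show ?case by (rule Ck_on_SucI[where F' = "\<lambda>x v. 0"]) (auto simp: Suc)
qed simp

lemma Ck_on_linear_compose:
  assumes "open S" "bounded_linear L" "Ck_on k F S"
  shows "Ck_on k (\<lambda>x. L (F x)) S"
  using assms(3)
proof (induction k arbitrary: F)
  case 0
  then show ?case by (simp add: bounded_linear.continuous_on[OF assms(2)])
next
  case (Suc k)
  show ?case
    by (rule Ck_on_SucI[OF assms(1), where F' = "\<lambda>x v. L (frechet_derivative F (at x) v)"])
      (use Suc in \<open>auto intro!: bounded_linear.has_derivative[OF assms(2)] simp: frechet_derivative_works[symmetric]\<close>)
qed

lemma Ck_on_linear:
  assumes "open S" "bounded_linear L"
  shows "Ck_on k L S"
proof (cases k)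
  case 0
  then show ?thesis using assms linear_continuous_on by auto
next
  case (Suc j)
  show ?thesis unfolding Suc
    by (rule Ck_on_SucI[OF assms(1), where F' = "\<lambda>x. L"])
      (use assms in \<open>auto intro: bounded_linear_imp_has_derivative Ck_on_const\<close>)
qed

lemma Ck_on_add:
  assumes "open S" "Ck_on k F S" "Ck_on k G S"
  shows "Ck_on k (\<lambda>x. F x + G x) S"
  using assms(2,3)
proof (induction k arbitrary: F G)
  case 0
  then show ?case by (simp add: continuous_on_add)
next
  case (Suc k)
  show ?case
    by (rule Ck_on_SucI[OF assms(1),
          where F' = "\<lambda>x v. frechet_derivative F (at x) v + frechet_derivative G (at x) v"])
      (use Suc in \<open>auto intro!: has_derivative_add simp: frechet_derivative_works[symmetric]\<close>)
qed

lemma Ck_on_sum: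
  assumes "open S" "\<And>i. i \<in> I \<Longrightarrow> Ck_on k (F i) S"
  shows "Ck_on k (\<lambda>x. \<Sum>i\<in>I. F i x) S"
  using assms(2)
  by (induction I rule: infinite_finite_induct) (auto intro: Ck_on_const Ck_on_add assms(1))

lemma Ck_on_scaleR:
  fixes F :: "'a::euclidean_space \<Rightarrow> real"
  assumes "open S" "Ck_on k F S" "Ck_on k G S"
  shows "Ck_on k (\<lambda>x. F x *\<^sub>R G x) S"
  using assms(2,3)
proof (induction k arbitrary: F G)
  case 0
  then show ?case by (simp add: continuous_on_scaleR)
next
  case (Suc k)
  show ?case
  proof (rule Ck_on_SucI[OF assms(1),
          where F' = "\<lambda>x v. F x *\<^sub>R frechet_derivative G (at x) v + frechet_derivative F (at x) v *\<^sub>R G x"])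
    show "((\<lambda>x. F x *\<^sub>R G x) has_derivative
        (\<lambda>v. F x *\<^sub>R frechet_derivative G (at x) v + frechet_derivative F (at x) v *\<^sub>R G x)) (at x)"
      if "x \<in> S" for x
      using Suc.prems that by (intro has_derivative_scaleR) (auto intro: Ck_on_Suc_has_derivative)
    show "Ck_on k (\<lambda>x. F x *\<^sub>R frechet_derivative G (at x) v + frechet_derivative F (at x) v *\<^sub>R G x) S" for v
      using Suc.prems Ck_on_Suc_imp[OF Suc.prems(1)] Ck_on_Suc_imp[OF Suc.prems(2)]
      by (intro Ck_on_add[OF assms(1)] Suc.IH) auto
  qed
qed

text \<open>\<open>Ck_on\<close> controls derivatives only in a fixed direction, whereas the chain
  rule differentiates \<open>F\<close> in the direction \<open>DG(x) v\<close>, which moves with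
  \<open>x\<close>. Expanding that direction in the basis leaves fixed directions with scalar
  coefficients, to which the induction hypothesis and the product rule apply.\<close>

lemma Ck_on_compose:
  fixes G :: "'a::euclidean_space \<Rightarrow> 'b::euclidean_space"
  assumes "open S" "open T" "Ck_on k F T" "Ck_on k G S" "G ` S \<subseteq> T"
  shows "Ck_on k (\<lambda>x. F (G x)) S"
  using assms(3,4)
proof (induction k arbitrary: F)
  case 0
  then show ?case
    using assms(5) continuous_on_compose2 by auto
next
  case (Suc k)
  let ?D = "\<lambda>x v. \<Sum>i\<in>Basis. (frechet_derivative G (at x) v \<bullet> i) *\<^sub>R frechet_derivative F (at (G x)) i"
  show ?case
  proof (rule Ck_on_SucI[OF assms(1), where F' = ?D])
    fix x assume x: "x \<in> S"
    have F: "(F has_derivative frechet_derivative F (at (G x))) (at (G x))"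
      and G: "(G has_derivative frechet_derivative G (at x)) (at x)"
      using Ck_on_Suc_has_derivative[OF Suc.prems(1), of "G x"]
        Ck_on_Suc_has_derivative[OF Suc.prems(2) x] x assms(5) by blast+
    have lin: "linear (frechet_derivative F (at (G x)))"
      using F by (rule has_derivative_linear)
    have rep: "frechet_derivative F (at (G x)) w = (\<Sum>i\<in>Basis. (w \<bullet> i) *\<^sub>R frechet_derivative F (at (G x)) i)" for w
    proof -
      have rep: "frechet_derivative F (at (G x)) w = frechet_derivative F (at (G x)) (\<Sum>i\<in>Basis. (w \<bullet> i) *\<^sub>R i)"
        by (simp add: euclidean_representation)
      then show ?thesis by (simp add: linear_sum[OF lin] linear_scale[OF lin])
    qed
    have "frechet_derivative F (at (G x)) \<circ> frechet_derivative G (at x) = ?D x"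
      unfolding o_def by (rule ext) (rule rep)
    with diff_chain_at[OF G F]
    show "((\<lambda>x. F (G x)) has_derivative ?D x) (at x)"
      by (simp add: o_def)
  next
    fix v
    show "Ck_on k (\<lambda>x. ?D x v) S"
    proof (intro Ck_on_sum Ck_on_scaleR assms(1))
      fix i :: 'b assume "i \<in> Basis"
      show "Ck_on k (\<lambda>x. frechet_derivative G (at x) v \<bullet> i) S"
        using Suc.prems(2) by (intro Ck_on_linear_compose[OF assms(1) bounded_linear_inner_left]) simp
      show "Ck_on k (\<lambda>x. frechet_derivative F (at (G x)) i) S"
        using Suc.prems(1) by (intro Suc.IH Ck_on_Suc_imp[OF Suc.prems(2)]) simp
    qed
  qed
qed

section \<open>Infinitely differentiable functions\<close>

lemma smooth_on_cong:
  "open S \<Longrightarrow> (\<And>x. x \<in> S \<Longrightarrow> F x = G x) \<Longrightarrow> smooth_on F S \<longleftrightarrow> smooth_on G S"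
  unfolding smooth_on_def using Ck_on_cong by blast

lemma smooth_on_subset: "smooth_on F S \<Longrightarrow> T \<subseteq> S \<Longrightarrow> smooth_on F T"
  unfolding smooth_on_def using Ck_on_subset by blast

lemma smooth_on_has_derivative:
  assumes "smooth_on F S" "x \<in> S"
  shows "(F has_derivative frechet_derivative F (at x)) (at x)"
  using assms Ck_on_Suc_has_derivative[of 0] unfolding smooth_on_def by blast

lemma smooth_on_frechet_derivative:
  assumes "smooth_on F S"
  shows "smooth_on (\<lambda>x. frechet_derivative F (at x) v) S"
  using assms unfolding smooth_on_def by (metis Ck_on.simps(2))

lemma smooth_on_imp_continuous_on: "smooth_on F S \<Longrightarrow> continuous_on S F"
  unfolding smooth_on_def by (metis Ck_on.simps(1))

lemma smooth_on_locally:
  assumes "\<And>x. x \<in> S \<Longrightarrow> \<exists>T. open T \<and> x \<in> T \<and> smooth_on F T"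
  shows "smooth_on F S"
  unfolding smooth_on_def
  using assms by (intro allI Ck_on_locally) (meson smooth_on_def)

lemma smooth_on_const: "open S \<Longrightarrow> smooth_on (\<lambda>x. a) S"
  by (simp add: smooth_on_def Ck_on_const)

lemma smooth_on_linear: "open S \<Longrightarrow> bounded_linear L \<Longrightarrow> smooth_on L S"
  by (simp add: smooth_on_def Ck_on_linear)

lemma smooth_on_linear_compose:
  "open S \<Longrightarrow> bounded_linear L \<Longrightarrow> smooth_on F S \<Longrightarrow> smooth_on (\<lambda>x. L (F x)) S"
  by (simp add: smooth_on_def Ck_on_linear_compose)

lemma smooth_on_add:
  "open S \<Longrightarrow> smooth_on F S \<Longrightarrow> smooth_on G S \<Longrightarrow> smooth_on (\<lambda>x. F x + G x) S"
  by (simp add: smooth_on_def Ck_on_add)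

lemma smooth_on_scaleR:
  fixes F :: "'a::euclidean_space \<Rightarrow> real"
  shows "open S \<Longrightarrow> smooth_on F S \<Longrightarrow> smooth_on G S \<Longrightarrow> smooth_on (\<lambda>x. F x *\<^sub>R G x) S"
  by (simp add: smooth_on_def Ck_on_scaleR)

lemma smooth_on_compose:
  fixes G :: "'a::euclidean_space \<Rightarrow> 'b::euclidean_space"
  assumes "open S" "open T" "smooth_on F T" "smooth_on G S" "G ` S \<subseteq> T"
  shows "smooth_on (\<lambda>x. F (G x)) S"
  using assms by (simp add: smooth_on_def Ck_on_compose[OF assms(1,2)])

text \<open>The map is the sum of \<open>(F (fst x), 0)\<close> and \<open>(0, G (snd x))\<close>,
  so composition, linear maps and addition already cover it.\<close>

lemma smooth_on_map_prod:
  fixes F :: "'a::euclidean_space \<Rightarrow> 'b::euclidean_space" and G :: "'c::euclidean_space \<Rightarrow> 'd::euclidean_space"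
  assumes S: "open S" and T: "open T" and F: "smooth_on F S" and G: "smooth_on G T"
  shows "smooth_on (map_prod F G) (S \<times> T)"
proof -
  have o: "open (S \<times> T)" using S T by (rule open_Times)
  have lin: "bounded_linear (\<lambda>u::'b. (u, 0::'d))" "bounded_linear (\<lambda>u::'d. (0::'b, u))"
    by (intro bounded_linear_Pair bounded_linear_ident bounded_linear_zero)+
  have "smooth_on (\<lambda>x. F (fst x)) (S \<times> T)"
    by (rule smooth_on_compose[OF o S F smooth_on_linear[OF o bounded_linear_fst]]) auto
  note F' = smooth_on_linear_compose[OF o lin(1) this]
  have "smooth_on (\<lambda>x. G (snd x)) (S \<times> T)"
    by (rule smooth_on_compose[OF o T G smooth_on_linear[OF o bounded_linear_snd]]) auto
  note G' = smooth_on_linear_compose[OF o lin(2) this]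
  from smooth_on_add[OF o F' G']
  show ?thesis by (simp add: map_prod_def case_prod_unfold)
qed


subsection \<open>Charts and coordinates of tangent vectors\<close>

lemma cinv_cmap: "is_chart c \<Longrightarrow> p \<in> cdom c \<Longrightarrow> cinv c (cmap c p) = p"
  by (auto simp: is_chart_def homeomorphism_def)

lemma cmap_cinv: "is_chart c \<Longrightarrow> x \<in> cimage c W \<Longrightarrow> cmap c (cinv c x) = x"
  by (auto simp: cinv_cmap cimage_def)

lemma cinv_in_cdom: "is_chart c \<Longrightarrow> x \<in> cimage c W \<Longrightarrow> cinv c x \<in> cdom c"
  by (auto simp: cinv_cmap cimage_def)

lemma cinv_in: "is_chart c \<Longrightarrow> x \<in> cimage c W \<Longrightarrow> cinv c x \<in> W"
  by (auto simp: cinv_cmap cimage_def)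

lemma cmap_in_cimage: "p \<in> cdom c \<Longrightarrow> p \<in> W \<Longrightarrow> cmap c p \<in> cimage c W"
  by (auto simp: cimage_def)

lemma cimage_mono: "V \<subseteq> W \<Longrightarrow> cimage c V \<subseteq> cimage c W"
  by (auto simp: cimage_def)

lemma open_cimage:
  assumes "is_chart c" "open W"
  shows "open (cimage c W)"
proof -
  have "cimage c W = cimage c UNIV \<inter> cinv c -` W"
    using assms(1) by (auto simp: cimage_def cinv_cmap)
  moreover have "continuous_on (cimage c UNIV) (cinv c)" "open (cimage c UNIV)"
    using assms(1) by (auto simp: is_chart_def homeomorphism_def)
  ultimately show ?thesis
    using assms(2) by (simp add: continuous_open_preimage)
qed

lemma smooth_vf_subset: "smooth_vf M W X \<Longrightarrow> V \<subseteq> W \<Longrightarrow> smooth_vf M V X"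
  unfolding smooth_vf_def by (meson cimage_mono smooth_on_subset)

text \<open>The Jacobian of a transition map. \<open>tcoord\<close> and \<open>tvec\<close> are the
  two instances with the preferred chart on one side, so their algebra reduces to the cocycle rule
  for \<open>transd\<close>.\<close>

definition transd :: "('m, 'e::euclidean_space) chart \<Rightarrow> ('m, 'e) chart \<Rightarrow> 'm \<Rightarrow> 'e \<Rightarrow> 'e" where
  "transd c d p = frechet_derivative (\<lambda>x. cmap d (cinv c x)) (at (cmap c p))"

lemma tcoord_transd: "tcoord M c p = transd (chart_at M p) c p"
  by (simp add: tcoord_def transd_def fun_eq_iff)

lemma tvec_transd: "tvec M c p = transd c (chart_at M p) p"
  by (simp add: tvec_def transd_def fun_eq_iff)

context
  fixes M :: "('m::{t2_space,second_countable_topology}, 'e::euclidean_space, 'z) manifold_scheme"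
  assumes M: "smooth_manifold M"
begin

lemma is_chart_atlas: "c \<in> atlas M \<Longrightarrow> is_chart c"
  using M by (simp add: smooth_manifold_def)

lemma open_cdom: "c \<in> atlas M \<Longrightarrow> open (cdom c)"
  using is_chart_atlas by (simp add: is_chart_def)

lemma open_cimage_atlas: "c \<in> atlas M \<Longrightarrow> open W \<Longrightarrow> open (cimage c W)"
  using is_chart_atlas open_cimage by blast

lemma chart_at_atlas: "chart_at M p \<in> atlas M" "p \<in> cdom (chart_at M p)"
  using M by (simp_all add: smooth_manifold_def)

lemma smooth_transition:
  "c \<in> atlas M \<Longrightarrow> d \<in> atlas M \<Longrightarrow> smooth_on (\<lambda>x. cmap d (cinv c x)) (cimage c (cdom d))"
  using M by (simp add: smooth_manifold_def)

lemma transd_has_derivative: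
  assumes "c \<in> atlas M" "d \<in> atlas M" "p \<in> cdom c" "p \<in> cdom d"
  shows "((\<lambda>x. cmap d (cinv c x)) has_derivative transd c d p) (at (cmap c p))"
  unfolding transd_def
  using assms by (intro smooth_on_has_derivative[OF smooth_transition] cmap_in_cimage)

lemma linear_transd:
  assumes "c \<in> atlas M" "d \<in> atlas M" "p \<in> cdom c" "p \<in> cdom d"
  shows "linear (transd c d p)"
  using transd_has_derivative[OF assms] by (rule has_derivative_linear)

text \<open>Near the point, \<open>h\<close> read in \<open>d\<close> is \<open>h\<close> read in
  \<open>c\<close> after the transition map. With a chart map for \<open>h\<close> this yields the
  cocycle rule, with a real function it makes \<open>dfun\<close> independent of the chart.\<close>

lemma has_derivative_change_chart:
  fixes h :: "'m \<Rightarrow> 'b::real_normed_vector"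
  assumes c: "c \<in> atlas M" "p \<in> cdom c" and d: "d \<in> atlas M" "p \<in> cdom d"
    and h: "((\<lambda>x. h (cinv c x)) has_derivative L) (at (cmap c p))"
  shows "((\<lambda>x. h (cinv d x)) has_derivative (\<lambda>v. L (transd d c p v))) (at (cmap d p))"
proof (rule has_derivative_transform_within_open)
  have "cmap c (cinv d (cmap d p)) = cmap c p"
    using d is_chart_atlas by (simp add: cinv_cmap)
  then show "((\<lambda>x. h (cinv c (cmap c (cinv d x)))) has_derivative (\<lambda>v. L (transd d c p v))) (at (cmap d p))"
    using diff_chain_at[OF transd_has_derivative[OF d(1) c(1) d(2) c(2)], of "\<lambda>x. h (cinv c x)" L] h
    by (simp add: o_def)
  show "open (cimage d (cdom c))"
    using c d by (intro open_cimage_atlas open_cdom)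
  show "cmap d p \<in> cimage d (cdom c)"
    using c d by (intro cmap_in_cimage)
  show "h (cinv c (cmap c (cinv d x))) = h (cinv d x)" if "x \<in> cimage d (cdom c)" for x
    using that c(1) d(1) is_chart_atlas cinv_in cinv_cmap by metis
qed

lemma transd_trans:
  assumes "c \<in> atlas M" "p \<in> cdom c" "d \<in> atlas M" "p \<in> cdom d" "e \<in> atlas M" "p \<in> cdom e"
  shows "transd d e p (transd c d p v) = transd c e p v"
proof -
  have "((\<lambda>x. cmap e (cinv c x)) has_derivative (\<lambda>v. transd d e p (transd c d p v))) (at (cmap c p))"
    using assms by (intro has_derivative_change_chart transd_has_derivative)
  from has_derivative_unique[OF this transd_has_derivative[OF assms(1,5,2,6)]]
  show ?thesis by (simp add: fun_eq_iff)
qed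

lemma transd_refl:
  assumes "c \<in> atlas M" "p \<in> cdom c"
  shows "transd c c p v = v"
proof -
  have "((\<lambda>x. cmap c (cinv c x)) has_derivative (\<lambda>v. v)) (at (cmap c p))"
  proof (rule has_derivative_transform_within_open)
    show "((\<lambda>v. v) has_derivative (\<lambda>v. v)) (at (cmap c p))" by simp
    show "open (cimage c UNIV)" "cmap c p \<in> cimage c UNIV"
      using assms by (auto intro: open_cimage_atlas cmap_in_cimage)
    show "x = cmap c (cinv c x)" if "x \<in> cimage c UNIV" for x
      using that assms(1) is_chart_atlas cmap_cinv by metis
  qed
  from has_derivative_unique[OF this transd_has_derivative[OF assms(1,1,2,2)]]
  show ?thesis by (simp add: fun_eq_iff)
qed

lemma linear_tcoord: "c \<in> atlas M \<Longrightarrow> p \<in> cdom c \<Longrightarrow> linear (tcoord M c p)"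
  unfolding tcoord_transd by (rule linear_transd) (simp_all add: chart_at_atlas)

lemma linear_tvec: "c \<in> atlas M \<Longrightarrow> p \<in> cdom c \<Longrightarrow> linear (tvec M c p)"
  unfolding tvec_transd by (rule linear_transd) (simp_all add: chart_at_atlas)

lemma tcoord_tvec_transd:
  "\<lbrakk>c \<in> atlas M; p \<in> cdom c; d \<in> atlas M; p \<in> cdom d\<rbrakk> \<Longrightarrow> tcoord M d p (tvec M c p v) = transd c d p v"
  unfolding tcoord_transd tvec_transd by (rule transd_trans) (simp_all add: chart_at_atlas)

lemma tcoord_tvec: "c \<in> atlas M \<Longrightarrow> p \<in> cdom c \<Longrightarrow> tcoord M c p (tvec M c p v) = v"
  by (simp add: tcoord_tvec_transd transd_refl)

lemma tvec_tcoord: "c \<in> atlas M \<Longrightarrow> p \<in> cdom c \<Longrightarrow> tvec M c p (tcoord M c p v) = v"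
  unfolding tcoord_transd tvec_transd by (simp add: transd_trans transd_refl chart_at_atlas)

lemma tcoord_eq_0_iff: "c \<in> atlas M \<Longrightarrow> p \<in> cdom c \<Longrightarrow> tcoord M c p v = 0 \<longleftrightarrow> v = 0"
  by (metis linear_0 linear_tcoord linear_tvec tvec_tcoord)

lemma tvec_eq_sum:
  assumes "c \<in> atlas M" "p \<in> cdom c"
  shows "tvec M c p v = (\<Sum>b\<in>Basis. (v \<bullet> b) *\<^sub>R tvec M c p b)"
proof -
  have "tvec M c p v = tvec M c p (\<Sum>b\<in>Basis. (v \<bullet> b) *\<^sub>R b)"
    by (simp add: euclidean_representation)
  then show ?thesis
    using linear_tvec[OF assms] by (simp add: linear_sum linear_scale)
qed

text \<open>Frees \<open>dfun\<close> from the preferred chart: a derivative found in any chart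
  around the point may be used.\<close>

lemma dfun_eq:
  assumes "c \<in> atlas M" "p \<in> cdom c" "((\<lambda>x. h (cinv c x)) has_derivative L) (at (cmap c p))"
  shows "dfun M h p v = L (tcoord M c p v)"
  unfolding dfun_def tcoord_transd
  using has_derivative_change_chart[OF assms(1,2) chart_at_atlas assms(3)]
  by (simp add: frechet_derivative_at[symmetric])

lemma smooth_fun_has_derivative:
  assumes "smooth_fun M W h" "c \<in> atlas M" "p \<in> cdom c" "p \<in> W"
  shows "((\<lambda>x. h (cinv c x)) has_derivative (\<lambda>v. dfun M h p (tvec M c p v))) (at (cmap c p))"
proof -
  let ?L = "frechet_derivative (\<lambda>x. h (cinv c x)) (at (cmap c p))"
  have h: "((\<lambda>x. h (cinv c x)) has_derivative ?L) (at (cmap c p))"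
    using assms
    by (intro smooth_on_has_derivative[of _ "cimage c W"]) (auto simp: smooth_fun_def intro: cmap_in_cimage)
  moreover have "?L = (\<lambda>v. dfun M h p (tvec M c p v))"
    using assms by (simp add: dfun_eq[OF _ _ h] tcoord_tvec)
  ultimately show ?thesis by simp
qed


lemma linear_dfun:
  assumes "smooth_fun M W h" "p \<in> W"
  shows "linear (dfun M h p)"
proof -
  \<comment> \<open>In the preferred chart itself, components and tangent vector coincide, so the
    linear map found in that chart is \<open>dfun\<close> itself.\<close>
  have "tvec M (chart_at M p) p v = v" for v
    by (simp add: tvec_transd transd_refl chart_at_atlas)
  then show ?thesis
    using has_derivative_linear[OF smooth_fun_has_derivative[OF assms(1) chart_at_atlas assms(2)]] by simp
qed



subsection \<open>Smooth vector fields\<close>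

lemma smooth_vf_cong:
  assumes "open W" "\<And>q. q \<in> W \<Longrightarrow> X q = Y q" "smooth_vf M W X"
  shows "smooth_vf M W Y"
  unfolding smooth_vf_def
proof
  fix c assume c: "c \<in> atlas M"
  have "smooth_on (\<lambda>x. tcoord M c (cinv c x) (X (cinv c x))) (cimage c W)"
    using assms(3) c by (simp add: smooth_vf_def)
  then show "smooth_on (\<lambda>x. tcoord M c (cinv c x) (Y (cinv c x))) (cimage c W)"
    using assms(2) cinv_in[OF is_chart_atlas[OF c]]
    by (subst smooth_on_cong[OF open_cimage_atlas[OF c assms(1)],
          where G = "\<lambda>x. tcoord M c (cinv c x) (X (cinv c x))"]) auto
qed

lemma smooth_fun_cong:
  assumes "open W" "\<And>q. q \<in> W \<Longrightarrow> h q = k q" "smooth_fun M W h"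
  shows "smooth_fun M W k"
  unfolding smooth_fun_def
proof
  fix c assume c: "c \<in> atlas M"
  have "smooth_on (\<lambda>x. h (cinv c x)) (cimage c W)"
    using assms(3) c by (simp add: smooth_fun_def)
  then show "smooth_on (\<lambda>x. k (cinv c x)) (cimage c W)"
    using assms(2) cinv_in[OF is_chart_atlas[OF c]]
    by (subst smooth_on_cong[OF open_cimage_atlas[OF c assms(1)], where G = "\<lambda>x. h (cinv c x)"]) auto
qed

lemma smooth_fun_const:
  assumes "open W" shows "smooth_fun M W (\<lambda>q. a)"
  unfolding smooth_fun_def using assms by (auto intro: smooth_on_const open_cimage_atlas)

text \<open>On a set inside one chart domain, every other chart reads the function as the given
  smooth one composed with a transition map, so a single chart suffices.\<close>

lemma smooth_fun_chartI:
  assumes c: "c \<in> atlas M" and W: "open W" "W \<subseteq> cdom c"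
    and h: "smooth_on (\<lambda>x. h (cinv c x)) (cimage c W)"
  shows "smooth_fun M W h"
  unfolding smooth_fun_def
proof
  fix d assume d: "d \<in> atlas M"
  have W': "q \<in> cdom c" if "q \<in> W" for q
    using that W(2) by auto
  have o: "open (cimage d W)" "open (cimage c W)"
    using W c d by (auto intro: open_cimage_atlas)
  have "smooth_on (\<lambda>x. h (cinv c (cmap c (cinv d x)))) (cimage d W)"
  proof (rule smooth_on_compose[OF o h])
    show "smooth_on (\<lambda>x. cmap c (cinv d x)) (cimage d W)"
      using smooth_transition[OF d c] cimage_mono[OF W(2)] by (rule smooth_on_subset)
    show "(\<lambda>x. cmap c (cinv d x)) ` cimage d W \<subseteq> cimage c W"
      using cinv_in[OF is_chart_atlas[OF d], of _ W] W' by (auto intro!: cmap_in_cimage)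
  qed
  then show "smooth_on (\<lambda>x. h (cinv d x)) (cimage d W)"
    using cinv_in[OF is_chart_atlas[OF d], of _ W] cinv_cmap[OF is_chart_atlas[OF c]] W'
    by (subst smooth_on_cong[OF o(1), where G = "\<lambda>x. h (cinv c (cmap c (cinv d x)))"]) auto
qed

text \<open>These are the test functions against which the bracket of two coordinate fields will be
  evaluated.\<close>

lemma smooth_fun_coordinate:
  assumes "c \<in> atlas M"
  shows "smooth_fun M (cdom c) (\<lambda>q. cmap c q \<bullet> i)"
proof (rule smooth_fun_chartI[OF assms open_cdom[OF assms]])
  have o: "open (cimage c (cdom c))"
    using assms by (intro open_cimage_atlas open_cdom)
  show "smooth_on (\<lambda>x. cmap c (cinv c x) \<bullet> i) (cimage c (cdom c))"
    by (rule smooth_on_linear_compose[OF o bounded_linear_inner_left smooth_transition[OF assms assms]])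
qed simp

lemma smooth_fun_component:
  assumes "c \<in> atlas M" "open W" "smooth_vf M W X"
  shows "smooth_fun M (W \<inter> cdom c) (\<lambda>q. tcoord M c q (X q) \<bullet> i)"
proof (rule smooth_fun_chartI[OF assms(1)])
  show o: "open (W \<inter> cdom c)"
    using assms open_cdom by blast
  have "smooth_on (\<lambda>x. tcoord M c (cinv c x) (X (cinv c x))) (cimage c (W \<inter> cdom c))"
    using smooth_vf_subset[OF assms(3), of "W \<inter> cdom c"] assms(1) by (simp add: smooth_vf_def)
  from smooth_on_linear_compose[OF open_cimage_atlas[OF assms(1) o] bounded_linear_inner_left this]
  show "smooth_on (\<lambda>x. tcoord M c (cinv c x) (X (cinv c x)) \<bullet> i) (cimage c (W \<inter> cdom c))" .
qed simp

lemma smooth_vf_zero: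
  assumes "open W" shows "smooth_vf M W (\<lambda>q. 0)"
  unfolding smooth_vf_def
proof
  fix c assume c: "c \<in> atlas M"
  have "tcoord M c (cinv c x) 0 = 0" if "x \<in> cimage c W" for x
    using c that cinv_in_cdom[OF is_chart_atlas[OF c]] by (auto simp: tcoord_eq_0_iff)
  then show "smooth_on (\<lambda>x. tcoord M c (cinv c x) 0) (cimage c W)"
    using assms c
    by (subst smooth_on_cong[where G = "\<lambda>x. 0"]) (auto intro: open_cimage_atlas smooth_on_const)
qed

lemma smooth_vf_add:
  assumes "open W" "smooth_vf M W X" "smooth_vf M W Y"
  shows "smooth_vf M W (\<lambda>q. X q + Y q)"
  unfolding smooth_vf_def
proof
  fix c assume c: "c \<in> atlas M"
  have o: "open (cimage c W)" using c assms(1) by (rule open_cimage_atlas)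
  have "tcoord M c (cinv c x) (X (cinv c x) + Y (cinv c x)) =
      tcoord M c (cinv c x) (X (cinv c x)) + tcoord M c (cinv c x) (Y (cinv c x))" if "x \<in> cimage c W" for x
    using linear_tcoord[OF c cinv_in_cdom[OF is_chart_atlas[OF c] that]] by (rule linear_add)
  then show "smooth_on (\<lambda>x. tcoord M c (cinv c x) (X (cinv c x) + Y (cinv c x))) (cimage c W)"
    using smooth_on_add[OF o, of "\<lambda>x. tcoord M c (cinv c x) (X (cinv c x))"
        "\<lambda>x. tcoord M c (cinv c x) (Y (cinv c x))"] assms c
    by (subst smooth_on_cong[OF o]) (auto simp: smooth_vf_def)
qed

lemma smooth_vf_scale:
  assumes "open W" "smooth_fun M W h" "smooth_vf M W X"
  shows "smooth_vf M W (\<lambda>q. h q *\<^sub>R X q)"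
  unfolding smooth_vf_def
proof
  fix c assume c: "c \<in> atlas M"
  have o: "open (cimage c W)" using c assms(1) by (rule open_cimage_atlas)
  have "tcoord M c (cinv c x) (h (cinv c x) *\<^sub>R X (cinv c x)) =
      h (cinv c x) *\<^sub>R tcoord M c (cinv c x) (X (cinv c x))" if "x \<in> cimage c W" for x
    using linear_tcoord[OF c cinv_in_cdom[OF is_chart_atlas[OF c] that]] by (rule linear_scale)
  then show "smooth_on (\<lambda>x. tcoord M c (cinv c x) (h (cinv c x) *\<^sub>R X (cinv c x))) (cimage c W)"
    using smooth_on_scaleR[OF o, of "\<lambda>x. h (cinv c x)" "\<lambda>x. tcoord M c (cinv c x) (X (cinv c x))"]
      assms c
    by (subst smooth_on_cong[OF o]) (auto simp: smooth_vf_def smooth_fun_def)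
qed

lemma smooth_vf_sum:
  assumes "open W" "\<And>i. i \<in> I \<Longrightarrow> smooth_vf M W (X i)"
  shows "smooth_vf M W (\<lambda>q. \<Sum>i\<in>I. X i q)"
  using assms(2)
  by (induction I rule: infinite_finite_induct) (auto intro: smooth_vf_zero smooth_vf_add assms(1))

text \<open>In another chart \<open>d\<close> the components are a partial derivative of the
  transition map from \<open>c\<close> to \<open>d\<close>, evaluated at the point carried back to
  \<open>c\<close>.\<close>

lemma smooth_vf_coordinate:
  assumes c: "c \<in> atlas M"
  shows "smooth_vf M (cdom c) (\<lambda>q. tvec M c q a)"
  unfolding smooth_vf_def
proof
  fix d assume d: "d \<in> atlas M"
  let ?F = "\<lambda>z. frechet_derivative (\<lambda>x. cmap d (cinv c x)) (at z) a"
  have o: "open (cimage d (cdom c))" "open (cimage c (cdom d))"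
    using c d by (intro open_cimage_atlas open_cdom; simp)+
  have im: "cinv d x \<in> cdom c" "cinv d x \<in> cdom d" if "x \<in> cimage d (cdom c)" for x
    using that cinv_in cinv_in_cdom is_chart_atlas d by blast+
  have "smooth_on (\<lambda>x. ?F (cmap c (cinv d x))) (cimage d (cdom c))"
    by (rule smooth_on_compose[OF o(1) o(2) smooth_on_frechet_derivative[OF smooth_transition[OF c d]]
          smooth_transition[OF d c]]) (auto intro: cmap_in_cimage im)
  then show "smooth_on (\<lambda>x. tcoord M d (cinv d x) (tvec M c (cinv d x) a)) (cimage d (cdom c))"
    using im c d by (subst smooth_on_cong[OF o(1)]) (auto simp: tcoord_tvec_transd transd_def)
qed

end


subsection \<open>Velocity of smooth curves\<close>

context
  fixes M :: "('m::{t2_space,second_countable_topology}, 'e::euclidean_space, 'z) manifold_scheme"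
  assumes M: "smooth_manifold M"
begin

lemma open_curve_preimage:
  assumes "smooth_curve M I \<gamma>" "open I" "c \<in> atlas M"
  shows "open (I \<inter> \<gamma> -` cdom c)"
  using assms open_cdom[OF M] unfolding smooth_curve_def by (intro continuous_open_preimage) auto

text \<open>\<open>velocity\<close> is taken in the preferred chart at \<open>\<gamma> t\<close>,
  which may change abruptly with \<open>t\<close>. In a fixed chart the components of the velocity
  become an ordinary derivative, the only form in which they can be differentiated once
  more.\<close>

lemma curve_has_vector_derivative:
  assumes \<gamma>: "smooth_curve M I \<gamma>" and I: "open I" "t \<in> I" and c: "c \<in> atlas M" "\<gamma> t \<in> cdom c"
  shows "((\<lambda>s. cmap c (\<gamma> s)) has_vector_derivative tcoord M c (\<gamma> t) (velocity M \<gamma> t)) (at t)"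
proof -
  let ?d = "chart_at M (\<gamma> t)"
  have d: "?d \<in> atlas M" "\<gamma> t \<in> cdom ?d" using chart_at_atlas[OF M] by auto
  have "smooth_on (\<lambda>s. cmap ?d (\<gamma> s)) (I \<inter> \<gamma> -` cdom ?d)"
    using \<gamma> d by (simp add: smooth_curve_def)
  then have "(\<lambda>s. cmap ?d (\<gamma> s)) differentiable (at t)"
    using smooth_on_has_derivative[of _ "I \<inter> \<gamma> -` cdom ?d" t] I d by (auto simp: differentiable_def)
  then have "((\<lambda>s. cmap ?d (\<gamma> s)) has_vector_derivative velocity M \<gamma> t) (at t)"
    by (simp add: velocity_def vector_derivative_works)
  then have "((\<lambda>s. cmap c (cinv ?d (cmap ?d (\<gamma> s)))) has_derivative
      (\<lambda>r. transd ?d c (\<gamma> t) (r *\<^sub>R velocity M \<gamma> t))) (at t)"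
    using diff_chain_at[of "\<lambda>s. cmap ?d (\<gamma> s)" _ t "\<lambda>x. cmap c (cinv ?d x)"]
      transd_has_derivative[OF M d(1) c(1) d(2) c(2)]
    by (simp add: has_vector_derivative_def o_def)
  then have "((\<lambda>s. cmap c (\<gamma> s)) has_derivative
      (\<lambda>r. transd ?d c (\<gamma> t) (r *\<^sub>R velocity M \<gamma> t))) (at t)"
  proof (rule has_derivative_transform_within_open)
    show "open (I \<inter> \<gamma> -` cdom ?d)" using \<gamma> I d by (intro open_curve_preimage)
  qed (use I d cinv_cmap[OF is_chart_atlas[OF M d(1)]] in auto)
  then show ?thesis
    by (simp add: has_vector_derivative_def tcoord_transd linear_scale[OF linear_transd[OF M d(1) c(1) d(2) c(2)]])
qed

lemma tcoord_velocity:
  assumes \<gamma>: "smooth_curve M I \<gamma>" and I: "open I" "s \<in> I" and c: "c \<in> atlas M" "\<gamma> s \<in> cdom c"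
  shows "tcoord M c (\<gamma> s) (velocity M \<gamma> s) = frechet_derivative (\<lambda>s. cmap c (\<gamma> s)) (at s) 1"
  using frechet_derivative_at[OF curve_has_vector_derivative[OF assms, unfolded has_vector_derivative_def]]
  by (metis scaleR_one)

lemma smooth_tcoord_velocity:
  assumes \<gamma>: "smooth_curve M I \<gamma>" and I: "open I" and c: "c \<in> atlas M"
  shows "smooth_on (\<lambda>s. tcoord M c (\<gamma> s) (velocity M \<gamma> s)) (I \<inter> \<gamma> -` cdom c)"
proof -
  have "smooth_on (\<lambda>s. frechet_derivative (\<lambda>s. cmap c (\<gamma> s)) (at s) 1) (I \<inter> \<gamma> -` cdom c)"
    using \<gamma> c by (intro smooth_on_frechet_derivative) (simp add: smooth_curve_def)
  then show ?thesis
    using tcoord_velocity[OF \<gamma> I _ c]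
    by (subst smooth_on_cong[OF open_curve_preimage[OF \<gamma> I c],
          where G = "\<lambda>s. frechet_derivative (\<lambda>s. cmap c (\<gamma> s)) (at s) 1"]) auto
qed

end



subsection \<open>Connections in coordinates\<close>

context
  fixes M :: "('m::{t2_space,second_countable_topology}, 'e::euclidean_space, 'z) manifold_scheme"
    and D :: "('m \<Rightarrow> 'e) \<Rightarrow> ('m \<Rightarrow> 'e) \<Rightarrow> 'm \<Rightarrow> 'e"
  assumes M: "smooth_manifold M" and D: "affine_connection M D"
begin

lemma connection_smooth:
  assumes "open W" "smooth_vf M W X" "smooth_vf M W Y"
  shows "smooth_vf M W (D X Y)"
  using D assms smooth_fun_const[OF M assms(1), of 0] unfolding affine_connection_def by blast

lemma connection_add_left:
  assumes "open W" "smooth_vf M W X" "smooth_vf M W X'" "smooth_vf M W Y" "p \<in> W"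
  shows "D (\<lambda>q. X q + X' q) Y p = D X Y p + D X' Y p"
  using D assms smooth_fun_const[OF M assms(1), of 0] unfolding affine_connection_def by blast

lemma connection_add_right:
  assumes "open W" "smooth_vf M W X" "smooth_vf M W Y" "smooth_vf M W Y'" "p \<in> W"
  shows "D X (\<lambda>q. Y q + Y' q) p = D X Y p + D X Y' p"
  using D assms smooth_fun_const[OF M assms(1), of 0] unfolding affine_connection_def by blast

lemma connection_scale_left:
  assumes "open W" "smooth_vf M W X" "smooth_vf M W Y" "smooth_fun M W h" "p \<in> W"
  shows "D (\<lambda>q. h q *\<^sub>R X q) Y p = h p *\<^sub>R D X Y p"
  using D assms unfolding affine_connection_def by blast

lemma connection_scale_right:
  assumes "open W" "smooth_vf M W X" "smooth_vf M W Y" "smooth_fun M W h" "p \<in> W"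
  shows "D X (\<lambda>q. h q *\<^sub>R Y q) p = dfun M h p (X p) *\<^sub>R Y p + h p *\<^sub>R D X Y p"
  using D assms unfolding affine_connection_def by blast

lemma connection_zero_left:
  assumes "open W" "smooth_vf M W Y" "p \<in> W"
  shows "D (\<lambda>q. 0) Y p = 0"
  using connection_scale_left[OF assms(1) smooth_vf_zero[OF M assms(1)] assms(2) smooth_fun_const[OF M assms(1), of 0] assms(3)]
  by simp

lemma connection_zero_right:
  assumes "open W" "smooth_vf M W X" "p \<in> W"
  shows "D X (\<lambda>q. 0) p = 0"
  using connection_scale_right[OF assms(1,2) smooth_vf_zero[OF M assms(1)] smooth_fun_const[OF M assms(1), of 0] assms(3)]
  by simp

lemma connection_sum_left:
  assumes "open W" "\<And>i. i \<in> I \<Longrightarrow> smooth_vf M W (X i)" "smooth_vf M W Y" "p \<in> W"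
  shows "D (\<lambda>q. \<Sum>i\<in>I. X i q) Y p = (\<Sum>i\<in>I. D (X i) Y p)"
  using assms(2)
proof (induction I rule: infinite_finite_induct)
  case (insert i I)
  then show ?case
    using connection_add_left[OF assms(1), of "X i" "\<lambda>q. \<Sum>i\<in>I. X i q" Y p] assms
    by (simp add: smooth_vf_sum[OF M])
qed (use connection_zero_left assms in auto)

lemma connection_sum_right:
  assumes "open W" "smooth_vf M W X" "\<And>i. i \<in> I \<Longrightarrow> smooth_vf M W (Y i)" "p \<in> W"
  shows "D X (\<lambda>q. \<Sum>i\<in>I. Y i q) p = (\<Sum>i\<in>I. D X (Y i) p)"
  using assms(3)
proof (induction I rule: infinite_finite_induct)
  case (insert i I)
  then show ?case
    using connection_add_right[OF assms(1,2), of "Y i" "\<lambda>q. \<Sum>i\<in>I. Y i q" p] assms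
    by (simp add: smooth_vf_sum[OF M])
qed (use connection_zero_right assms in auto)

text \<open>The difference of the two fields is its own multiple by a function vanishing on \<open>W\<close>.\<close>

lemma connection_cong_right:
  assumes W: "open W" "p \<in> W" and X: "smooth_vf M W X" and Y: "smooth_vf M W Y"
    and eq: "\<And>q. q \<in> W \<Longrightarrow> Y q = Y' q"
  shows "D X Y p = D X Y' p"
proof -
  define h where "h q = (if q \<in> W then 0 else 1::real)" for q
  let ?Z = "\<lambda>q. Y' q - Y q"
  have h: "smooth_fun M W h"
    by (rule smooth_fun_cong[OF M W(1) _ smooth_fun_const[OF M W(1), of 0]]) (simp add: h_def)
  have Z: "smooth_vf M W ?Z"
    by (rule smooth_vf_cong[OF M W(1) _ smooth_vf_zero[OF M W(1)]]) (simp add: eq)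
  have "Y' = (\<lambda>q. Y q + h q *\<^sub>R ?Z q)"
    by (rule ext) (use eq in \<open>auto simp: h_def\<close>)
  then have "D X Y' p = D X Y p + D X (\<lambda>q. h q *\<^sub>R ?Z q) p"
    using connection_add_right[OF W(1) X Y smooth_vf_scale[OF M W(1) h Z] W(2)] by simp
  also have "D X (\<lambda>q. h q *\<^sub>R ?Z q) p = 0"
    using connection_scale_right[OF W(1) X Z h W(2)] W(2) by (simp add: h_def eq)
  finally show ?thesis by simp
qed

lemma connection_cong_left:
  assumes W: "open W" "p \<in> W" and X: "smooth_vf M W X" and Y: "smooth_vf M W Y"
    and eq: "\<And>q. q \<in> W \<Longrightarrow> X q = X' q"
  shows "D X Y p = D X' Y p"
proof -
  define h where "h q = (if q \<in> W then 0 else 1::real)" for q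
  let ?Z = "\<lambda>q. X' q - X q"
  have h: "smooth_fun M W h"
    by (rule smooth_fun_cong[OF M W(1) _ smooth_fun_const[OF M W(1), of 0]]) (simp add: h_def)
  have Z: "smooth_vf M W ?Z"
    by (rule smooth_vf_cong[OF M W(1) _ smooth_vf_zero[OF M W(1)]]) (simp add: eq)
  have "X' = (\<lambda>q. X q + h q *\<^sub>R ?Z q)"
    by (rule ext) (use eq in \<open>auto simp: h_def\<close>)
  then have "D X' Y p = D X Y p + D (\<lambda>q. h q *\<^sub>R ?Z q) Y p"
    using connection_add_left[OF W(1) X smooth_vf_scale[OF M W(1) h Z] Y W(2)] by simp
  also have "D (\<lambda>q. h q *\<^sub>R ?Z q) Y p = 0"
    using connection_scale_left[OF W(1) Z Y h W(2)] W(2) by (simp add: h_def)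
  finally show ?thesis by simp
qed

lemma connection_cong:
  assumes W: "open W" "p \<in> W" and X: "smooth_vf M W X" and Y: "smooth_vf M W Y"
    and eq: "\<And>q. q \<in> W \<Longrightarrow> X q = X' q" "\<And>q. q \<in> W \<Longrightarrow> Y q = Y' q"
  shows "D X Y p = D X' Y' p"
  using connection_cong_left[OF W X Y eq(1)]
    connection_cong_right[OF W smooth_vf_cong[OF M W(1) eq(1) X] Y eq(2)] by simp

text \<open>Both fields are expanded in coordinate fields; the Leibniz rule gives the derivative
  \<open>L\<close> of the components of \<open>Y\<close> along \<open>X\<close> plus the Christoffel
  terms. The right side has the shape of \<open>cov_along\<close>, so the two can be
  compared.\<close>

lemma connection_coordinates:
  assumes c: "c \<in> atlas M" "p \<in> cdom c" and W: "open W" "p \<in> W"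
    and X: "smooth_vf M W X" and Y: "smooth_vf M W Y"
    and L: "((\<lambda>x. tcoord M c (cinv c x) (Y (cinv c x))) has_derivative L) (at (cmap c p))"
  shows "D X Y p = tvec M c p (L (tcoord M c p (X p))) +
    (\<Sum>a\<in>Basis. \<Sum>b\<in>Basis. ((tcoord M c p (X p) \<bullet> a) * (tcoord M c p (Y p) \<bullet> b)) *\<^sub>R
       D (\<lambda>q. tvec M c q a) (\<lambda>q. tvec M c q b) p)"
proof -
  let ?W = "W \<inter> cdom c"
  let ?\<xi> = "\<lambda>a q. tcoord M c q (X q) \<bullet> a"
  let ?\<eta> = "\<lambda>b q. tcoord M c q (Y q) \<bullet> b"
  let ?d = "\<lambda>a q. tvec M c q a"
  have W': "open ?W" "p \<in> ?W"
    using W c open_cdom[OF M] by auto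
  have sX: "smooth_fun M ?W (?\<xi> a)" and sY: "smooth_fun M ?W (?\<eta> a)" for a
    using c W X Y by (auto intro: smooth_fun_component[OF M])
  have sd: "smooth_vf M ?W (?d a)" for a
    using smooth_vf_subset[OF smooth_vf_coordinate[OF M c(1)], of ?W] by simp
  have sX': "smooth_vf M ?W (\<lambda>q. ?\<xi> a q *\<^sub>R ?d a q)" and sY': "smooth_vf M ?W (\<lambda>q. ?\<eta> a q *\<^sub>R ?d a q)" for a
    by (rule smooth_vf_scale[OF M W'(1) _ sd], rule sX sY)+
  have X1: "X q = (\<Sum>a\<in>Basis. ?\<xi> a q *\<^sub>R ?d a q)" and Y1: "Y q = (\<Sum>b\<in>Basis. ?\<eta> b q *\<^sub>R ?d b q)"
    if "q \<in> ?W" for q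
    using that c by (simp_all add: tvec_eq_sum[OF M, symmetric] tvec_tcoord[OF M])
  have dY: "dfun M (?\<eta> b) p (?d a p) = L a \<bullet> b" for a b
    using dfun_eq[OF M c, of "?\<eta> b" "\<lambda>v. L v \<bullet> b" "?d a p"] has_derivative_inner_left[OF L, of b] c
    by (simp add: tcoord_tvec[OF M])
  have linL: "linear L" using L by (rule has_derivative_linear)
  \<comment> \<open>The expansions hold only on \<open>W \<inter> cdom c\<close>, while
    \<open>D\<close> takes total functions; locality permits the exchange.\<close>
  have "D X Y p = D (\<lambda>q. \<Sum>a\<in>Basis. ?\<xi> a q *\<^sub>R ?d a q) (\<lambda>q. \<Sum>b\<in>Basis. ?\<eta> b q *\<^sub>R ?d b q) p"
    by (rule connection_cong[OF W' _ _ X1 Y1]) (use smooth_vf_subset[of M W _ ?W] X Y in auto)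
  also have "\<dots> = (\<Sum>a\<in>Basis. \<Sum>b\<in>Basis. D (\<lambda>q. ?\<xi> a q *\<^sub>R ?d a q) (\<lambda>q. ?\<eta> b q *\<^sub>R ?d b q) p)"
    by (subst connection_sum_left[OF W'(1) sX' smooth_vf_sum[OF M W'(1) sY'] W'(2)])
      (simp only: connection_sum_right[OF W'(1) sX' sY' W'(2)])
  also have "\<dots> = (\<Sum>a\<in>Basis. \<Sum>b\<in>Basis. ?\<xi> a p *\<^sub>R ((L a \<bullet> b) *\<^sub>R ?d b p) + (?\<xi> a p * ?\<eta> b p) *\<^sub>R D (?d a) (?d b) p)"
    by (simp add: connection_scale_left[OF W'(1) sd sY' sX W'(2)]
        connection_scale_right[OF W'(1) sd sd sY W'(2)] dY scaleR_add_right)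
  also have "\<dots> = (\<Sum>a\<in>Basis. ?\<xi> a p *\<^sub>R tvec M c p (L a)) +
      (\<Sum>a\<in>Basis. \<Sum>b\<in>Basis. (?\<xi> a p * ?\<eta> b p) *\<^sub>R D (?d a) (?d b) p)"
    by (simp only: sum.distrib scaleR_sum_right[symmetric] tvec_eq_sum[OF M c, symmetric])
  also have "(\<Sum>a\<in>Basis. ?\<xi> a p *\<^sub>R tvec M c p (L a)) = tvec M c p (L (\<Sum>a\<in>Basis. ?\<xi> a p *\<^sub>R a))"
    using linL linear_tvec[OF M c] by (simp add: linear_sum linear_scale)
  finally show ?thesis by (simp add: euclidean_representation)
qed

text \<open>Coordinate fields have constant components, so the derivative term in their coordinate
  formula vanishes and the double sum collapses to one application of \<open>D\<close>. On a product
  this spares the splitting of a sum over the basis of \<open>'e1 \<times> 'e2\<close>.\<close>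

lemma cov_along_eq:
  assumes c: "c \<in> atlas M" "\<gamma> t \<in> cdom c"
  shows "cov_along M D c \<gamma> V t =
    tvec M c (\<gamma> t) (vector_derivative (\<lambda>s. tcoord M c (\<gamma> s) (V s)) (at t)) +
    D (\<lambda>q. tvec M c q (vector_derivative (\<lambda>s. cmap c (\<gamma> s)) (at t)))
      (\<lambda>q. tvec M c q (tcoord M c (\<gamma> t) (V t))) (\<gamma> t)"
proof -
  have o: "open (cimage c UNIV)" "cmap c (\<gamma> t) \<in> cimage c UNIV"
    using c open_cimage_atlas[OF M] by (auto intro: cmap_in_cimage)
  have "((\<lambda>x. tcoord M c (cinv c x) (tvec M c (cinv c x) a)) has_derivative (\<lambda>v. 0)) (at (cmap c (\<gamma> t)))" for a
  proof (rule has_derivative_transform_within_open[OF has_derivative_const o])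
    show "a = tcoord M c (cinv c x) (tvec M c (cinv c x) a)" if "x \<in> cimage c UNIV" for x
      using cinv_in_cdom[OF is_chart_atlas[OF M c(1)] that] c by (simp add: tcoord_tvec[OF M])
  qed
  note * = connection_coordinates[OF c open_cdom[OF M c(1)] c(2) smooth_vf_coordinate[OF M c(1)]
      smooth_vf_coordinate[OF M c(1)] this]
  show ?thesis
    unfolding cov_along_def Let_def
    by (subst *) (use c in \<open>simp add: tcoord_tvec[OF M] linear_0[OF linear_tvec[OF M]]\<close>)
qed

text \<open>The chain rule identifies the derivative of the velocity components with that of the
  components of \<open>X\<close> in the direction of the velocity. Only the values of
  \<open>X\<close> along the curve, for parameters in \<open>K\<close> and \<open>I\<close>, have to
  match.\<close>

lemma cov_along_extension:
  assumes \<gamma>: "smooth_curve M I \<gamma>" and I: "open I" "t \<in> I" and c: "c \<in> atlas M" "\<gamma> t \<in> cdom c"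
    and W: "open W" "\<gamma> t \<in> W" and X: "smooth_vf M W X"
    and K: "open K" "t \<in> K" "\<And>s. s \<in> K \<Longrightarrow> s \<in> I \<Longrightarrow> X (\<gamma> s) = velocity M \<gamma> s"
  shows "cov_along M D c \<gamma> (velocity M \<gamma>) t = D X X (\<gamma> t)"
proof -
  let ?F = "\<lambda>x. tcoord M c (cinv c x) (X (cinv c x))"
  let ?\<sigma> = "\<lambda>s. cmap c (\<gamma> s)"
  let ?v = "tcoord M c (\<gamma> t) (velocity M \<gamma> t)"
  define L where "L = frechet_derivative ?F (at (?\<sigma> t))"
  have L: "(?F has_derivative L) (at (?\<sigma> t))"
    unfolding L_def using X c W
    by (intro smooth_on_has_derivative[of _ "cimage c W"]) (auto simp: smooth_vf_def intro: cmap_in_cimage)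
  have \<sigma>: "(?\<sigma> has_vector_derivative ?v) (at t)"
    using M \<gamma> I c by (rule curve_has_vector_derivative)
  have "((\<lambda>s. ?F (?\<sigma> s)) has_derivative (\<lambda>r. L (r *\<^sub>R ?v))) (at t)"
    using diff_chain_at[OF \<sigma>[unfolded has_vector_derivative_def] L] by (simp add: o_def)
  then have "((\<lambda>s. tcoord M c (\<gamma> s) (velocity M \<gamma> s)) has_derivative (\<lambda>r. L (r *\<^sub>R ?v))) (at t)"
  proof (rule has_derivative_transform_within_open)
    show "open (K \<inter> (I \<inter> \<gamma> -` cdom c))"
      using K open_curve_preimage[OF M \<gamma> I(1) c(1)] by blast
  qed (use K I c cinv_cmap[OF is_chart_atlas[OF M c(1)]] in auto)
  then have "vector_derivative (\<lambda>s. tcoord M c (\<gamma> s) (velocity M \<gamma> s)) (at t) = L ?v"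
    by (intro vector_derivative_at) (simp add: has_vector_derivative_def linear_scale[OF has_derivative_linear[OF L]])
  moreover have "X (\<gamma> t) = velocity M \<gamma> t" using K I by blast
  ultimately show ?thesis
    using connection_coordinates[OF c W X X L] vector_derivative_at[OF \<sigma>]
    by (simp add: cov_along_def Let_def)
qed

text \<open>In a fixed chart the acceleration is the derivative of the smooth velocity components
  plus products of these with components of \<open>D\<close> on coordinate fields, which are smooth
  because the connection preserves smoothness.\<close>

lemma continuous_on_tcoord_cov_along:
  assumes \<gamma>: "smooth_curve M I \<gamma>" and I: "open I" and c: "c \<in> atlas M"
  shows "continuous_on (I \<inter> \<gamma> -` cdom c) (\<lambda>s. tcoord M c (\<gamma> s) (cov_along M D c \<gamma> (velocity M \<gamma>) s))"
proof -
  let ?O = "I \<inter> \<gamma> -` cdom c"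
  let ?y = "\<lambda>s. tcoord M c (\<gamma> s) (velocity M \<gamma> s)"
  let ?G = "\<lambda>a b x. tcoord M c (cinv c x) (D (\<lambda>q. tvec M c q a) (\<lambda>q. tvec M c q b) (cinv c x))"
  have y: "smooth_on ?y ?O" using M assms by (rule smooth_tcoord_velocity)
  \<comment> \<open>A linear map on the reals is determined by its value at 1; this trades
    \<open>vector_derivative\<close> for \<open>frechet_derivative\<close>, about which
    \<open>smooth_on\<close> speaks.\<close>
  have y': "vector_derivative ?y (at s) = frechet_derivative ?y (at s) 1" if "s \<in> ?O" for s
  proof -
    have y: "(?y has_derivative frechet_derivative ?y (at s)) (at s)"
      using y that by (rule smooth_on_has_derivative)
    have "frechet_derivative ?y (at s) = (\<lambda>r. r *\<^sub>R frechet_derivative ?y (at s) 1)"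
    proof
      show "frechet_derivative ?y (at s) r = r *\<^sub>R frechet_derivative ?y (at s) 1" for r
        using linear_scale[OF has_derivative_linear[OF y], of r 1] by simp
    qed
    with y have "(?y has_vector_derivative frechet_derivative ?y (at s) 1) (at s)"
      unfolding has_vector_derivative_def by metis
    then show ?thesis by (rule vector_derivative_at)
  qed
  have x': "vector_derivative (\<lambda>s. cmap c (\<gamma> s)) (at s) = ?y s" if "s \<in> ?O" for s
    using curve_has_vector_derivative[OF M \<gamma> I _ c] that by (intro vector_derivative_at) auto
  have eq: "tcoord M c (\<gamma> s) (cov_along M D c \<gamma> (velocity M \<gamma>) s) = frechet_derivative ?y (at s) 1 +
      (\<Sum>a\<in>Basis. \<Sum>b\<in>Basis. ((?y s \<bullet> a) * (?y s \<bullet> b)) *\<^sub>R ?G a b (cmap c (\<gamma> s)))" if s: "s \<in> ?O" for s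
  proof -
    have lin: "linear (tcoord M c (\<gamma> s))" using s c by (simp add: linear_tcoord[OF M])
    show ?thesis
      using s c cinv_cmap[OF is_chart_atlas[OF M c]]
      by (simp add: cov_along_def Let_def linear_add[OF lin] linear_sum[OF lin] linear_scale[OF lin]
          tcoord_tvec[OF M] y' x')
  qed
  have G: "continuous_on (cimage c (cdom c)) (?G a b)" for a b
    using connection_smooth[OF open_cdom[OF M c] smooth_vf_coordinate[OF M c] smooth_vf_coordinate[OF M c]] c
    unfolding smooth_vf_def by (intro smooth_on_imp_continuous_on) auto
  have \<sigma>: "continuous_on ?O (\<lambda>s. cmap c (\<gamma> s))"
    using \<gamma> c by (intro smooth_on_imp_continuous_on) (simp add: smooth_curve_def)
  have "continuous_on ?O (\<lambda>s. ?G a b (cmap c (\<gamma> s)))" for a b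
    by (rule continuous_on_compose2[OF G \<sigma>]) (auto intro: cmap_in_cimage)
  then have "continuous_on ?O (\<lambda>s. frechet_derivative ?y (at s) 1 +
      (\<Sum>a\<in>Basis. \<Sum>b\<in>Basis. ((?y s \<bullet> a) * (?y s \<bullet> b)) *\<^sub>R ?G a b (cmap c (\<gamma> s))))"
    using smooth_on_imp_continuous_on[OF y] smooth_on_imp_continuous_on[OF smooth_on_frechet_derivative[OF y, of 1]]
    by (intro continuous_intros)
  then show ?thesis
    by (subst continuous_on_cong[OF refl eq])
qed

text \<open>The parameters in the chart domain at which the acceleration is nonzero form an open
  set; if nonempty, it would meet the dense set \<open>J\<close>.\<close>

lemma cov_along_zero_dense:
  assumes \<gamma>: "smooth_curve M I \<gamma>" and I: "open I" and J: "J \<subseteq> I" "I \<subseteq> closure J"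
    and c: "c \<in> atlas M"
    and zero: "\<And>s. s \<in> J \<Longrightarrow> \<gamma> s \<in> cdom c \<Longrightarrow> cov_along M D c \<gamma> (velocity M \<gamma>) s = 0"
    and t: "t \<in> I" "\<gamma> t \<in> cdom c"
  shows "cov_along M D c \<gamma> (velocity M \<gamma>) t = 0"
proof (rule ccontr)
  assume nz: "cov_along M D c \<gamma> (velocity M \<gamma>) t \<noteq> 0"
  let ?k = "\<lambda>s. tcoord M c (\<gamma> s) (cov_along M D c \<gamma> (velocity M \<gamma>) s)"
  let ?O = "(I \<inter> \<gamma> -` cdom c) \<inter> ?k -` (- {0})"
  have "open ?O"
    by (rule continuous_open_preimage[OF continuous_on_tcoord_cov_along[OF \<gamma> I c]
          open_curve_preimage[OF M \<gamma> I c]]) auto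
  moreover have "t \<in> ?O"
    using nz t c by (simp add: tcoord_eq_0_iff[OF M])
  moreover have "t \<in> closure J" using t J by auto
  ultimately obtain s where s: "s \<in> J" "s \<in> ?O"
    by (meson closure_iff_nhds_not_empty disjoint_iff subset_refl)
  then show False
    using zero[OF s(1)] c tcoord_eq_0_iff[OF M, of c "\<gamma> s"] by auto
qed

end


subsection \<open>Orthogonal projections\<close>

text \<open>The pointwise part of a Riemannian metric, isolated so that the same linear algebra
  serves the factors and the warped product.\<close>

definition metric_form :: "('e::real_vector \<Rightarrow> 'e \<Rightarrow> real) \<Rightarrow> bool" where
  "metric_form g \<longleftrightarrow> bilinear g \<and> (\<forall>u v. g u v = g v u) \<and> (\<forall>u. u \<noteq> 0 \<longrightarrow> 0 < g u u)"

context
  fixes g :: "'e::euclidean_space \<Rightarrow> 'e \<Rightarrow> real"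
  assumes g: "metric_form g"
begin

lemma metric_formD: "bilinear g" "g u v = g v u" "u \<noteq> 0 \<Longrightarrow> 0 < g u u"
  using g by (auto simp: metric_form_def)

lemma form_nondegenerate:
  assumes "\<And>w. g u w = g v w"
  shows "u = v"
proof (rule ccontr)
  assume "u \<noteq> v"
  then show False
    using metric_formD(3)[of "u - v"] assms[of "u - v"] by (simp add: bilinear_lsub[OF metric_formD(1)])
qed

text \<open>Gram-Schmidt for \<open>g\<close>, which in general differs from the inner product of
  \<open>'e\<close>: the new generator \<open>b\<close> is replaced by its residual
  \<open>b - e\<close> over \<open>span B\<close>, and the decomposition of \<open>v\<close> is
  corrected along it.\<close>

lemma orthogonal_decomposition_span:
  assumes "finite B"
  shows "\<exists>u\<in>span B. \<forall>w\<in>span B. g (v - u) w = 0"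
  using assms
proof (induction B arbitrary: v)
  case empty
  then show ?case by (simp add: bilinear_rzero[OF metric_formD(1)])
next
  case (insert b B)
  obtain u where u: "u \<in> span B" "\<And>w. w \<in> span B \<Longrightarrow> g (v - u) w = 0"
    using insert.IH[of v] by blast
  obtain e where e: "e \<in> span B" "\<And>w. w \<in> span B \<Longrightarrow> g (b - e) w = 0"
    using insert.IH[of b] by blast
  let ?b = "b - e"
  \<comment> \<open>The coefficient of \<open>v - u\<close> along the residual. If the residual is
    0, then \<open>b\<close> was already in the span and \<open>r = 0\<close> keeps the identity
    below valid, both sides being 0.\<close>
  define r where "r = (if ?b = 0 then 0 else g (v - u) ?b / g ?b ?b)"
  have r: "r * g ?b ?b = g (v - u) ?b"
    using metric_formD(3)[of ?b] by (auto simp: r_def bilinear_rzero[OF metric_formD(1)])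
  have mono: "span B \<subseteq> span (insert b B)" by (rule span_mono) auto
  have b': "?b \<in> span (insert b B)"
    using e(1) mono by (intro span_diff) (auto intro: span_base)
  show ?case
  proof (intro bexI ballI)
    show "u + r *\<^sub>R ?b \<in> span (insert b B)"
      using u(1) mono b' by (intro span_add span_scale) auto
    fix w assume "w \<in> span (insert b B)"
    then obtain k where "w - k *\<^sub>R b \<in> span B"
      by (auto simp: span_insert)
    then have w': "(w - k *\<^sub>R b) + k *\<^sub>R e \<in> span B"
      using e(1) by (intro span_add span_scale)
    define w' where "w' = (w - k *\<^sub>R b) + k *\<^sub>R e"
    have w: "w = w' + k *\<^sub>R ?b" by (simp add: w'_def algebra_simps)
    have z: "g (v - u) w' = 0" "g ?b w' = 0"
      using u(2) e(2) w' by (simp_all add: w'_def)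
    have "g (v - (u + r *\<^sub>R ?b)) w = g ((v - u) - r *\<^sub>R ?b) (w' + k *\<^sub>R ?b)"
      by (simp add: w diff_diff_eq)
    also have "\<dots> = g (v - u) w' + k * g (v - u) ?b - r * g ?b w' - k * (r * g ?b ?b)"
    proof -
      have "g (x - r *\<^sub>R y) (w' + k *\<^sub>R y) = g x w' + k * g x y - r * g y w' - k * (r * g y y)" for x y
        by (simp add: bilinear_lsub[OF metric_formD(1)] bilinear_radd[OF metric_formD(1)] bilinear_rmul[OF metric_formD(1)] bilinear_lmul[OF metric_formD(1)]
            algebra_simps)
      then show ?thesis .
    qed
    finally show "g (v - (u + r *\<^sub>R ?b)) w = 0" by (simp add: r z)
  qed
qed

text \<open>Two candidates differ by a vector of \<open>S\<close> orthogonal to itself. This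
  uniqueness is what evaluates the definite description in \<open>orth_proj\<close>.\<close>

lemma orth_proj_eqI:
  assumes "subspace S" "u \<in> S" "\<And>w. w \<in> S \<Longrightarrow> g (v - u) w = 0"
  shows "orth_proj g S v = u"
  unfolding orth_proj_def
proof (rule the_equality)
  fix u' assume u': "u' \<in> S \<and> (\<forall>w\<in>S. g (v - u') w = 0)"
  then have "u - u' \<in> S" using assms by (simp add: subspace_diff)
  then have "g (v - u') (u - u') - g (v - u) (u - u') = 0"
    using u' assms by simp
  then have "g (u - u') (u - u') = 0"
    by (simp add: bilinear_lsub[OF metric_formD(1)])
  then show "u' = u" using metric_formD(3)[of "u - u'"] by fastforce
qed (use assms in auto)

lemma orth_proj:
  assumes "subspace S"
  shows "orth_proj g S v \<in> S" "\<And>w. w \<in> S \<Longrightarrow> g (v - orth_proj g S v) w = 0"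
proof -
  obtain B where "finite B" "span B = S"
    using basis_exists[of S] assms by (metis finiteI_independent span_minimal span_superset subset_antisym)
  then obtain u where "u \<in> S" "\<And>w. w \<in> S \<Longrightarrow> g (v - u) w = 0"
    using orthogonal_decomposition_span[of B v] by blast
  moreover from this have "orth_proj g S v = u"
    using assms by (intro orth_proj_eqI)
  ultimately show "orth_proj g S v \<in> S" "\<And>w. w \<in> S \<Longrightarrow> g (v - orth_proj g S v) w = 0"
    by auto
qed

lemma linear_orth_proj:
  assumes S: "subspace S"
  shows "linear (orth_proj g S)"
proof (rule linearI)
  show "orth_proj g S (u + v) = orth_proj g S u + orth_proj g S v" for u v
  proof (rule orth_proj_eqI[OF S])
    show "orth_proj g S u + orth_proj g S v \<in> S"
      using orth_proj(1)[OF S] subspace_add[OF S] by blast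
    have "u + v - (orth_proj g S u + orth_proj g S v) = (u - orth_proj g S u) + (v - orth_proj g S v)"
      by simp
    then show "g (u + v - (orth_proj g S u + orth_proj g S v)) w = 0" if "w \<in> S" for w
      by (simp only: bilinear_ladd[OF metric_formD(1)] orth_proj(2)[OF S that] add_0_left)
  qed
  show "orth_proj g S (r *\<^sub>R v) = r *\<^sub>R orth_proj g S v" for r v
  proof (rule orth_proj_eqI[OF S])
    show "r *\<^sub>R orth_proj g S v \<in> S"
      using orth_proj(1)[OF S] subspace_scale[OF S] by blast
    show "g (r *\<^sub>R v - r *\<^sub>R orth_proj g S v) w = 0" if "w \<in> S" for w
      by (simp add: scaleR_diff_right[symmetric] bilinear_lmul[OF metric_formD(1)] orth_proj(2)[OF S that])
  qed
qed

lemma orth_proj_same: "subspace S \<Longrightarrow> v \<in> S \<Longrightarrow> orth_proj g S v = v"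
  by (rule orth_proj_eqI) (simp_all add: bilinear_lzero[OF metric_formD(1)])

lemma orth_proj_orthogonal: "subspace S \<Longrightarrow> (\<And>w. w \<in> S \<Longrightarrow> g v w = 0) \<Longrightarrow> orth_proj g S v = 0"
  by (rule orth_proj_eqI) (simp_all add: subspace_0)

lemma subspace_orthogonal_complement: "subspace {v. \<forall>w\<in>S. g v w = 0}"
  by (simp add: subspace_def bilinear_lzero[OF metric_formD(1)] bilinear_ladd[OF metric_formD(1)] bilinear_lmul[OF metric_formD(1)])

text \<open>The residual of \<open>v - P v\<close> is \<open>P v\<close>, which lies in
  \<open>S\<close> and is therefore orthogonal to the complement. This gives the identity that
  horizontal and vertical parts add up to the vector.\<close>

lemma orth_proj_complement:
  assumes S: "subspace S"
  shows "orth_proj g {v. \<forall>w\<in>S. g v w = 0} v = v - orth_proj g S v"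
proof (rule orth_proj_eqI[OF subspace_orthogonal_complement])
  show "v - orth_proj g S v \<in> {v. \<forall>w\<in>S. g v w = 0}"
    using orth_proj(2)[OF S] by simp
  show "g (v - (v - orth_proj g S v)) w = 0" if "w \<in> {v. \<forall>w\<in>S. g v w = 0}" for w
    using that orth_proj(1)[OF S] by (simp add: metric_formD(2)[of "orth_proj g S v"])
qed

text \<open>\<open>T\<close> is the matrix of \<open>g\<close> in the standard basis; it is
  injective by nondegeneracy, hence surjective. The lemma supplies the gradient of
  \<open>ln f\<close> as a vector before the definite description in \<open>grad\<close> is
  touched.\<close>

lemma form_representation:
  fixes l :: "'e \<Rightarrow> real"
  assumes "linear l"
  shows "\<exists>v. \<forall>w. g v w = l w"
proof -
  define T where "T v = (\<Sum>b\<in>Basis. g v b *\<^sub>R b)" for v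
  have rep: "g v w = T v \<bullet> w" for v w
  proof -
    have "g v w = g v (\<Sum>b\<in>Basis. (w \<bullet> b) *\<^sub>R b)" by (simp add: euclidean_representation)
    also have "\<dots> = (\<Sum>b\<in>Basis. (w \<bullet> b) * g v b)"
      using metric_formD(1) by (simp add: bilinear_def linear_sum linear_scale)
    also have "\<dots> = (\<Sum>b\<in>Basis. g v b * (b \<bullet> w))"
      by (simp add: inner_commute mult.commute)
    finally show ?thesis by (simp add: T_def inner_sum_left)
  qed
  have lin: "linear T"
    by (rule linearI) (simp_all add: T_def bilinear_ladd[OF metric_formD(1)] bilinear_lmul[OF metric_formD(1)] scaleR_add_left
        sum.distrib scaleR_sum_right)
  have "inj T"
  proof (rule injI)
    fix u v assume "T u = T v"
    then have "g u w = g v w" for w by (simp add: rep)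
    then show "u = v" by (rule form_nondegenerate)
  qed
  then have "surj T"
    using lin linear_injective_imp_surjective by blast
  then obtain v where v: "T v = (\<Sum>b\<in>Basis. l b *\<^sub>R b)"
    by (metis surjD)
  have "g v w = l w" for w
  proof -
    have "l w = l (\<Sum>b\<in>Basis. (w \<bullet> b) *\<^sub>R b)" by (simp add: euclidean_representation)
    also have "\<dots> = (\<Sum>b\<in>Basis. (w \<bullet> b) * l b)"
      using assms by (simp add: linear_sum linear_scale)
    also have "\<dots> = (\<Sum>b\<in>Basis. l b * (b \<bullet> w))"
      by (simp add: inner_commute mult.commute)
    finally show ?thesis
      unfolding rep v by (simp add: inner_sum_left)
  qed
  then show ?thesis by blast
qed

end

lemma riemannian_manifold_form:
  assumes "riemannian_manifold M"
  shows "smooth_manifold M" "metric_form (gmetric M p)"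
  using assms unfolding riemannian_manifold_def metric_form_def by auto



subsection \<open>The Koszul formula for coordinate fields\<close>

context
  fixes M :: "('m::{t2_space,second_countable_topology}, 'e::euclidean_space) riemannian"
    and D :: "('m \<Rightarrow> 'e) \<Rightarrow> ('m \<Rightarrow> 'e) \<Rightarrow> 'm \<Rightarrow> 'e"
  assumes M: "smooth_manifold M" and D: "levi_civita M D"
begin

text \<open>The coordinate functions have constant derivatives along coordinate fields, so testing the
  bracket against them avoids the symmetry of second derivatives.\<close>

lemma coordinate_fields_torsion_free:
  assumes c: "c \<in> atlas M" "p \<in> cdom c"
  shows "D (\<lambda>q. tvec M c q a) (\<lambda>q. tvec M c q b) p = D (\<lambda>q. tvec M c q b) (\<lambda>q. tvec M c q a) p"
proof -
  let ?Z = "\<lambda>p. D (\<lambda>q. tvec M c q a) (\<lambda>q. tvec M c q b) p - D (\<lambda>q. tvec M c q b) (\<lambda>q. tvec M c q a) p"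
  have o: "open (cimage c UNIV)" "cmap c q \<in> cimage c UNIV" if "q \<in> cdom c" for q
    using c that open_cimage_atlas[OF M] by (auto intro: cmap_in_cimage)
  have br: "is_lie_bracket M (cdom c) (\<lambda>q. tvec M c q a) (\<lambda>q. tvec M c q b) ?Z"
    using D open_cdom[OF M c(1)] smooth_vf_coordinate[OF M c(1)] unfolding levi_civita_def by blast
  have d1: "dfun M (\<lambda>q. cmap c q \<bullet> i) q v = tcoord M c q v \<bullet> i" if q: "q \<in> cdom c" for q v i
  proof (rule dfun_eq[OF M c(1) q])
    show "((\<lambda>x. cmap c (cinv c x) \<bullet> i) has_derivative (\<lambda>v. v \<bullet> i)) (at (cmap c q))"
      by (rule has_derivative_transform_within_open[OF has_derivative_inner_left[OF has_derivative_ident] o[OF q]])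
        (simp add: cmap_cinv[OF is_chart_atlas[OF M c(1)]])
  qed
  have d2: "dfun M (\<lambda>q. dfun M (\<lambda>q. cmap c q \<bullet> i) q (tvec M c q v)) p w = 0" for i v w
  proof (rule dfun_eq[OF M c])
    show "((\<lambda>x. dfun M (\<lambda>q. cmap c q \<bullet> i) (cinv c x) (tvec M c (cinv c x) v)) has_derivative (\<lambda>v. 0))
        (at (cmap c p))"
      by (rule has_derivative_transform_within_open[OF has_derivative_const[of "v \<bullet> i"] o[OF c(2)]])
        (use c cinv_in_cdom[OF is_chart_atlas[OF M c(1)]] in \<open>simp add: d1 tcoord_tvec[OF M]\<close>)
  qed
  have "tcoord M c p (?Z p) \<bullet> i = 0" for i
  proof -
    have "dfun M (\<lambda>q. cmap c q \<bullet> i) p (?Z p) =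
        dfun M (\<lambda>q. dfun M (\<lambda>q. cmap c q \<bullet> i) q (tvec M c q b)) p (tvec M c p a) -
        dfun M (\<lambda>q. dfun M (\<lambda>q. cmap c q \<bullet> i) q (tvec M c q a)) p (tvec M c p b)"
      using br smooth_fun_coordinate[OF M c(1), of i] open_cdom[OF M c(1)] c(2)
      unfolding is_lie_bracket_def by blast
    then show ?thesis using d1[OF c(2)] d2 by simp
  qed
  then have "tcoord M c p (?Z p) = 0"
    by (metis inner_eq_zero_iff)
  then show ?thesis
    using c by (simp add: tcoord_eq_0_iff[OF M])
qed

text \<open>Metric compatibility for the three pairs of fields, combined so that torsion-freeness
  cancels all but one connection term; the bracket terms of the general formula are absent. Of the
  metric only symmetry at \<open>p\<close> is asked, so the formula applies to the warped product as
  soon as its pointwise form is known.\<close>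

lemma koszul_coordinate_fields:
  assumes sym: "\<And>u v. gmetric M p u v = gmetric M p v u"
    and c: "c \<in> atlas M" "p \<in> cdom c"
  shows "2 * gmetric M p (D (\<lambda>q. tvec M c q a) (\<lambda>q. tvec M c q b) p) (tvec M c p e) =
    dfun M (\<lambda>q. gmetric M q (tvec M c q b) (tvec M c q e)) p (tvec M c p a) +
    dfun M (\<lambda>q. gmetric M q (tvec M c q a) (tvec M c q e)) p (tvec M c p b) -
    dfun M (\<lambda>q. gmetric M q (tvec M c q a) (tvec M c q b)) p (tvec M c p e)"
proof -
  have compat: "dfun M (\<lambda>q. gmetric M q (tvec M c q x) (tvec M c q y)) p (tvec M c p z) =
      gmetric M p (D (\<lambda>q. tvec M c q z) (\<lambda>q. tvec M c q x) p) (tvec M c p y) +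
      gmetric M p (tvec M c p x) (D (\<lambda>q. tvec M c q z) (\<lambda>q. tvec M c q y) p)" for x y z
    using D open_cdom[OF M c(1)] smooth_vf_coordinate[OF M c(1)] c(2) unfolding levi_civita_def by blast
  show ?thesis
    unfolding compat
      coordinate_fields_torsion_free[OF c, of b a] coordinate_fields_torsion_free[OF c, of e a]
      coordinate_fields_torsion_free[OF c, of e b]
    using sym[of "tvec M c p b" "D (\<lambda>q. tvec M c q a) (\<lambda>q. tvec M c q e) p"] by simp
qed

end

lemma coordinate_metric_has_derivative:
  assumes M: "riemannian_manifold M" and c: "c \<in> atlas M" "p \<in> cdom c"
  shows "((\<lambda>x. gmetric M (cinv c x) (tvec M c (cinv c x) a) (tvec M c (cinv c x) b)) has_derivative
    (\<lambda>v. dfun M (\<lambda>q. gmetric M q (tvec M c q a) (tvec M c q b)) p (tvec M c p v))) (at (cmap c p))"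
proof -
  note M' = riemannian_manifold_form(1)[OF M]
  have "smooth_fun M (cdom c) (\<lambda>q. gmetric M q (tvec M c q a) (tvec M c q b))"
  proof (rule smooth_fun_chartI[OF M' c(1) open_cdom[OF M' c(1)] subset_refl])
    show "smooth_on (\<lambda>x. gmetric M (cinv c x) (tvec M c (cinv c x) a) (tvec M c (cinv c x) b)) (cimage c (cdom c))"
      using M c(1) smooth_on_subset[OF _ cimage_mono[OF subset_UNIV]]
      unfolding riemannian_manifold_def by blast
  qed
  from smooth_fun_has_derivative[OF M' this c c(2)] show ?thesis .
qed


subsection \<open>Warped products\<close>

lemma has_derivative_map_prod:
  assumes "(F has_derivative F') (at x)" "(G has_derivative G') (at y)"
  shows "(map_prod F G has_derivative map_prod F' G') (at (x, y))"
proof -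
  have "((\<lambda>z. F (fst z)) has_derivative (\<lambda>z. F' (fst z))) (at (x, y))"
    using diff_chain_at[OF bounded_linear_imp_has_derivative[OF bounded_linear_fst], of F F' "(x, y)"] assms(1)
    by (simp add: o_def)
  moreover have "((\<lambda>z. G (snd z)) has_derivative (\<lambda>z. G' (snd z))) (at (x, y))"
    using diff_chain_at[OF bounded_linear_imp_has_derivative[OF bounded_linear_snd], of G G' "(x, y)"] assms(2)
    by (simp add: o_def)
  ultimately show ?thesis
    by (simp add: map_prod_def case_prod_unfold has_derivative_Pair)
qed

lemma prod_chart_simps [simp]:
  "cdom (prod_chart c1 c2) = cdom c1 \<times> cdom c2"
  "cmap (prod_chart c1 c2) = map_prod (cmap c1) (cmap c2)"
  "cinv (prod_chart c1 c2) = map_prod (cinv c1) (cinv c2)"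
  by (simp_all add: prod_chart_def)

lemma cimage_prod_chart: "cimage (prod_chart c1 c2) (A \<times> B) = cimage c1 A \<times> cimage c2 B"
  by (force simp: cimage_def)

lemma is_chart_prod_chart:
  assumes "is_chart c1" "is_chart c2"
  shows "is_chart (prod_chart c1 c2)"
proof -
  have im: "cimage (prod_chart c1 c2) UNIV = cimage c1 UNIV \<times> cimage c2 UNIV"
    by (simp flip: UNIV_Times_UNIV add: cimage_prod_chart)
  have cont: "continuous_on (A \<times> B) (map_prod h k)" if "continuous_on A h" "continuous_on B k"
    for h :: "'p::topological_space \<Rightarrow> 'q::topological_space" and k :: "'r::topological_space \<Rightarrow> 's::topological_space" and A B
    unfolding map_prod_def case_prod_unfold
    by (intro continuous_on_Pair continuous_on_compose2[OF that(1)] continuous_on_compose2[OF that(2)]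
        continuous_on_fst continuous_on_snd continuous_on_id) auto
  have "homeomorphism (cdom c1 \<times> cdom c2) (cimage c1 UNIV \<times> cimage c2 UNIV)
      (map_prod (cmap c1) (cmap c2)) (map_prod (cinv c1) (cinv c2))"
    using assms unfolding is_chart_def homeomorphism_def by (auto intro: cont simp: map_prod_surj_on)
  then show ?thesis
    using assms by (simp add: is_chart_def im open_Times)
qed

lemma warped_product_simps [simp]:
  "atlas (warped_product M1 f M2) = {prod_chart c1 c2 | c1 c2. c1 \<in> atlas M1 \<and> c2 \<in> atlas M2}"
  "chart_at (warped_product M1 f M2) p = prod_chart (chart_at M1 (fst p)) (chart_at M2 (snd p))"
  "gmetric (warped_product M1 f M2) p u v =
     gmetric M1 (fst p) (fst u) (fst v) + (f (fst p))\<^sup>2 * gmetric M2 (snd p) (snd u) (snd v)"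
  by (simp_all add: warped_product_def)

section \<open>Product atlas, tangent coordinates and curves in a product\<close>

context
  fixes M1 :: "('m1::{t2_space,second_countable_topology}, 'e1::euclidean_space) riemannian"
    and M2 :: "('m2::{t2_space,second_countable_topology}, 'e2::euclidean_space) riemannian"
    and f :: "'m1 \<Rightarrow> real"
  assumes M1: "smooth_manifold M1" and M2: "smooth_manifold M2"
begin

lemma smooth_manifold_warped_product: "smooth_manifold (warped_product M1 f M2)"
  unfolding smooth_manifold_def
proof (intro conjI ballI allI)
  fix c assume "c \<in> atlas (warped_product M1 f M2)"
  then show "is_chart c"
    using M1 M2 is_chart_prod_chart by (auto simp: smooth_manifold_def)
next
  fix c d assume "c \<in> atlas (warped_product M1 f M2)" "d \<in> atlas (warped_product M1 f M2)"
  then obtain c1 c2 d1 d2 where c: "c = prod_chart c1 c2" "c1 \<in> atlas M1" "c2 \<in> atlas M2"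
    and d: "d = prod_chart d1 d2" "d1 \<in> atlas M1" "d2 \<in> atlas M2" by auto
  have "smooth_on (map_prod (\<lambda>x. cmap d1 (cinv c1 x)) (\<lambda>x. cmap d2 (cinv c2 x)))
      (cimage c1 (cdom d1) \<times> cimage c2 (cdom d2))"
    using c d M1 M2
    by (intro smooth_on_map_prod smooth_transition open_cimage open_cdom is_chart_atlas)
  then show "smooth_on (\<lambda>x. cmap d (cinv c x)) (cimage c (cdom d))"
    by (simp add: c d cimage_prod_chart map_prod_def case_prod_unfold)
next
  fix p
  show "chart_at (warped_product M1 f M2) p \<in> atlas (warped_product M1 f M2)"
    "p \<in> cdom (chart_at (warped_product M1 f M2) p)"
    using chart_at_atlas[OF M1] chart_at_atlas[OF M2] by (simp_all add: mem_Times_iff) blast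
qed

text \<open>The Jacobian of a product transition map is block diagonal, so tangent coordinates in
  any product chart are taken factor by factor.\<close>

lemma transd_prod_chart:
  assumes "c1 \<in> atlas M1" "d1 \<in> atlas M1" "fst p \<in> cdom c1" "fst p \<in> cdom d1"
    and "c2 \<in> atlas M2" "d2 \<in> atlas M2" "snd p \<in> cdom c2" "snd p \<in> cdom d2"
  shows "transd (prod_chart c1 c2) (prod_chart d1 d2) p = map_prod (transd c1 d1 (fst p)) (transd c2 d2 (snd p))"
proof -
  have "(map_prod (\<lambda>x. cmap d1 (cinv c1 x)) (\<lambda>x. cmap d2 (cinv c2 x)) has_derivative
      map_prod (transd c1 d1 (fst p)) (transd c2 d2 (snd p))) (at (cmap c1 (fst p), cmap c2 (snd p)))"
    using assms by (intro has_derivative_map_prod transd_has_derivative[OF M1] transd_has_derivative[OF M2])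
  from frechet_derivative_at[OF this] show ?thesis
    unfolding transd_def by (cases p) (simp add: map_prod_def case_prod_unfold)
qed

lemma tcoord_prod_chart:
  assumes "c1 \<in> atlas M1" "fst p \<in> cdom c1" "c2 \<in> atlas M2" "snd p \<in> cdom c2"
  shows "tcoord (warped_product M1 f M2) (prod_chart c1 c2) p v =
    (tcoord M1 c1 (fst p) (fst v), tcoord M2 c2 (snd p) (snd v))"
  using assms chart_at_atlas[OF M1] chart_at_atlas[OF M2]
  by (simp add: tcoord_transd transd_prod_chart map_prod_def case_prod_unfold)

lemma tvec_prod_chart:
  assumes "c1 \<in> atlas M1" "fst p \<in> cdom c1" "c2 \<in> atlas M2" "snd p \<in> cdom c2"
  shows "tvec (warped_product M1 f M2) (prod_chart c1 c2) p v =
    (tvec M1 c1 (fst p) (fst v), tvec M2 c2 (snd p) (snd v))"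
  using assms chart_at_atlas[OF M1] chart_at_atlas[OF M2]
  by (simp add: tvec_transd transd_prod_chart map_prod_def case_prod_unfold)

text \<open>The product atlas tests the first component only where the second lies in some chart
  \<open>c2\<close> as well. Each parameter has a neighbourhood on which a preferred chart serves as
  \<open>c2\<close>, and smoothness is glued from these neighbourhoods.\<close>

lemma smooth_curve_warped_product:
  assumes \<gamma>: "smooth_curve (warped_product M1 f M2) I \<gamma>" and I: "open I"
  shows "smooth_curve M1 I (\<lambda>t. fst (\<gamma> t))" and "smooth_curve M2 I (\<lambda>t. snd (\<gamma> t))"
proof -
  have cont: "continuous_on I \<gamma>" using \<gamma> by (simp add: smooth_curve_def)
  note M = smooth_manifold_warped_product
  have *: "open (I \<inter> \<gamma> -` cdom (prod_chart c1 c2))"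
    "smooth_on (\<lambda>t. cmap c1 (fst (\<gamma> t))) (I \<inter> \<gamma> -` cdom (prod_chart c1 c2))"
    "smooth_on (\<lambda>t. cmap c2 (snd (\<gamma> t))) (I \<inter> \<gamma> -` cdom (prod_chart c1 c2))"
    if c: "c1 \<in> atlas M1" "c2 \<in> atlas M2" for c1 c2
  proof -
    have c': "prod_chart c1 c2 \<in> atlas (warped_product M1 f M2)" using c by auto
    show o: "open (I \<inter> \<gamma> -` cdom (prod_chart c1 c2))"
      by (rule open_curve_preimage[OF M \<gamma> I c'])
    have s: "smooth_on (\<lambda>t. cmap (prod_chart c1 c2) (\<gamma> t)) (I \<inter> \<gamma> -` cdom (prod_chart c1 c2))"
      using \<gamma> c' unfolding smooth_curve_def by blast
    show "smooth_on (\<lambda>t. cmap c1 (fst (\<gamma> t))) (I \<inter> \<gamma> -` cdom (prod_chart c1 c2))"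
      using smooth_on_linear_compose[OF o bounded_linear_fst s] by simp
    show "smooth_on (\<lambda>t. cmap c2 (snd (\<gamma> t))) (I \<inter> \<gamma> -` cdom (prod_chart c1 c2))"
      using smooth_on_linear_compose[OF o bounded_linear_snd s] by simp
  qed
  show "smooth_curve M1 I (\<lambda>t. fst (\<gamma> t))"
    unfolding smooth_curve_def
  proof (intro conjI ballI smooth_on_locally)
    show "continuous_on I (\<lambda>t. fst (\<gamma> t))" using cont by (rule continuous_on_fst)
    fix c1 t assume c1: "c1 \<in> atlas M1" and t: "t \<in> I \<inter> (\<lambda>t. fst (\<gamma> t)) -` cdom c1"
    let ?c2 = "chart_at M2 (snd (\<gamma> t))"
    show "\<exists>T. open T \<and> t \<in> T \<and> smooth_on (\<lambda>t. cmap c1 (fst (\<gamma> t))) T"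
      using *[OF c1 chart_at_atlas(1)[OF M2, of "snd (\<gamma> t)"]] t chart_at_atlas(2)[OF M2, of "snd (\<gamma> t)"]
      by (intro exI[of _ "I \<inter> \<gamma> -` cdom (prod_chart c1 ?c2)"]) (auto simp: mem_Times_iff)
  qed
  show "smooth_curve M2 I (\<lambda>t. snd (\<gamma> t))"
    unfolding smooth_curve_def
  proof (intro conjI ballI smooth_on_locally)
    show "continuous_on I (\<lambda>t. snd (\<gamma> t))" using cont by (rule continuous_on_snd)
    fix c2 t assume c2: "c2 \<in> atlas M2" and t: "t \<in> I \<inter> (\<lambda>t. snd (\<gamma> t)) -` cdom c2"
    let ?c1 = "chart_at M1 (fst (\<gamma> t))"
    show "\<exists>T. open T \<and> t \<in> T \<and> smooth_on (\<lambda>t. cmap c2 (snd (\<gamma> t))) T"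
      using *[OF chart_at_atlas(1)[OF M1, of "fst (\<gamma> t)"] c2] t chart_at_atlas(2)[OF M1, of "fst (\<gamma> t)"]
      by (intro exI[of _ "I \<inter> \<gamma> -` cdom (prod_chart ?c1 c2)"]) (auto simp: mem_Times_iff)
  qed
qed

lemma velocity_warped_product:
  assumes \<gamma>: "smooth_curve (warped_product M1 f M2) I \<gamma>" and I: "open I" "t \<in> I"
  shows "velocity (warped_product M1 f M2) \<gamma> t =
    (velocity M1 (\<lambda>t. fst (\<gamma> t)) t, velocity M2 (\<lambda>t. snd (\<gamma> t)) t)"
proof -
  let ?c1 = "chart_at M1 (fst (\<gamma> t))" and ?c2 = "chart_at M2 (snd (\<gamma> t))"
  note c1 = chart_at_atlas[OF M1, of "fst (\<gamma> t)"] and c2 = chart_at_atlas[OF M2, of "snd (\<gamma> t)"]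
  note \<gamma>' = smooth_curve_warped_product[OF \<gamma> I(1)]
  have "((\<lambda>s. cmap ?c1 (fst (\<gamma> s))) has_vector_derivative velocity M1 (\<lambda>t. fst (\<gamma> t)) t) (at t)"
    using curve_has_vector_derivative[OF M1 \<gamma>'(1) I c1] c1 by (simp add: tcoord_transd transd_refl[OF M1])
  moreover have "((\<lambda>s. cmap ?c2 (snd (\<gamma> s))) has_vector_derivative velocity M2 (\<lambda>t. snd (\<gamma> t)) t) (at t)"
    using curve_has_vector_derivative[OF M2 \<gamma>'(2) I c2] c2 by (simp add: tcoord_transd transd_refl[OF M2])
  ultimately show ?thesis
    unfolding velocity_def[of "warped_product M1 f M2"]
    by (intro vector_derivative_at)
      (simp add: has_vector_derivative_Pair map_prod_def case_prod_unfold)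
qed

end

section \<open>The warped metric, its connection and the gradient of the warping function\<close>

lemma metric_form_warped_product:
  assumes M1: "riemannian_manifold M1" and M2: "riemannian_manifold M2" and f: "0 < f (fst p)"
  shows "metric_form (gmetric (warped_product M1 f M2) p)"
proof -
  note b = metric_formD[OF riemannian_manifold_form(2)[where p = "fst p", OF M1]]
    metric_formD[OF riemannian_manifold_form(2)[where p = "snd p", OF M2]]
  note bs = bilinear_ladd bilinear_lmul bilinear_radd bilinear_rmul
  have "bilinear (gmetric (warped_product M1 f M2) p)"
    unfolding bilinear_def
    by (auto intro!: linearI simp: bs[OF b(1)] bs[OF b(4)] algebra_simps)
  moreover have "gmetric (warped_product M1 f M2) p u v = gmetric (warped_product M1 f M2) p v u" for u v
    by (simp add: b(2)[of "fst u" "fst v"] b(5)[of "snd u" "snd v"])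
  moreover have "0 < gmetric (warped_product M1 f M2) p u u" if u: "u \<noteq> 0" for u
  proof -
    have nn: "0 \<le> gmetric M1 (fst p) (fst u) (fst u)" "0 \<le> gmetric M2 (snd p) (snd u) (snd u)"
      using b(3)[of "fst u"] b(6)[of "snd u"] bilinear_lzero[OF b(1), of 0] bilinear_lzero[OF b(4), of 0]
      by (cases "fst u = 0"; cases "snd u = 0"; simp add: less_imp_le)+
    consider "fst u \<noteq> 0" | "snd u \<noteq> 0" using u by (auto simp: prod_eq_iff)
    then show ?thesis
    proof cases
      case 1
      then show ?thesis using b(3) nn by (simp add: add_pos_nonneg)
    next
      case 2
      then show ?thesis using b(6) nn f by (simp add: add_nonneg_pos)
    qed
  qed
  ultimately show ?thesis by (auto simp: metric_form_def)
qed

text \<open>Besides the Koszul terms of the factors, the three derivatives of \<open>f^2 g2\<close>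
  contribute \<open>2 f (df(a) g2(b, e) + df(b) g2(a, e) - df(e) g2(a, b))\<close>. The first two
  summands are pairings with \<open>M2\<close> components of size \<open>df / f\<close>; the last is
  the pairing of \<open>- f^2 g2(a, b) G\<close> with the \<open>M1\<close> component of
  \<open>e\<close>, because \<open>G\<close> represents \<open>df / f\<close>.\<close>

lemma warped_connection_coordinate_fields:
  fixes M1 :: "('m1::{t2_space,second_countable_topology}, 'e1::euclidean_space) riemannian"
    and M2 :: "('m2::{t2_space,second_countable_topology}, 'e2::euclidean_space) riemannian"
  assumes M1: "riemannian_manifold M1" and M2: "riemannian_manifold M2"
    and f: "smooth_fun M1 UNIV f" "0 < f (fst p)"
    and D: "levi_civita M1 D1" "levi_civita M2 D2" "levi_civita (warped_product M1 f M2) D"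
    and c1: "c1 \<in> atlas M1" "fst p \<in> cdom c1" and c2: "c2 \<in> atlas M2" "snd p \<in> cdom c2"
    and G: "\<And>w. gmetric M1 (fst p) G w = dfun M1 f (fst p) w / f (fst p)"
  defines "\<delta> \<equiv> \<lambda>a q. tvec (warped_product M1 f M2) (prod_chart c1 c2) q a"
    and "\<delta>1 \<equiv> \<lambda>a q. tvec M1 c1 q a" and "\<delta>2 \<equiv> \<lambda>a q. tvec M2 c2 q a"
  shows "D (\<delta> a) (\<delta> b) p =
    (D1 (\<delta>1 (fst a)) (\<delta>1 (fst b)) (fst p)
       - ((f (fst p))\<^sup>2 * gmetric M2 (snd p) (\<delta>2 (snd a) (snd p)) (\<delta>2 (snd b) (snd p))) *\<^sub>R G,
     D2 (\<delta>2 (snd a)) (\<delta>2 (snd b)) (snd p)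
       + (dfun M1 f (fst p) (\<delta>1 (fst a) (fst p)) / f (fst p)) *\<^sub>R \<delta>2 (snd b) (snd p)
       + (dfun M1 f (fst p) (\<delta>1 (fst b) (fst p)) / f (fst p)) *\<^sub>R \<delta>2 (snd a) (snd p))"
    (is "_ = ?R")
proof -
  let ?M = "warped_product M1 f M2" and ?c = "prod_chart c1 c2"
  let ?p1 = "fst p" and ?p2 = "snd p"
  note M1' = riemannian_manifold_form(1)[OF M1] and M2' = riemannian_manifold_form(1)[OF M2]
  note M = smooth_manifold_warped_product[OF M1' M2', of f]
  note form = metric_form_warped_product[where f = f and p = p, OF M1 M2 f(2)]
  note form1 = riemannian_manifold_form(2)[OF M1] and form2 = riemannian_manifold_form(2)[OF M2]
  note sym1 = metric_formD(2)[OF form1] and sym2 = metric_formD(2)[OF form2]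
  have c: "?c \<in> atlas ?M" "p \<in> cdom ?c" using c1 c2 by (auto simp: mem_Times_iff)
  let ?g = "\<lambda>a b q. gmetric ?M q (\<delta> a q) (\<delta> b q)"
  let ?g1 = "\<lambda>a b q. gmetric M1 q (\<delta>1 a q) (\<delta>1 b q)"
  let ?g2 = "\<lambda>a b q. gmetric M2 q (\<delta>2 a q) (\<delta>2 b q)"
  have \<delta>p: "\<delta> a q = (\<delta>1 (fst a) (fst q), \<delta>2 (snd a) (snd q))" if "fst q \<in> cdom c1" "snd q \<in> cdom c2" for a q
    using that c1 c2 by (simp add: \<delta>_def \<delta>1_def \<delta>2_def tvec_prod_chart[OF M1' M2'])
  have \<delta>p': "\<delta> a p = (\<delta>1 (fst a) ?p1, \<delta>2 (snd a) ?p2)" for a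
    using c1(2) c2(2) by (rule \<delta>p)
  \<comment> \<open>Product rule for \<open>g1 + f^2 g2\<close> in a product chart:
    \<open>g1\<close> and \<open>f\<close> depend on the first coordinates only, \<open>g2\<close>
    on the second ones.\<close>
  have dg: "dfun ?M (?g a b) p (\<delta> e p) = dfun M1 (?g1 (fst a) (fst b)) ?p1 (\<delta>1 (fst e) ?p1)
      + (f ?p1)\<^sup>2 * dfun M2 (?g2 (snd a) (snd b)) ?p2 (\<delta>2 (snd e) ?p2)
      + 2 * f ?p1 * dfun M1 f ?p1 (\<delta>1 (fst e) ?p1) * ?g2 (snd a) (snd b) ?p2" for a b e
  proof -
    let ?L = "\<lambda>v. dfun M1 (?g1 (fst a) (fst b)) ?p1 (\<delta>1 (fst v) ?p1)
      + ((f ?p1)\<^sup>2 * dfun M2 (?g2 (snd a) (snd b)) ?p2 (\<delta>2 (snd v) ?p2)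
      + 2 * f ?p1 * dfun M1 f ?p1 (\<delta>1 (fst v) ?p1) * ?g2 (snd a) (snd b) ?p2)"
    have fst': "((\<lambda>x. k (fst x)) has_derivative (\<lambda>v. k' (fst v))) (at (x, y))"
      if "(k has_derivative k') (at x)" for k k' and x :: 'e1 and y :: 'e2
      using diff_chain_at[OF bounded_linear_imp_has_derivative[OF bounded_linear_fst], of k k' "(x, y)"] that
      by (simp add: o_def)
    have snd': "((\<lambda>x. k (snd x)) has_derivative (\<lambda>v. k' (snd v))) (at (x, y))"
      if "(k has_derivative k') (at y)" for k k' and x :: 'e1 and y :: 'e2
      using diff_chain_at[OF bounded_linear_imp_has_derivative[OF bounded_linear_snd], of k k' "(x, y)"] that
      by (simp add: o_def)
    have k1: "((\<lambda>x. ?g1 (fst a) (fst b) (cinv c1 (fst x))) has_derivative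
        (\<lambda>v. dfun M1 (?g1 (fst a) (fst b)) ?p1 (\<delta>1 (fst v) ?p1))) (at (cmap c1 ?p1, cmap c2 ?p2))"
      unfolding \<delta>1_def by (rule fst'[OF coordinate_metric_has_derivative[OF M1 c1]])
    have k2: "((\<lambda>x. ?g2 (snd a) (snd b) (cinv c2 (snd x))) has_derivative
        (\<lambda>v. dfun M2 (?g2 (snd a) (snd b)) ?p2 (\<delta>2 (snd v) ?p2))) (at (cmap c1 ?p1, cmap c2 ?p2))"
      unfolding \<delta>2_def by (rule snd'[OF coordinate_metric_has_derivative[OF M2 c2]])
    have kf: "((\<lambda>x. f (cinv c1 (fst x))) has_derivative
        (\<lambda>v. dfun M1 f ?p1 (\<delta>1 (fst v) ?p1))) (at (cmap c1 ?p1, cmap c2 ?p2))"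
      unfolding \<delta>1_def by (rule fst'[OF smooth_fun_has_derivative[OF M1' f(1) c1 UNIV_I]])
    have inv: "cinv c1 (cmap c1 ?p1) = ?p1" "cinv c2 (cmap c2 ?p2) = ?p2"
      using c1 c2 cinv_cmap is_chart_atlas[OF M1'] is_chart_atlas[OF M2'] by auto
    have "((\<lambda>x. ?g1 (fst a) (fst b) (cinv c1 (fst x)) +
        (f (cinv c1 (fst x)))\<^sup>2 * ?g2 (snd a) (snd b) (cinv c2 (snd x))) has_derivative ?L)
        (at (cmap c1 ?p1, cmap c2 ?p2))"
      by (rule has_derivative_eq_rhs[OF has_derivative_add[OF k1 has_derivative_mult[OF has_derivative_power[OF kf, of 2] k2]]])
        (simp add: inv algebra_simps)
    then have "((\<lambda>x. ?g a b (cinv ?c x)) has_derivative ?L) (at (cmap c1 ?p1, cmap c2 ?p2))"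
    proof (rule has_derivative_transform_within_open)
      show "open (cimage c1 UNIV \<times> cimage c2 UNIV)"
        using c1 c2 by (intro open_Times open_cimage_atlas[OF M1'] open_cimage_atlas[OF M2']) auto
      show "(cmap c1 ?p1, cmap c2 ?p2) \<in> cimage c1 UNIV \<times> cimage c2 UNIV"
        using c1 c2 by (auto intro: cmap_in_cimage)
      fix x assume "x \<in> cimage c1 UNIV \<times> cimage c2 UNIV"
      then have "cinv c1 (fst x) \<in> cdom c1" "cinv c2 (snd x) \<in> cdom c2"
        using cinv_in_cdom[OF is_chart_atlas[OF M1' c1(1)], of "fst x" UNIV]
          cinv_in_cdom[OF is_chart_atlas[OF M2' c2(1)], of "snd x" UNIV] by (simp_all add: mem_Times_iff)
      then show "?g1 (fst a) (fst b) (cinv c1 (fst x)) + (f (cinv c1 (fst x)))\<^sup>2 * ?g2 (snd a) (snd b) (cinv c2 (snd x)) =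
          ?g a b (cinv ?c x)"
        by (simp add: \<delta>p)
    qed
    then have "((\<lambda>x. ?g a b (cinv ?c x)) has_derivative ?L) (at (cmap ?c p))"
      by (simp add: map_prod_def case_prod_unfold)
    from dfun_eq[OF M c this] show ?thesis
      using c1 c2
      by (simp add: \<delta>_def \<delta>1_def \<delta>2_def tcoord_tvec[OF M c])
  qed
  have "gmetric ?M p (D (\<delta> a) (\<delta> b) p) w = gmetric ?M p ?R w" for w
  proof -
    \<comment> \<open>Every tangent vector at \<open>p\<close> is the value of a coordinate field,
      so testing against coordinate fields is enough for nondegeneracy.\<close>
    define e where "e = tcoord ?M ?c p w"
    have w: "w = \<delta> e p" by (simp add: e_def \<delta>_def tvec_tcoord[OF M c])
    have K1: "2 * gmetric M1 ?p1 (D1 (\<delta>1 x) (\<delta>1 y) ?p1) (\<delta>1 z ?p1) =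
        dfun M1 (?g1 y z) ?p1 (\<delta>1 x ?p1) + dfun M1 (?g1 x z) ?p1 (\<delta>1 y ?p1) - dfun M1 (?g1 x y) ?p1 (\<delta>1 z ?p1)"
      for x y z unfolding \<delta>1_def by (rule koszul_coordinate_fields[OF M1' D(1) sym1 c1])
    have K2: "2 * gmetric M2 ?p2 (D2 (\<delta>2 x) (\<delta>2 y) ?p2) (\<delta>2 z ?p2) =
        dfun M2 (?g2 y z) ?p2 (\<delta>2 x ?p2) + dfun M2 (?g2 x z) ?p2 (\<delta>2 y ?p2) - dfun M2 (?g2 x y) ?p2 (\<delta>2 z ?p2)"
      for x y z unfolding \<delta>2_def by (rule koszul_coordinate_fields[OF M2' D(2) sym2 c2])
    have "2 * gmetric ?M p (D (\<delta> a) (\<delta> b) p) w =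
        dfun ?M (?g b e) p (\<delta> a p) + dfun ?M (?g a e) p (\<delta> b p) - dfun ?M (?g a b) p (\<delta> e p)"
      unfolding w unfolding \<delta>_def by (rule koszul_coordinate_fields[OF M D(3) metric_formD(2)[OF form] c])
    also have "\<dots> = 2 * gmetric M1 ?p1 (D1 (\<delta>1 (fst a)) (\<delta>1 (fst b)) ?p1) (\<delta>1 (fst e) ?p1)
      + (f ?p1)\<^sup>2 * (2 * gmetric M2 ?p2 (D2 (\<delta>2 (snd a)) (\<delta>2 (snd b)) ?p2) (\<delta>2 (snd e) ?p2))
      + 2 * f ?p1 * (dfun M1 f ?p1 (\<delta>1 (fst a) ?p1) * ?g2 (snd b) (snd e) ?p2
        + dfun M1 f ?p1 (\<delta>1 (fst b) ?p1) * ?g2 (snd a) (snd e) ?p2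
        - dfun M1 f ?p1 (\<delta>1 (fst e) ?p1) * ?g2 (snd a) (snd b) ?p2)"
      unfolding dg K1 K2 by (simp add: algebra_simps)
    also have "\<dots> = 2 * gmetric ?M p ?R w"
      using f(2)
      by (simp add: w \<delta>p' bilinear_lsub[OF metric_formD(1)[OF form1]] bilinear_lmul[OF metric_formD(1)[OF form1]]
          bilinear_ladd[OF metric_formD(1)[OF form2]] bilinear_lmul[OF metric_formD(1)[OF form2]] G
          field_simps power2_eq_square)
    finally show ?thesis by simp
  qed
  then show ?thesis
    by (rule form_nondegenerate[OF form])
qed

text \<open>The derivative of the velocity components splits by factor. In the connection term both
  coordinate fields take the value of the velocity at \<open>t\<close>, so the two symmetric
  \<open>df / f\<close> terms of the warped connection coincide; this is the origin of the factor
  2.\<close>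

lemma warped_cov_along:
  fixes M1 :: "('m1::{t2_space,second_countable_topology}, 'e1::euclidean_space) riemannian"
    and M2 :: "('m2::{t2_space,second_countable_topology}, 'e2::euclidean_space) riemannian"
  assumes M1: "riemannian_manifold M1" and M2: "riemannian_manifold M2"
    and f: "smooth_fun M1 UNIV f" "0 < f (fst (\<gamma> t))"
    and D: "levi_civita M1 D1" "levi_civita M2 D2" "levi_civita (warped_product M1 f M2) D"
    and \<gamma>: "smooth_curve (warped_product M1 f M2) I \<gamma>" and I: "open I" "t \<in> I"
    and c1: "c1 \<in> atlas M1" "fst (\<gamma> t) \<in> cdom c1" and c2: "c2 \<in> atlas M2" "snd (\<gamma> t) \<in> cdom c2"
    and G: "\<And>w. gmetric M1 (fst (\<gamma> t)) G w = dfun M1 f (fst (\<gamma> t)) w / f (fst (\<gamma> t))"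
  defines "v1 \<equiv> velocity M1 (\<lambda>t. fst (\<gamma> t))" and "v2 \<equiv> velocity M2 (\<lambda>t. snd (\<gamma> t))"
  shows "cov_along (warped_product M1 f M2) D (prod_chart c1 c2) \<gamma> (velocity (warped_product M1 f M2) \<gamma>) t =
    (cov_along M1 D1 c1 (\<lambda>t. fst (\<gamma> t)) v1 t
       - ((f (fst (\<gamma> t)))\<^sup>2 * gmetric M2 (snd (\<gamma> t)) (v2 t) (v2 t)) *\<^sub>R G,
     cov_along M2 D2 c2 (\<lambda>t. snd (\<gamma> t)) v2 t
       + (2 * (dfun M1 f (fst (\<gamma> t)) (v1 t) / f (fst (\<gamma> t)))) *\<^sub>R v2 t)"
proof -
  let ?M = "warped_product M1 f M2" and ?c = "prod_chart c1 c2"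
  let ?\<gamma>1 = "\<lambda>t. fst (\<gamma> t)" and ?\<gamma>2 = "\<lambda>t. snd (\<gamma> t)"
  note M1' = riemannian_manifold_form(1)[OF M1] and M2' = riemannian_manifold_form(1)[OF M2]
  note M = smooth_manifold_warped_product[OF M1' M2', of f]
  have D': "affine_connection M1 D1" "affine_connection M2 D2" "affine_connection ?M D"
    using D by (auto simp: levi_civita_def)
  note \<gamma>' = smooth_curve_warped_product[OF M1' M2' \<gamma> I(1)]
  have c: "?c \<in> atlas ?M" "\<gamma> t \<in> cdom ?c" using c1 c2 by (auto simp: mem_Times_iff)
  have vel: "velocity ?M \<gamma> s = (v1 s, v2 s)" if "s \<in> I" for s
    using that unfolding v1_def v2_def by (rule velocity_warped_product[OF M1' M2' \<gamma> I(1)])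
  let ?y1 = "\<lambda>s. tcoord M1 c1 (?\<gamma>1 s) (v1 s)" and ?y2 = "\<lambda>s. tcoord M2 c2 (?\<gamma>2 s) (v2 s)"
  let ?y = "\<lambda>s. tcoord ?M ?c (\<gamma> s) (velocity ?M \<gamma> s)"
  have yp: "?y s = (?y1 s, ?y2 s)" if "s \<in> I" "\<gamma> s \<in> cdom ?c" for s
    using that c1 c2 by (simp add: vel tcoord_prod_chart[OF M1' M2'] mem_Times_iff)
  have y1: "(?y1 has_vector_derivative vector_derivative ?y1 (at t)) (at t)"
    unfolding vector_derivative_works[symmetric] v1_def
    using smooth_on_has_derivative[OF smooth_tcoord_velocity[OF M1' \<gamma>'(1) I(1) c1(1)], of t] I c1
    by (auto simp: differentiable_def)
  have y2: "(?y2 has_vector_derivative vector_derivative ?y2 (at t)) (at t)"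
    unfolding vector_derivative_works[symmetric] v2_def
    using smooth_on_has_derivative[OF smooth_tcoord_velocity[OF M2' \<gamma>'(2) I(1) c2(1)], of t] I c2
    by (auto simp: differentiable_def)
  have y': "vector_derivative ?y (at t) = (vector_derivative ?y1 (at t), vector_derivative ?y2 (at t))"
  proof (rule vector_derivative_at)
    show "(?y has_vector_derivative (vector_derivative ?y1 (at t), vector_derivative ?y2 (at t))) (at t)"
      by (rule has_vector_derivative_transform_within_open[OF has_vector_derivative_Pair[OF y1 y2]
            open_curve_preimage[OF M \<gamma> I(1) c(1)]])
        (use I c yp in auto)
  qed
  have x1: "vector_derivative (\<lambda>s. cmap c1 (?\<gamma>1 s)) (at t) = ?y1 t"
    unfolding v1_def by (rule vector_derivative_at[OF curve_has_vector_derivative[OF M1' \<gamma>'(1) I c1]])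
  have x2: "vector_derivative (\<lambda>s. cmap c2 (?\<gamma>2 s)) (at t) = ?y2 t"
    unfolding v2_def by (rule vector_derivative_at[OF curve_has_vector_derivative[OF M2' \<gamma>'(2) I c2]])
  have x: "vector_derivative (\<lambda>s. cmap ?c (\<gamma> s)) (at t) = (?y1 t, ?y2 t)"
    using vector_derivative_at[OF curve_has_vector_derivative[OF M \<gamma> I c]] yp[OF I(2) c(2)] by simp
  show ?thesis
    unfolding cov_along_eq[where \<gamma> = \<gamma> and t = t and V = "velocity ?M \<gamma>", OF M D'(3) c]
      cov_along_eq[where \<gamma> = "?\<gamma>1" and t = t, OF M1' D'(1) c1] cov_along_eq[where \<gamma> = "?\<gamma>2" and t = t, OF M2' D'(2) c2]
      x x1 x2 yp[OF I(2) c(2)] y'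
      warped_connection_coordinate_fields[OF M1 M2 f D c1 c2 G]
    using c1 c2
    by (simp add: tvec_prod_chart[OF M1' M2'] tvec_tcoord[OF M1'] tvec_tcoord[OF M2'] scaleR_add_left[symmetric])
qed

text \<open>A function lifted from \<open>M1\<close> has no derivative along \<open>M2\<close>, and
  the warped metric does not rescale the \<open>M1\<close> part; hence the gradient is the lift of
  \<open>G\<close>.\<close>

lemma grad_ln_warping:
  fixes M1 :: "('m1::{t2_space,second_countable_topology}, 'e1::euclidean_space) riemannian"
    and M2 :: "('m2::{t2_space,second_countable_topology}, 'e2::euclidean_space) riemannian"
  assumes M1: "riemannian_manifold M1" and M2: "riemannian_manifold M2"
    and f: "smooth_fun M1 UNIV f" "0 < f (fst p)"
    and G: "\<And>w. gmetric M1 (fst p) G w = dfun M1 f (fst p) w / f (fst p)"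
  shows "grad (warped_product M1 f M2) (\<lambda>p. ln (f (fst p))) p = (G, 0)"
proof -
  let ?M = "warped_product M1 f M2"
  note M1' = riemannian_manifold_form(1)[OF M1] and M2' = riemannian_manifold_form(1)[OF M2]
  note M = smooth_manifold_warped_product[OF M1' M2', of f]
  let ?c1 = "chart_at M1 (fst p)" and ?c2 = "chart_at M2 (snd p)"
  note c1 = chart_at_atlas[OF M1', of "fst p"] and c2 = chart_at_atlas[OF M2', of "snd p"]
  have c: "prod_chart ?c1 ?c2 \<in> atlas ?M" "p \<in> cdom (prod_chart ?c1 ?c2)"
    using c1 c2 by (auto simp: mem_Times_iff)
  have d: "dfun ?M (\<lambda>p. ln (f (fst p))) p w = dfun M1 f (fst p) (fst w) / f (fst p)" for w
  proof -
    have inv: "cinv ?c1 (cmap ?c1 (fst p)) = fst p"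
      using c1 cinv_cmap is_chart_atlas[OF M1'] by auto
    have "((\<lambda>x. ln (f (cinv ?c1 x))) has_derivative
        (\<lambda>v. dfun M1 f (fst p) (tvec M1 ?c1 (fst p) v) / f (fst p))) (at (cmap ?c1 (fst p)))"
      by (rule has_derivative_eq_rhs[OF has_derivative_ln[OF _ smooth_fun_has_derivative[OF M1' f(1) c1 UNIV_I]]])
        (use f(2) in \<open>simp_all add: inv divide_inverse\<close>)
    from diff_chain_at[OF bounded_linear_imp_has_derivative[OF bounded_linear_fst], of _ _ "(cmap ?c1 (fst p), cmap ?c2 (snd p))", simplified, OF this]
    have "((\<lambda>x. ln (f (fst (cinv (prod_chart ?c1 ?c2) x)))) has_derivative
        (\<lambda>v. dfun M1 f (fst p) (tvec M1 ?c1 (fst p) (fst v)) / f (fst p))) (at (cmap (prod_chart ?c1 ?c2) p))"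
      by (simp add: o_def map_prod_def case_prod_unfold)
    from dfun_eq[OF M c this] show ?thesis
      using c1 c2 by (simp add: tcoord_prod_chart[OF M1' M2'] tvec_tcoord[OF M1'])
  qed
  have z: "gmetric M2 (snd p) 0 w = 0" for w
    by (rule bilinear_lzero[OF metric_formD(1)[OF riemannian_manifold_form(2)[OF M2]]])
  have 1: "gmetric ?M p (G, 0) w = dfun ?M (\<lambda>p. ln (f (fst p))) p w" for w
    by (simp add: d G z)
  show ?thesis
    unfolding grad_def
  proof (rule the_equality)
    show "v = (G, 0)" if "\<forall>w. gmetric ?M p v w = dfun ?M (\<lambda>p. ln (f (fst p))) p w" for v
      by (rule form_nondegenerate[OF metric_form_warped_product[where f = f and p = p, OF M1 M2 f(2)]])
        (simp only: that[rule_format] 1)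
  qed (simp only: 1, blast)
qed



subsection \<open>Vertical and horizontal components\<close>

lemma component_fields_at:
  assumes "component_fields M N \<phi> \<gamma> t U Y"
  shows "U (\<gamma> t) = vproj M N \<phi> (\<gamma> t) (velocity M \<gamma> t)" and "Y (\<gamma> t) = hproj M N \<phi> (\<gamma> t) (velocity M \<gamma> t)"
  using assms unfolding component_fields_def local_extension_def by blast+

text \<open>The two extensions come with separate neighbourhoods; intersecting them lets both fields
  be used together.\<close>

lemma component_fields_obtain:
  assumes "component_fields M N \<phi> \<gamma> t U Y"
  obtains W K where "open W" "\<gamma> t \<in> W" "open K" "t \<in> K"
    "smooth_vf M W U" "\<And>q. q \<in> W \<Longrightarrow> U q \<in> vertical_space M N \<phi> q"
    "smooth_vf M W Y" "\<And>q. q \<in> W \<Longrightarrow> Y q \<in> horizontal_space M N \<phi> q"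
    "\<And>s. s \<in> K \<Longrightarrow> U (\<gamma> s) = vproj M N \<phi> (\<gamma> s) (velocity M \<gamma> s)"
    "\<And>s. s \<in> K \<Longrightarrow> Y (\<gamma> s) = hproj M N \<phi> (\<gamma> s) (velocity M \<gamma> s)"
proof -
  obtain W1 K1 W2 K2 where U: "open W1" "\<gamma> t \<in> W1" "smooth_vf M W1 U" "\<forall>q\<in>W1. U q \<in> vertical_space M N \<phi> q"
      "open K1" "t \<in> K1" "\<forall>s\<in>K1. U (\<gamma> s) = vproj M N \<phi> (\<gamma> s) (velocity M \<gamma> s)"
    and Y: "open W2" "\<gamma> t \<in> W2" "smooth_vf M W2 Y" "\<forall>q\<in>W2. Y q \<in> horizontal_space M N \<phi> q"
      "open K2" "t \<in> K2" "\<forall>s\<in>K2. Y (\<gamma> s) = hproj M N \<phi> (\<gamma> s) (velocity M \<gamma> s)"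
    using assms unfolding component_fields_def local_extension_def by blast
  show ?thesis
    by (rule that[of "W1 \<inter> W2" "K1 \<inter> K2"])
      (use U Y smooth_vf_subset[OF U(3), of "W1 \<inter> W2"] smooth_vf_subset[OF Y(3), of "W1 \<inter> W2"] in auto)
qed

section \<open>Projections of one factor and the O'Neill tensors\<close>

lemma tmap_has_derivative:
  assumes M: "smooth_manifold M" and N: "smooth_manifold N" and \<phi>: "smooth_map M N \<phi>"
  shows "((\<lambda>x. cmap (chart_at N (\<phi> p)) (\<phi> (cinv (chart_at M p) x))) has_derivative tmap M N \<phi> p)
    (at (cmap (chart_at M p) p))"
proof -
  let ?F = "\<lambda>x. cmap (chart_at N (\<phi> p)) (\<phi> (cinv (chart_at M p) x))"
  have "smooth_on ?F (cimage (chart_at M p) (\<phi> -` cdom (chart_at N (\<phi> p))))"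
    using \<phi> chart_at_atlas(1)[OF M] chart_at_atlas(1)[OF N] unfolding smooth_map_def by blast
  moreover have "cmap (chart_at M p) p \<in> cimage (chart_at M p) (\<phi> -` cdom (chart_at N (\<phi> p)))"
    using chart_at_atlas(2)[OF M] chart_at_atlas(2)[OF N] by (intro cmap_in_cimage) auto
  moreover have "tmap M N \<phi> p = frechet_derivative ?F (at (cmap (chart_at M p) p))"
    by (simp add: fun_eq_iff tmap_def)
  ultimately show ?thesis
    using smooth_on_has_derivative[of ?F] by simp
qed

context
  fixes M :: "('m::{t2_space,second_countable_topology}, 'e::euclidean_space) riemannian"
    and N :: "('n::{t2_space,second_countable_topology}, 'd::euclidean_space) riemannian"
    and \<phi> :: "'m \<Rightarrow> 'n"
  assumes M: "riemannian_manifold M" and N: "smooth_manifold N" and \<phi>: "smooth_map M N \<phi>"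
begin

lemma subspace_vertical: "subspace (vertical_space M N \<phi> p)"
  using linear_subspace_kernel[OF has_derivative_linear[OF tmap_has_derivative[OF riemannian_manifold_form(1)[OF M] N \<phi>]]]
  by (simp add: vertical_space_def)

lemma linear_vproj: "linear (vproj M N \<phi> p)"
  unfolding vproj_def
  by (rule linear_orth_proj[OF riemannian_manifold_form(2)[OF M] subspace_vertical])

lemma hproj_eq: "hproj M N \<phi> p v = v - vproj M N \<phi> p v"
  unfolding hproj_def vproj_def horizontal_space_def
  by (rule orth_proj_complement[OF riemannian_manifold_form(2)[OF M] subspace_vertical])

lemma linear_hproj: "linear (hproj M N \<phi> p)"
  using linear_compose_sub[OF linear_id linear_vproj] unfolding hproj_eq[abs_def] by (simp add: id_def)

lemma vproj_vertical: "v \<in> vertical_space M N \<phi> p \<Longrightarrow> vproj M N \<phi> p v = v"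
  unfolding vproj_def
  by (rule orth_proj_same[OF riemannian_manifold_form(2)[OF M] subspace_vertical])

lemma vproj_horizontal: "v \<in> horizontal_space M N \<phi> p \<Longrightarrow> vproj M N \<phi> p v = 0"
  unfolding vproj_def horizontal_space_def
  by (rule orth_proj_orthogonal[OF riemannian_manifold_form(2)[OF M] subspace_vertical]) auto

lemma hproj_vertical: "v \<in> vertical_space M N \<phi> p \<Longrightarrow> hproj M N \<phi> p v = 0"
  by (simp add: hproj_eq vproj_vertical)

lemma hproj_horizontal: "v \<in> horizontal_space M N \<phi> p \<Longrightarrow> hproj M N \<phi> p v = v"
  by (simp add: hproj_eq vproj_horizontal)

lemma vproj_in_vertical: "vproj M N \<phi> p v \<in> vertical_space M N \<phi> p"
  unfolding vproj_def
  by (rule orth_proj(1)[OF riemannian_manifold_form(2)[OF M] subspace_vertical])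

lemma vproj_residual: "w \<in> vertical_space M N \<phi> p \<Longrightarrow> gmetric M p (v - vproj M N \<phi> p v) w = 0"
  unfolding vproj_def
  by (rule orth_proj(2)[OF riemannian_manifold_form(2)[OF M] subspace_vertical])

text \<open>On \<open>W\<close> the projections inside the tensors fix the field or send it to 0,
  and by locality the connection sees nothing else. Of the two summands one becomes a derivative of
  the zero field, and the other is the stated projection.\<close>

lemma oneill_tensors_eq:
  assumes D: "affine_connection M D" and W: "open W" "p \<in> W"
    and U: "smooth_vf M W U" "\<And>q. q \<in> W \<Longrightarrow> U q \<in> vertical_space M N \<phi> q"
    and Y: "smooth_vf M W Y" "\<And>q. q \<in> W \<Longrightarrow> Y q \<in> horizontal_space M N \<phi> q"
  shows "oneill_T M N \<phi> D U U p = hproj M N \<phi> p (D U U p)"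
    and "oneill_T M N \<phi> D U Y p = vproj M N \<phi> p (D U Y p)"
    and "oneill_A M N \<phi> D Y Y p = vproj M N \<phi> p (D Y Y p)"
    and "oneill_A M N \<phi> D Y U p = hproj M N \<phi> p (D Y U p)"
proof -
  note M' = riemannian_manifold_form(1)[OF M]
  note cong = connection_cong[OF M' D W, symmetric]
  note zero = smooth_vf_zero[OF M' W(1)]
  have D0: "D X (\<lambda>q. 0) p = 0" if "smooth_vf M W X" for X
    using that W by (intro connection_zero_right[OF M' D])
  have V: "U q = vproj M N \<phi> q (U q)" "0 = hproj M N \<phi> q (U q)"
    "0 = vproj M N \<phi> q (Y q)" "Y q = hproj M N \<phi> q (Y q)" if "q \<in> W" for q
    using U(2)[OF that] Y(2)[OF that]
    by (simp_all add: vproj_vertical hproj_vertical vproj_horizontal hproj_horizontal)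
  note lin0 = linear_0[OF linear_vproj] linear_0[OF linear_hproj]
  note U1 = U(1) and Y1 = Y(1)
  show "oneill_T M N \<phi> D U U p = hproj M N \<phi> p (D U U p)"
    by (simp add: oneill_T_def Let_def cong[OF U1 U1 V(1) V(1)] cong[OF U1 zero V(1) V(2)] D0 U1 lin0)
  show "oneill_T M N \<phi> D U Y p = vproj M N \<phi> p (D U Y p)"
    by (simp add: oneill_T_def Let_def cong[OF U1 zero V(1) V(3)] cong[OF U1 Y1 V(1) V(4)] D0 U1 lin0)
  show "oneill_A M N \<phi> D Y Y p = vproj M N \<phi> p (D Y Y p)"
    by (simp add: oneill_A_def Let_def cong[OF Y1 zero V(4) V(3)] cong[OF Y1 Y1 V(4) V(4)] D0 Y1 lin0)
  show "oneill_A M N \<phi> D Y U p = hproj M N \<phi> p (D Y U p)"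
    by (simp add: oneill_A_def Let_def cong[OF Y1 U1 V(4) V(1)] cong[OF Y1 zero V(4) V(2)] D0 Y1 lin0)
qed

context
  fixes D \<gamma> I t U Y c
  assumes D: "affine_connection M D" and \<gamma>: "smooth_curve M I \<gamma>" and I: "open I" "t \<in> I"
    and c: "c \<in> atlas M" "\<gamma> t \<in> cdom c" and UY: "component_fields M N \<phi> \<gamma> t U Y"
begin

text \<open>\<open>U + Y\<close> extends the velocity because the two projections add up to the
  identity. Expanding \<open>D\<close> biadditively on \<open>U + Y\<close> gives four terms; each
  projection of each term is an O'Neill tensor or a projected connection by definition.\<close>

lemma cov_along_components:
  shows "vproj M N \<phi> (\<gamma> t) (cov_along M D c \<gamma> (velocity M \<gamma>) t) =
      vnabla M N \<phi> D U U (\<gamma> t) + oneill_T M N \<phi> D U Y (\<gamma> t) + vnabla M N \<phi> D Y U (\<gamma> t) + oneill_A M N \<phi> D Y Y (\<gamma> t)"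
    and "hproj M N \<phi> (\<gamma> t) (cov_along M D c \<gamma> (velocity M \<gamma>) t) =
      oneill_T M N \<phi> D U U (\<gamma> t) + hnabla M N \<phi> D U Y (\<gamma> t) + oneill_A M N \<phi> D Y U (\<gamma> t) + hnabla M N \<phi> D Y Y (\<gamma> t)"
proof -
  note M' = riemannian_manifold_form(1)[OF M]
  obtain W K where W: "open W" "\<gamma> t \<in> W" and K: "open K" "t \<in> K"
    and U: "smooth_vf M W U" "\<And>q. q \<in> W \<Longrightarrow> U q \<in> vertical_space M N \<phi> q"
    and Y: "smooth_vf M W Y" "\<And>q. q \<in> W \<Longrightarrow> Y q \<in> horizontal_space M N \<phi> q"
    and ext: "\<And>s. s \<in> K \<Longrightarrow> U (\<gamma> s) = vproj M N \<phi> (\<gamma> s) (velocity M \<gamma> s)"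
      "\<And>s. s \<in> K \<Longrightarrow> Y (\<gamma> s) = hproj M N \<phi> (\<gamma> s) (velocity M \<gamma> s)"
    by (rule component_fields_obtain[OF UY]) blast
  let ?X = "\<lambda>q. U q + Y q"
  have X: "smooth_vf M W ?X" using W(1) U(1) Y(1) by (rule smooth_vf_add[OF M'])
  have "cov_along M D c \<gamma> (velocity M \<gamma>) t = D ?X ?X (\<gamma> t)"
    by (rule cov_along_extension[OF M' D \<gamma> I c W X K]) (simp add: ext hproj_eq)
  also have "\<dots> = D U U (\<gamma> t) + D U Y (\<gamma> t) + D Y U (\<gamma> t) + D Y Y (\<gamma> t)"
    by (simp add: connection_add_left[OF M' D W(1) U(1) Y(1) X W(2)] connection_add_right[OF M' D W(1) _ U(1) Y(1) W(2)]
        U(1) Y(1))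
  finally have C: "cov_along M D c \<gamma> (velocity M \<gamma>) t =
    D U U (\<gamma> t) + D U Y (\<gamma> t) + D Y U (\<gamma> t) + D Y Y (\<gamma> t)" .
  note [simp] = C oneill_tensors_eq[OF D W U Y] vnabla_def hnabla_def
  show "vproj M N \<phi> (\<gamma> t) (cov_along M D c \<gamma> (velocity M \<gamma>) t) =
      vnabla M N \<phi> D U U (\<gamma> t) + oneill_T M N \<phi> D U Y (\<gamma> t) + vnabla M N \<phi> D Y U (\<gamma> t) + oneill_A M N \<phi> D Y Y (\<gamma> t)"
    by (simp add: linear_add[OF linear_vproj])
  show "hproj M N \<phi> (\<gamma> t) (cov_along M D c \<gamma> (velocity M \<gamma>) t) =
      oneill_T M N \<phi> D U U (\<gamma> t) + hnabla M N \<phi> D U Y (\<gamma> t) + oneill_A M N \<phi> D Y U (\<gamma> t) + hnabla M N \<phi> D Y Y (\<gamma> t)"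
    by (simp add: linear_add[OF linear_hproj])
qed

text \<open>Here the other component field vanishes along the curve, but not necessarily near it.\<close>

lemma cov_along_components_vertical:
  assumes vert: "\<And>s. s \<in> I \<Longrightarrow> velocity M \<gamma> s \<in> vertical_space M N \<phi> (\<gamma> s)"
  shows "vproj M N \<phi> (\<gamma> t) (cov_along M D c \<gamma> (velocity M \<gamma>) t) = vnabla M N \<phi> D U U (\<gamma> t)"
    and "hproj M N \<phi> (\<gamma> t) (cov_along M D c \<gamma> (velocity M \<gamma>) t) = oneill_T M N \<phi> D U U (\<gamma> t)"
proof -
  note M' = riemannian_manifold_form(1)[OF M]
  obtain W K where W: "open W" "\<gamma> t \<in> W" and K: "open K" "t \<in> K"
    and U: "smooth_vf M W U" "\<And>q. q \<in> W \<Longrightarrow> U q \<in> vertical_space M N \<phi> q"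
    and Y: "smooth_vf M W Y" "\<And>q. q \<in> W \<Longrightarrow> Y q \<in> horizontal_space M N \<phi> q"
    and ext: "\<And>s. s \<in> K \<Longrightarrow> U (\<gamma> s) = vproj M N \<phi> (\<gamma> s) (velocity M \<gamma> s)"
      "\<And>s. s \<in> K \<Longrightarrow> Y (\<gamma> s) = hproj M N \<phi> (\<gamma> s) (velocity M \<gamma> s)"
    by (rule component_fields_obtain[OF UY]) blast
  have "cov_along M D c \<gamma> (velocity M \<gamma>) t = D U U (\<gamma> t)"
    by (rule cov_along_extension[OF M' D \<gamma> I c W U(1) K]) (simp add: ext vproj_vertical vert)
  then show "vproj M N \<phi> (\<gamma> t) (cov_along M D c \<gamma> (velocity M \<gamma>) t) = vnabla M N \<phi> D U U (\<gamma> t)"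
    "hproj M N \<phi> (\<gamma> t) (cov_along M D c \<gamma> (velocity M \<gamma>) t) = oneill_T M N \<phi> D U U (\<gamma> t)"
    by (simp_all add: oneill_tensors_eq[OF D W U Y] vnabla_def)
qed

text \<open>The horizontal projection fixes the velocity, so \<open>Y\<close> alone extends it and
  the terms containing \<open>U\<close> never arise.\<close>

lemma cov_along_components_horizontal:
  assumes hor: "\<And>s. s \<in> I \<Longrightarrow> velocity M \<gamma> s \<in> horizontal_space M N \<phi> (\<gamma> s)"
  shows "vproj M N \<phi> (\<gamma> t) (cov_along M D c \<gamma> (velocity M \<gamma>) t) = oneill_A M N \<phi> D Y Y (\<gamma> t)"
    and "hproj M N \<phi> (\<gamma> t) (cov_along M D c \<gamma> (velocity M \<gamma>) t) = hnabla M N \<phi> D Y Y (\<gamma> t)"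
proof -
  note M' = riemannian_manifold_form(1)[OF M]
  obtain W K where W: "open W" "\<gamma> t \<in> W" and K: "open K" "t \<in> K"
    and U: "smooth_vf M W U" "\<And>q. q \<in> W \<Longrightarrow> U q \<in> vertical_space M N \<phi> q"
    and Y: "smooth_vf M W Y" "\<And>q. q \<in> W \<Longrightarrow> Y q \<in> horizontal_space M N \<phi> q"
    and ext: "\<And>s. s \<in> K \<Longrightarrow> U (\<gamma> s) = vproj M N \<phi> (\<gamma> s) (velocity M \<gamma> s)"
      "\<And>s. s \<in> K \<Longrightarrow> Y (\<gamma> s) = hproj M N \<phi> (\<gamma> s) (velocity M \<gamma> s)"
    by (rule component_fields_obtain[OF UY]) blast
  have "cov_along M D c \<gamma> (velocity M \<gamma>) t = D Y Y (\<gamma> t)"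
    by (rule cov_along_extension[OF M' D \<gamma> I c W Y(1) K]) (simp add: ext hproj_horizontal hor)
  then show "vproj M N \<phi> (\<gamma> t) (cov_along M D c \<gamma> (velocity M \<gamma>) t) = oneill_A M N \<phi> D Y Y (\<gamma> t)"
    "hproj M N \<phi> (\<gamma> t) (cov_along M D c \<gamma> (velocity M \<gamma>) t) = hnabla M N \<phi> D Y Y (\<gamma> t)"
    by (simp_all add: oneill_tensors_eq[OF D W U Y] hnabla_def)
qed

end

end

section \<open>Kernel, complement and projections of a product map\<close>

context
  fixes M1 :: "('m1::{t2_space,second_countable_topology}, 'e1::euclidean_space) riemannian"
    and M2 :: "('m2::{t2_space,second_countable_topology}, 'e2::euclidean_space) riemannian"
    and N1 :: "('n1::{t2_space,second_countable_topology}, 'd1::euclidean_space) riemannian"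
    and N2 :: "('n2::{t2_space,second_countable_topology}, 'd2::euclidean_space) riemannian"
    and f :: "'m1 \<Rightarrow> real" and \<rho> :: "'n1 \<Rightarrow> real" and \<phi>1 :: "'m1 \<Rightarrow> 'n1" and \<phi>2 :: "'m2 \<Rightarrow> 'n2"
  assumes M1: "riemannian_manifold M1" and M2: "riemannian_manifold M2"
    and N1: "smooth_manifold N1" and N2: "smooth_manifold N2"
    and \<phi>1: "smooth_map M1 N1 \<phi>1" and \<phi>2: "smooth_map M2 N2 \<phi>2" and f: "\<And>p. 0 < f p"
begin

lemma vertical_space_map_prod:
  "vertical_space (warped_product M1 f M2) (warped_product N1 \<rho> N2) (map_prod \<phi>1 \<phi>2) p =
    vertical_space M1 N1 \<phi>1 (fst p) \<times> vertical_space M2 N2 \<phi>2 (snd p)"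
proof -
  have "tmap (warped_product M1 f M2) (warped_product N1 \<rho> N2) (map_prod \<phi>1 \<phi>2) p =
      map_prod (tmap M1 N1 \<phi>1 (fst p)) (tmap M2 N2 \<phi>2 (snd p))"
    using frechet_derivative_at[OF has_derivative_map_prod[OF
        tmap_has_derivative[OF riemannian_manifold_form(1)[OF M1] N1 \<phi>1, of "fst p"]
        tmap_has_derivative[OF riemannian_manifold_form(1)[OF M2] N2 \<phi>2, of "snd p"]]]
    by (simp add: fun_eq_iff tmap_def[of "warped_product M1 f M2"] map_prod_def case_prod_unfold)
  then show ?thesis
    by (auto simp: vertical_space_def zero_prod_def map_prod_def case_prod_unfold)
qed

text \<open>The weight \<open>f^2\<close> multiplies a pairing that is already 0, so the pair of
  residuals in the factors is orthogonal for the warped metric.\<close>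

lemma vproj_map_prod:
  "vproj (warped_product M1 f M2) (warped_product N1 \<rho> N2) (map_prod \<phi>1 \<phi>2) p v =
    (vproj M1 N1 \<phi>1 (fst p) (fst v), vproj M2 N2 \<phi>2 (snd p) (snd v))"
  unfolding vproj_def[of "warped_product M1 f M2"] vertical_space_map_prod
  by (rule orth_proj_eqI[OF metric_form_warped_product[where f = f and p = p, OF M1 M2 f]])
    (auto intro!: subspace_Times subspace_vertical vproj_in_vertical simp: vproj_residual M1 M2 N1 N2 \<phi>1 \<phi>2)

lemma hproj_map_prod:
  "hproj (warped_product M1 f M2) (warped_product N1 \<rho> N2) (map_prod \<phi>1 \<phi>2) p v =
    (hproj M1 N1 \<phi>1 (fst p) (fst v), hproj M2 N2 \<phi>2 (snd p) (snd v))"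
proof -
  have "subspace (vertical_space (warped_product M1 f M2) (warped_product N1 \<rho> N2) (map_prod \<phi>1 \<phi>2) p)"
    unfolding vertical_space_map_prod
    by (intro subspace_Times subspace_vertical M1 M2 N1 N2 \<phi>1 \<phi>2)
  from orth_proj_complement[OF metric_form_warped_product[where f = f and p = p, OF M1 M2 f] this, of v]
  have "hproj (warped_product M1 f M2) (warped_product N1 \<rho> N2) (map_prod \<phi>1 \<phi>2) p v =
      v - vproj (warped_product M1 f M2) (warped_product N1 \<rho> N2) (map_prod \<phi>1 \<phi>2) p v"
    unfolding hproj_def vproj_def horizontal_space_def .
  then show ?thesis
    by (simp add: vproj_map_prod hproj_eq[OF M1 N1 \<phi>1] hproj_eq[OF M2 N2 \<phi>2] prod_eq_iff)
qed

lemma horizontal_space_map_prod: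
  "horizontal_space (warped_product M1 f M2) (warped_product N1 \<rho> N2) (map_prod \<phi>1 \<phi>2) p =
    horizontal_space M1 N1 \<phi>1 (fst p) \<times> horizontal_space M2 N2 \<phi>2 (snd p)"
proof -
  \<comment> \<open>Testing with \<open>(w, 0)\<close> and \<open>(0, w)\<close> separates the two
    orthogonality conditions; since \<open>f\<close> is nonzero, the weight can be cancelled in the
    second.\<close>
  have z: "0 \<in> vertical_space M1 N1 \<phi>1 (fst p)" "0 \<in> vertical_space M2 N2 \<phi>2 (snd p)"
    by (intro subspace_0 subspace_vertical M1 M2 N1 N2 \<phi>1 \<phi>2)+
  have b: "gmetric M1 (fst p) u 0 = 0" "gmetric M2 (snd p) v 0 = 0" for u v
    using bilinear_rzero metric_formD(1) riemannian_manifold_form(2) M1 M2 by metis+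
  have "f (fst p) \<noteq> 0" using f[of "fst p"] by simp
  then show ?thesis
    using z b by (fastforce simp: horizontal_space_def vertical_space_map_prod)
qed

end

theorem theorem3p1:
  fixes M1 :: "('m1::{t2_space,second_countable_topology}, 'e1::euclidean_space) riemannian"
    and M2 :: "('m2::{t2_space,second_countable_topology}, 'e2::euclidean_space) riemannian"
    and N1 :: "('n1::{t2_space,second_countable_topology}, 'd1::euclidean_space) riemannian"
    and N2 :: "('n2::{t2_space,second_countable_topology}, 'd2::euclidean_space) riemannian"
    and f :: "'m1 \<Rightarrow> real" and \<rho> :: "'n1 \<Rightarrow> real"
    and \<phi>1 :: "'m1 \<Rightarrow> 'n1" and \<phi>2 :: "'m2 \<Rightarrow> 'n2" and \<phi> :: "'m1 \<times> 'm2 \<Rightarrow> 'n1 \<times> 'n2"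
    and M :: "('m1 \<times> 'm2, 'e1 \<times> 'e2) riemannian"
    and N :: "('n1 \<times> 'n2, 'd1 \<times> 'd2) riemannian"
    and D1 :: "('m1 \<Rightarrow> 'e1) \<Rightarrow> ('m1 \<Rightarrow> 'e1) \<Rightarrow> 'm1 \<Rightarrow> 'e1"
    and D2 :: "('m2 \<Rightarrow> 'e2) \<Rightarrow> ('m2 \<Rightarrow> 'e2) \<Rightarrow> 'm2 \<Rightarrow> 'e2"
    and D :: "('m1 \<times> 'm2 \<Rightarrow> 'e1 \<times> 'e2) \<Rightarrow> ('m1 \<times> 'm2 \<Rightarrow> 'e1 \<times> 'e2) \<Rightarrow> 'm1 \<times> 'm2 \<Rightarrow> 'e1 \<times> 'e2"
    and I J :: "real set"
    and \<gamma> :: "real \<Rightarrow> 'm1 \<times> 'm2" and \<gamma>1 :: "real \<Rightarrow> 'm1" and \<gamma>2 :: "real \<Rightarrow> 'm2"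
    and U1 Y1 :: "real \<Rightarrow> 'm1 \<Rightarrow> 'e1" and U2 Y2 :: "real \<Rightarrow> 'm2 \<Rightarrow> 'e2"
    and u1 y1 :: "real \<Rightarrow> 'e1" and u2 y2 :: "real \<Rightarrow> 'e2"
    and gradlnf :: "real \<Rightarrow> 'e1 \<times> 'e2"
    and g :: "real \<Rightarrow> 'e1 \<times> 'e2 \<Rightarrow> 'e1 \<times> 'e2 \<Rightarrow> real"
  assumes "riemannian_warped_product_map M1 f M2 N1 \<rho> N2 \<phi>1 \<phi>2 \<phi>"
    and "M = warped_product M1 f M2" and "N = warped_product N1 \<rho> N2"
    and "levi_civita M1 D1" and "levi_civita M2 D2" and "levi_civita M D"
    and "open I" and "is_interval I" and "regular_curve M I \<gamma>"
    and "\<gamma>1 = (\<lambda>t. fst (\<gamma> t))" and "\<gamma>2 = (\<lambda>t. snd (\<gamma> t))"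
    \<comment> \<open>the components of the velocity are local vector fields; a component \<open>\<gamma>i\<close> need not be regular,
      so this is required only on a dense subset \<open>J\<close> of \<open>I\<close> (which may be \<open>I\<close> itself)\<close>
    and "J \<subseteq> I" and "I \<subseteq> closure J"
    and "\<forall>t\<in>J. component_fields M1 N1 \<phi>1 \<gamma>1 t (U1 t) (Y1 t)"
    and "\<forall>t\<in>J. component_fields M2 N2 \<phi>2 \<gamma>2 t (U2 t) (Y2 t)"
    \<comment> \<open>abbreviations: values along the curve\<close>
    and "u1 = (\<lambda>t. U1 t (\<gamma>1 t))" and "y1 = (\<lambda>t. Y1 t (\<gamma>1 t))"
    and "u2 = (\<lambda>t. U2 t (\<gamma>2 t))" and "y2 = (\<lambda>t. Y2 t (\<gamma>2 t))"
    and "g = (\<lambda>t. gmetric M (\<gamma> t))"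
    and "gradlnf = (\<lambda>t. grad M (\<lambda>p. ln (f (fst p))) (\<gamma> t))"
  shows
    "((\<forall>t\<in>I. velocity M \<gamma> t \<in> vertical_space M N \<phi> (\<gamma> t)) \<longrightarrow>
       (geodesic M D I \<gamma> \<longleftrightarrow>
         (\<forall>t\<in>J.
           lift1 (vnabla M1 N1 \<phi>1 D1 (U1 t) (U1 t) (\<gamma>1 t))
           + (2 * (dfun M1 f (\<gamma>1 t) (u1 t) / f (\<gamma>1 t))) *\<^sub>R lift2 (u2 t)
           + lift2 (vnabla M2 N2 \<phi>2 D2 (U2 t) (U2 t) (\<gamma>2 t))
           - g t (lift2 (u2 t)) (lift2 (u2 t)) *\<^sub>R vproj M N \<phi> (\<gamma> t) (gradlnf t) = 0
           \<and>
           lift1 (oneill_T M1 N1 \<phi>1 D1 (U1 t) (U1 t) (\<gamma>1 t))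
           + lift2 (oneill_T M2 N2 \<phi>2 D2 (U2 t) (U2 t) (\<gamma>2 t))
           - g t (lift2 (u2 t)) (lift2 (u2 t)) *\<^sub>R hproj M N \<phi> (\<gamma> t) (gradlnf t) = 0)))
     \<and>
     ((\<forall>t\<in>I. velocity M \<gamma> t \<in> horizontal_space M N \<phi> (\<gamma> t)) \<longrightarrow>
       (geodesic M D I \<gamma> \<longleftrightarrow>
         (\<forall>t\<in>J.
           lift1 (oneill_A M1 N1 \<phi>1 D1 (Y1 t) (Y1 t) (\<gamma>1 t))
           + lift2 (oneill_A M2 N2 \<phi>2 D2 (Y2 t) (Y2 t) (\<gamma>2 t))
           - g t (lift2 (y2 t)) (lift2 (y2 t)) *\<^sub>R vproj M N \<phi> (\<gamma> t) (gradlnf t) = 0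
           \<and>
           lift1 (hnabla M1 N1 \<phi>1 D1 (Y1 t) (Y1 t) (\<gamma>1 t))
           + (2 * (dfun M1 f (\<gamma>1 t) (y1 t) / f (\<gamma>1 t))) *\<^sub>R lift2 (y2 t)
           + lift2 (hnabla M2 N2 \<phi>2 D2 (Y2 t) (Y2 t) (\<gamma>2 t))
           - g t (lift2 (y2 t)) (lift2 (y2 t)) *\<^sub>R hproj M N \<phi> (\<gamma> t) (gradlnf t) = 0)))
     \<and>
     (geodesic M D I \<gamma> \<longleftrightarrow>
       (\<forall>t\<in>J.
         lift1 (vnabla M1 N1 \<phi>1 D1 (U1 t) (U1 t) (\<gamma>1 t))
         + lift1 (oneill_T M1 N1 \<phi>1 D1 (U1 t) (Y1 t) (\<gamma>1 t))
         + lift1 (vnabla M1 N1 \<phi>1 D1 (Y1 t) (U1 t) (\<gamma>1 t))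
         + lift1 (oneill_A M1 N1 \<phi>1 D1 (Y1 t) (Y1 t) (\<gamma>1 t))
         + (2 * (dfun M1 f (\<gamma>1 t) (u1 t) / f (\<gamma>1 t))) *\<^sub>R lift2 (u2 t)
         + (2 * (dfun M1 f (\<gamma>1 t) (y1 t) / f (\<gamma>1 t))) *\<^sub>R lift2 (u2 t)
         - g t (lift2 (u2 t)) (lift2 (u2 t)) *\<^sub>R vproj M N \<phi> (\<gamma> t) (gradlnf t)
         - g t (lift2 (y2 t)) (lift2 (y2 t)) *\<^sub>R vproj M N \<phi> (\<gamma> t) (gradlnf t)
         + lift2 (vnabla M2 N2 \<phi>2 D2 (U2 t) (U2 t) (\<gamma>2 t))
         + lift2 (oneill_T M2 N2 \<phi>2 D2 (U2 t) (Y2 t) (\<gamma>2 t))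
         + lift2 (oneill_A M2 N2 \<phi>2 D2 (Y2 t) (Y2 t) (\<gamma>2 t))
         + lift2 (vnabla M2 N2 \<phi>2 D2 (Y2 t) (U2 t) (\<gamma>2 t)) = 0
         \<and>
         lift1 (oneill_T M1 N1 \<phi>1 D1 (U1 t) (U1 t) (\<gamma>1 t))
         + lift2 (oneill_T M2 N2 \<phi>2 D2 (U2 t) (U2 t) (\<gamma>2 t))
         + lift1 (hnabla M1 N1 \<phi>1 D1 (U1 t) (Y1 t) (\<gamma>1 t))
         + lift2 (hnabla M2 N2 \<phi>2 D2 (U2 t) (Y2 t) (\<gamma>2 t))
         + lift1 (oneill_A M1 N1 \<phi>1 D1 (Y1 t) (U1 t) (\<gamma>1 t))
         + lift2 (oneill_A M2 N2 \<phi>2 D2 (Y2 t) (U2 t) (\<gamma>2 t))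
         + lift1 (hnabla M1 N1 \<phi>1 D1 (Y1 t) (Y1 t) (\<gamma>1 t))
         + lift2 (hnabla M2 N2 \<phi>2 D2 (Y2 t) (Y2 t) (\<gamma>2 t))
         + (2 * (dfun M1 f (\<gamma>1 t) (u1 t) / f (\<gamma>1 t))) *\<^sub>R lift2 (y2 t)
         + (2 * (dfun M1 f (\<gamma>1 t) (y1 t) / f (\<gamma>1 t))) *\<^sub>R lift2 (y2 t)
         - g t (lift2 (u2 t)) (lift2 (u2 t)) *\<^sub>R hproj M N \<phi> (\<gamma> t) (gradlnf t)
         - g t (lift2 (y2 t)) (lift2 (y2 t)) *\<^sub>R hproj M N \<phi> (\<gamma> t) (gradlnf t) = 0))"
proof -
  note wm = assms(1)[unfolded riemannian_warped_product_map_def]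
  have M1: "riemannian_manifold M1" and M2: "riemannian_manifold M2"
    and N1: "smooth_manifold N1" and N2: "smooth_manifold N2"
    and f: "smooth_fun M1 UNIV f" "\<And>p. 0 < f p"
    and \<phi>1: "smooth_map M1 N1 \<phi>1" and \<phi>2: "smooth_map M2 N2 \<phi>2" and \<phi>: "\<phi> = map_prod \<phi>1 \<phi>2"
    using wm by (auto simp: riemannian_map_def riemannian_manifold_form)
  note M1' = riemannian_manifold_form(1)[OF M1] and M2' = riemannian_manifold_form(1)[OF M2]
  have M: "smooth_manifold M"
    unfolding assms(2) using M1' M2' by (rule smooth_manifold_warped_product)
  have D: "levi_civita M1 D1" "levi_civita M2 D2" "levi_civita (warped_product M1 f M2) D"
    using assms(4-6) by (simp_all add: assms(2))
  have D': "affine_connection M1 D1" "affine_connection M2 D2" "affine_connection M D"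
    using assms(4-6) by (auto simp: levi_civita_def)
  have \<gamma>: "smooth_curve M I \<gamma>" using assms(9) by (simp add: regular_curve_def)
  have \<gamma>': "smooth_curve (warped_product M1 f M2) I \<gamma>" using \<gamma> by (simp add: assms(2))
  have \<gamma>1: "smooth_curve M1 I \<gamma>1" and \<gamma>2: "smooth_curve M2 I \<gamma>2"
    using smooth_curve_warped_product[OF M1' M2' \<gamma>' assms(7)] by (simp_all add: assms(10,11))
  let ?C = "\<lambda>c. cov_along M D c \<gamma> (velocity M \<gamma>)"
  let ?C1 = "\<lambda>c. cov_along M1 D1 c \<gamma>1 (velocity M1 \<gamma>1)" and ?C2 = "\<lambda>c. cov_along M2 D2 c \<gamma>2 (velocity M2 \<gamma>2)"
  let ?V1 = "\<lambda>t. vproj M1 N1 \<phi>1 (\<gamma>1 t)" and ?V2 = "\<lambda>t. vproj M2 N2 \<phi>2 (\<gamma>2 t)"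
  let ?H1 = "\<lambda>t. hproj M1 N1 \<phi>1 (\<gamma>1 t)" and ?H2 = "\<lambda>t. hproj M2 N2 \<phi>2 (\<gamma>2 t)"
  let ?v1 = "velocity M1 \<gamma>1" and ?v2 = "velocity M2 \<gamma>2"
  have vel: "velocity M \<gamma> t = (?v1 t, ?v2 t)" if "t \<in> I" for t
    using velocity_warped_product[OF M1' M2' \<gamma>' assms(7) that] by (simp add: assms(2,10,11))
  have V: "vproj M N \<phi> (\<gamma> t) w = (?V1 t (fst w), ?V2 t (snd w))" for t w
    unfolding assms(2,3,10,11) \<phi> by (rule vproj_map_prod[OF M1 M2 N1 N2 \<phi>1 \<phi>2 f(2)])
  have H: "hproj M N \<phi> (\<gamma> t) w = (?H1 t (fst w), ?H2 t (snd w))" for t w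
    unfolding assms(2,3,10,11) \<phi> by (rule hproj_map_prod[OF M1 M2 N1 N2 \<phi>1 \<phi>2 f(2)])
  have vert: "vertical_space M N \<phi> (\<gamma> t) = vertical_space M1 N1 \<phi>1 (\<gamma>1 t) \<times> vertical_space M2 N2 \<phi>2 (\<gamma>2 t)" for t
    unfolding assms(2,3,10,11) \<phi> by (rule vertical_space_map_prod[OF M1 M2 N1 N2 \<phi>1 \<phi>2 f(2)])
  have hor: "horizontal_space M N \<phi> (\<gamma> t) = horizontal_space M1 N1 \<phi>1 (\<gamma>1 t) \<times> horizontal_space M2 N2 \<phi>2 (\<gamma>2 t)" for t
    unfolding assms(2,3,10,11) \<phi> by (rule horizontal_space_map_prod[OF M1 M2 N1 N2 \<phi>1 \<phi>2 f(2)])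
  have charts: "\<exists>c1\<in>atlas M1. \<exists>c2\<in>atlas M2. c = prod_chart c1 c2 \<and> \<gamma>1 t \<in> cdom c1 \<and> \<gamma>2 t \<in> cdom c2"
    if "c \<in> atlas M" "\<gamma> t \<in> cdom c" for c t
    using that by (auto simp: assms(2,10,11) mem_Times_iff) blast
  \<comment> \<open>The frame shared by all three parts: a condition on \<open>J\<close>
    characterises geodesics once it matches vanishing acceleration in product charts. The way back
    from \<open>J\<close> to all of \<open>I\<close> uses density.\<close>
  have key: "geodesic M D I \<gamma> \<longleftrightarrow> (\<forall>t\<in>J. P t)"
    if P: "\<And>t c1 c2. \<lbrakk>t \<in> J; c1 \<in> atlas M1; \<gamma>1 t \<in> cdom c1; c2 \<in> atlas M2; \<gamma>2 t \<in> cdom c2\<rbrakk> \<Longrightarrow>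
      ?C (prod_chart c1 c2) t = 0 \<longleftrightarrow> P t" for P
  proof
    assume geo: "geodesic M D I \<gamma>"
    show "\<forall>t\<in>J. P t"
    proof
      fix t assume t: "t \<in> J"
      have c: "chart_at M (\<gamma> t) \<in> atlas M" "\<gamma> t \<in> cdom (chart_at M (\<gamma> t))"
        using chart_at_atlas[OF M] by auto
      then have "?C (chart_at M (\<gamma> t)) t = 0"
        using geo t assms(12) unfolding geodesic_def by blast
      then show "P t" using charts[OF c] P[OF t] by metis
    qed
  next
    assume eq: "\<forall>t\<in>J. P t"
    have "?C c t = 0" if "t \<in> I" "c \<in> atlas M" "\<gamma> t \<in> cdom c" for t c
    proof (rule cov_along_zero_dense[OF M D'(3) \<gamma> assms(7,12,13) that(2) _ that(1,3)])
      fix s assume s: "s \<in> J" "\<gamma> s \<in> cdom c"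
      show "?C c s = 0" using charts[OF that(2) s(2)] P[OF s(1)] eq s(1) by metis
    qed
    then show "geodesic M D I \<gamma>"
      using \<gamma> by (simp add: geodesic_def)
  qed
  \<comment> \<open>A vector is the sum of its vertical and horizontal parts, and both projections
    send 0 to 0; each displayed pair of equations is therefore the vanishing of one vector.\<close>
  have split: "?C c t = 0 \<longleftrightarrow> X = 0 \<and> Z = 0"
    if "X = vproj M N \<phi> (\<gamma> t) (?C c t)" "Z = hproj M N \<phi> (\<gamma> t) (?C c t)" for X Z c t
  proof -
    have "?C c t = vproj M N \<phi> (\<gamma> t) (?C c t) + hproj M N \<phi> (\<gamma> t) (?C c t)"
      by (simp add: V H hproj_eq[OF M1 N1 \<phi>1] hproj_eq[OF M2 N2 \<phi>2])
    moreover have "vproj M N \<phi> (\<gamma> t) 0 = 0" "hproj M N \<phi> (\<gamma> t) 0 = 0"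
      by (simp_all add: V H linear_0 linear_vproj[OF M1 N1 \<phi>1] linear_vproj[OF M2 N2 \<phi>2]
          linear_hproj[OF M1 N1 \<phi>1] linear_hproj[OF M2 N2 \<phi>2] zero_prod_def)
    ultimately show ?thesis unfolding that by (metis add.left_neutral)
  qed
  have linf: "linear (dfun M1 f (\<gamma>1 t))" for t
    by (rule linear_dfun[OF M1' f(1) UNIV_I])
  \<comment> \<open>\<open>G t\<close> is the gradient of \<open>ln f\<close> on \<open>M1\<close>
    at \<open>\<gamma>1 t\<close>, characterised by its pairings.\<close>
  obtain G where G: "gmetric M1 (\<gamma>1 t) (G t) w = dfun M1 f (\<gamma>1 t) w / f (\<gamma>1 t)" for t w
  proof -
    have "\<exists>v. \<forall>w. gmetric M1 (\<gamma>1 t) v w = dfun M1 f (\<gamma>1 t) w / f (\<gamma>1 t)" for t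
      using linear_compose[OF linf[of t], of "\<lambda>r. r / f (\<gamma>1 t)"]
      by (intro form_representation[OF riemannian_manifold_form(2)[OF M1]])
        (simp add: o_def linear_iff add_divide_distrib)
    then show ?thesis using that by metis
  qed
  have grad: "gradlnf t = (G t, 0)" for t
    unfolding assms(2,21) by (rule grad_ln_warping[OF M1 M2 f]) (use G in \<open>simp add: assms(10)\<close>)
  have C: "?C (prod_chart c1 c2) t =
    (?C1 c1 t - ((f (\<gamma>1 t))\<^sup>2 * gmetric M2 (\<gamma>2 t) (?v2 t) (?v2 t)) *\<^sub>R G t,
     ?C2 c2 t + (2 * (dfun M1 f (\<gamma>1 t) (?v1 t) / f (\<gamma>1 t))) *\<^sub>R ?v2 t)"
    if "t \<in> J" "c1 \<in> atlas M1" "\<gamma>1 t \<in> cdom c1" "c2 \<in> atlas M2" "\<gamma>2 t \<in> cdom c2" for t c1 c2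
    using warped_cov_along[OF M1 M2 f D \<gamma>' assms(7), of t c1 c2 "G t"] that assms(12) G
    by (auto simp: assms(2,10,11))
  have g: "g t (lift2 u) (lift2 v) = (f (\<gamma>1 t))\<^sup>2 * gmetric M2 (\<gamma>2 t) u v" for t u v
    by (simp add: assms(2,10,11,20) bilinear_lzero[OF metric_formD(1)[OF riemannian_manifold_form(2)[OF M1]]])
  note lin = linear_add linear_diff linear_scale linear_0
    linear_vproj[OF M1 N1 \<phi>1] linear_vproj[OF M2 N2 \<phi>2] linear_hproj[OF M1 N1 \<phi>1] linear_hproj[OF M2 N2 \<phi>2]
  have comp: "u1 t = ?V1 t (?v1 t)" "y1 t = ?H1 t (?v1 t)" "u2 t = ?V2 t (?v2 t)" "y2 t = ?H2 t (?v2 t)"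
    if "t \<in> J" for t
    using component_fields_at[OF assms(14)[rule_format, OF that]]
      component_fields_at[OF assms(15)[rule_format, OF that]] by (simp_all add: assms(16-19))
  show ?thesis
  proof (intro conjI impI)
    assume ver: "\<forall>t\<in>I. velocity M \<gamma> t \<in> vertical_space M N \<phi> (\<gamma> t)"
    then have ver1: "?v1 t \<in> vertical_space M1 N1 \<phi>1 (\<gamma>1 t)" and ver2: "?v2 t \<in> vertical_space M2 N2 \<phi>2 (\<gamma>2 t)"
      if "t \<in> I" for t using that by (auto simp: vel vert)
    show "geodesic M D I \<gamma> \<longleftrightarrow> (\<forall>t\<in>J.
           lift1 (vnabla M1 N1 \<phi>1 D1 (U1 t) (U1 t) (\<gamma>1 t))
           + (2 * (dfun M1 f (\<gamma>1 t) (u1 t) / f (\<gamma>1 t))) *\<^sub>R lift2 (u2 t)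
           + lift2 (vnabla M2 N2 \<phi>2 D2 (U2 t) (U2 t) (\<gamma>2 t))
           - g t (lift2 (u2 t)) (lift2 (u2 t)) *\<^sub>R vproj M N \<phi> (\<gamma> t) (gradlnf t) = 0
           \<and>
           lift1 (oneill_T M1 N1 \<phi>1 D1 (U1 t) (U1 t) (\<gamma>1 t))
           + lift2 (oneill_T M2 N2 \<phi>2 D2 (U2 t) (U2 t) (\<gamma>2 t))
           - g t (lift2 (u2 t)) (lift2 (u2 t)) *\<^sub>R hproj M N \<phi> (\<gamma> t) (gradlnf t) = 0)"
    \<comment> \<open>What remains is to recognise the two left sides as the vertical and horizontal
      parts of the acceleration in an arbitrary product chart around the point.\<close>
    proof (intro key split)
      fix t c1 c2
      assume a: "t \<in> J" "c1 \<in> atlas M1" "\<gamma>1 t \<in> cdom c1" "c2 \<in> atlas M2" "\<gamma>2 t \<in> cdom c2"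
      then have t: "t \<in> I" using assms(12) by auto
      note C1 = cov_along_components_vertical[OF M1 N1 \<phi>1 D'(1) \<gamma>1 assms(7) t a(2,3) assms(14)[rule_format, OF a(1)] ver1]
      note C2 = cov_along_components_vertical[OF M2 N2 \<phi>2 D'(2) \<gamma>2 assms(7) t a(4,5) assms(15)[rule_format, OF a(1)] ver2]
      \<comment> \<open>The warping term \<open>2 (v1(f) / f) v2\<close> is vertical here, so it
        appears in the vertical equation only.\<close>
      have u: "u1 t = ?v1 t" "u2 t = ?v2 t" "?V2 t (?v2 t) = ?v2 t" "?H2 t (?v2 t) = 0"
        using comp[OF a(1)] ver1[OF t] ver2[OF t]
        by (simp_all add: vproj_vertical[OF M1 N1 \<phi>1] vproj_vertical[OF M2 N2 \<phi>2] hproj_vertical[OF M2 N2 \<phi>2])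
      show "lift1 (vnabla M1 N1 \<phi>1 D1 (U1 t) (U1 t) (\<gamma>1 t))
           + (2 * (dfun M1 f (\<gamma>1 t) (u1 t) / f (\<gamma>1 t))) *\<^sub>R lift2 (u2 t)
           + lift2 (vnabla M2 N2 \<phi>2 D2 (U2 t) (U2 t) (\<gamma>2 t))
           - g t (lift2 (u2 t)) (lift2 (u2 t)) *\<^sub>R vproj M N \<phi> (\<gamma> t) (gradlnf t)
         = vproj M N \<phi> (\<gamma> t) (?C (prod_chart c1 c2) t)"
        by (simp add: C[OF a] V grad g u lin C1 C2)
      show "lift1 (oneill_T M1 N1 \<phi>1 D1 (U1 t) (U1 t) (\<gamma>1 t))
           + lift2 (oneill_T M2 N2 \<phi>2 D2 (U2 t) (U2 t) (\<gamma>2 t))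
           - g t (lift2 (u2 t)) (lift2 (u2 t)) *\<^sub>R hproj M N \<phi> (\<gamma> t) (gradlnf t)
         = hproj M N \<phi> (\<gamma> t) (?C (prod_chart c1 c2) t)"
        by (simp add: C[OF a] H grad g u lin C1 C2)
    qed
  next
    assume ho: "\<forall>t\<in>I. velocity M \<gamma> t \<in> horizontal_space M N \<phi> (\<gamma> t)"
    then have hor1: "?v1 t \<in> horizontal_space M1 N1 \<phi>1 (\<gamma>1 t)" and hor2: "?v2 t \<in> horizontal_space M2 N2 \<phi>2 (\<gamma>2 t)"
      if "t \<in> I" for t using that by (auto simp: vel hor)
    show "geodesic M D I \<gamma> \<longleftrightarrow> (\<forall>t\<in>J.
           lift1 (oneill_A M1 N1 \<phi>1 D1 (Y1 t) (Y1 t) (\<gamma>1 t))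
           + lift2 (oneill_A M2 N2 \<phi>2 D2 (Y2 t) (Y2 t) (\<gamma>2 t))
           - g t (lift2 (y2 t)) (lift2 (y2 t)) *\<^sub>R vproj M N \<phi> (\<gamma> t) (gradlnf t) = 0
           \<and>
           lift1 (hnabla M1 N1 \<phi>1 D1 (Y1 t) (Y1 t) (\<gamma>1 t))
           + (2 * (dfun M1 f (\<gamma>1 t) (y1 t) / f (\<gamma>1 t))) *\<^sub>R lift2 (y2 t)
           + lift2 (hnabla M2 N2 \<phi>2 D2 (Y2 t) (Y2 t) (\<gamma>2 t))
           - g t (lift2 (y2 t)) (lift2 (y2 t)) *\<^sub>R hproj M N \<phi> (\<gamma> t) (gradlnf t) = 0)"
    proof (intro key split)
      fix t c1 c2
      assume a: "t \<in> J" "c1 \<in> atlas M1" "\<gamma>1 t \<in> cdom c1" "c2 \<in> atlas M2" "\<gamma>2 t \<in> cdom c2"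
      then have t: "t \<in> I" using assms(12) by auto
      note C1 = cov_along_components_horizontal[OF M1 N1 \<phi>1 D'(1) \<gamma>1 assms(7) t a(2,3) assms(14)[rule_format, OF a(1)] hor1]
      note C2 = cov_along_components_horizontal[OF M2 N2 \<phi>2 D'(2) \<gamma>2 assms(7) t a(4,5) assms(15)[rule_format, OF a(1)] hor2]
      \<comment> \<open>Now \<open>v2\<close> is horizontal, which moves the warping term to the
        horizontal equation.\<close>
      have u: "y1 t = ?v1 t" "y2 t = ?v2 t" "?V2 t (?v2 t) = 0" "?H2 t (?v2 t) = ?v2 t"
        using comp[OF a(1)] hor1[OF t] hor2[OF t]
        by (simp_all add: vproj_horizontal[OF M2 N2 \<phi>2] hproj_horizontal[OF M1 N1 \<phi>1] hproj_horizontal[OF M2 N2 \<phi>2])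
      show "lift1 (oneill_A M1 N1 \<phi>1 D1 (Y1 t) (Y1 t) (\<gamma>1 t))
           + lift2 (oneill_A M2 N2 \<phi>2 D2 (Y2 t) (Y2 t) (\<gamma>2 t))
           - g t (lift2 (y2 t)) (lift2 (y2 t)) *\<^sub>R vproj M N \<phi> (\<gamma> t) (gradlnf t)
         = vproj M N \<phi> (\<gamma> t) (?C (prod_chart c1 c2) t)"
        by (simp add: C[OF a] V grad g u lin C1 C2)
      show "lift1 (hnabla M1 N1 \<phi>1 D1 (Y1 t) (Y1 t) (\<gamma>1 t))
           + (2 * (dfun M1 f (\<gamma>1 t) (y1 t) / f (\<gamma>1 t))) *\<^sub>R lift2 (y2 t)
           + lift2 (hnabla M2 N2 \<phi>2 D2 (Y2 t) (Y2 t) (\<gamma>2 t))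
           - g t (lift2 (y2 t)) (lift2 (y2 t)) *\<^sub>R hproj M N \<phi> (\<gamma> t) (gradlnf t)
         = hproj M N \<phi> (\<gamma> t) (?C (prod_chart c1 c2) t)"
        by (simp add: C[OF a] H grad g u lin C1 C2)
    qed
  next
    show "geodesic M D I \<gamma> \<longleftrightarrow> (\<forall>t\<in>J.
         lift1 (vnabla M1 N1 \<phi>1 D1 (U1 t) (U1 t) (\<gamma>1 t))
         + lift1 (oneill_T M1 N1 \<phi>1 D1 (U1 t) (Y1 t) (\<gamma>1 t))
         + lift1 (vnabla M1 N1 \<phi>1 D1 (Y1 t) (U1 t) (\<gamma>1 t))
         + lift1 (oneill_A M1 N1 \<phi>1 D1 (Y1 t) (Y1 t) (\<gamma>1 t))
         + (2 * (dfun M1 f (\<gamma>1 t) (u1 t) / f (\<gamma>1 t))) *\<^sub>R lift2 (u2 t)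
         + (2 * (dfun M1 f (\<gamma>1 t) (y1 t) / f (\<gamma>1 t))) *\<^sub>R lift2 (u2 t)
         - g t (lift2 (u2 t)) (lift2 (u2 t)) *\<^sub>R vproj M N \<phi> (\<gamma> t) (gradlnf t)
         - g t (lift2 (y2 t)) (lift2 (y2 t)) *\<^sub>R vproj M N \<phi> (\<gamma> t) (gradlnf t)
         + lift2 (vnabla M2 N2 \<phi>2 D2 (U2 t) (U2 t) (\<gamma>2 t))
         + lift2 (oneill_T M2 N2 \<phi>2 D2 (U2 t) (Y2 t) (\<gamma>2 t))
         + lift2 (oneill_A M2 N2 \<phi>2 D2 (Y2 t) (Y2 t) (\<gamma>2 t))
         + lift2 (vnabla M2 N2 \<phi>2 D2 (Y2 t) (U2 t) (\<gamma>2 t)) = 0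
         \<and>
         lift1 (oneill_T M1 N1 \<phi>1 D1 (U1 t) (U1 t) (\<gamma>1 t))
         + lift2 (oneill_T M2 N2 \<phi>2 D2 (U2 t) (U2 t) (\<gamma>2 t))
         + lift1 (hnabla M1 N1 \<phi>1 D1 (U1 t) (Y1 t) (\<gamma>1 t))
         + lift2 (hnabla M2 N2 \<phi>2 D2 (U2 t) (Y2 t) (\<gamma>2 t))
         + lift1 (oneill_A M1 N1 \<phi>1 D1 (Y1 t) (U1 t) (\<gamma>1 t))
         + lift2 (oneill_A M2 N2 \<phi>2 D2 (Y2 t) (U2 t) (\<gamma>2 t))
         + lift1 (hnabla M1 N1 \<phi>1 D1 (Y1 t) (Y1 t) (\<gamma>1 t))
         + lift2 (hnabla M2 N2 \<phi>2 D2 (Y2 t) (Y2 t) (\<gamma>2 t))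
         + (2 * (dfun M1 f (\<gamma>1 t) (u1 t) / f (\<gamma>1 t))) *\<^sub>R lift2 (y2 t)
         + (2 * (dfun M1 f (\<gamma>1 t) (y1 t) / f (\<gamma>1 t))) *\<^sub>R lift2 (y2 t)
         - g t (lift2 (u2 t)) (lift2 (u2 t)) *\<^sub>R hproj M N \<phi> (\<gamma> t) (gradlnf t)
         - g t (lift2 (y2 t)) (lift2 (y2 t)) *\<^sub>R hproj M N \<phi> (\<gamma> t) (gradlnf t) = 0)"
    proof (intro key split)
      fix t c1 c2
      assume a: "t \<in> J" "c1 \<in> atlas M1" "\<gamma>1 t \<in> cdom c1" "c2 \<in> atlas M2" "\<gamma>2 t \<in> cdom c2"
      then have t: "t \<in> I" using assms(12) by auto
      note C1 = cov_along_components[OF M1 N1 \<phi>1 D'(1) \<gamma>1 assms(7) t a(2,3) assms(14)[rule_format, OF a(1)]]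
      note C2 = cov_along_components[OF M2 N2 \<phi>2 D'(2) \<gamma>2 assms(7) t a(4,5) assms(15)[rule_format, OF a(1)]]
      \<comment> \<open>Linearity of the differential separates the warping coefficient into its
        vertical and horizontal contributions.\<close>
      have df: "dfun M1 f (\<gamma>1 t) (?v1 t) = dfun M1 f (\<gamma>1 t) (u1 t) + dfun M1 f (\<gamma>1 t) (y1 t)"
        using linear_add[OF linf, of t "u1 t" "y1 t"] by (simp add: comp[OF a(1)] hproj_eq[OF M1 N1 \<phi>1])
      have v2: "?v2 t = u2 t + y2 t"
        by (simp add: comp[OF a(1)] hproj_eq[OF M2 N2 \<phi>2])
      note form2 = metric_formD[OF riemannian_manifold_form(2)[OF M2]]
      \<comment> \<open>The mixed terms of \<open>g2(v2, v2)\<close> vanish by this orthogonality,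
        which is why the equations contain only the squares of \<open>u2\<close> and
        \<open>y2\<close>.\<close>
      have orth: "gmetric M2 (\<gamma>2 t) (y2 t) (u2 t) = 0"
        using vproj_residual[OF M2 N2 \<phi>2 vproj_in_vertical[OF M2 N2 \<phi>2]]
        by (simp add: comp[OF a(1)] hproj_eq[OF M2 N2 \<phi>2])
      have g2: "gmetric M2 (\<gamma>2 t) (?v2 t) (?v2 t) =
          gmetric M2 (\<gamma>2 t) (u2 t) (u2 t) + gmetric M2 (\<gamma>2 t) (y2 t) (y2 t)"
        unfolding v2 using orth form2(2)[of "\<gamma>2 t" "u2 t" "y2 t"]
        by (simp add: bilinear_ladd[OF form2(1)] bilinear_radd[OF form2(1)])
      note u = comp(3,4)[OF a(1), symmetric]
      show "lift1 (vnabla M1 N1 \<phi>1 D1 (U1 t) (U1 t) (\<gamma>1 t))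
         + lift1 (oneill_T M1 N1 \<phi>1 D1 (U1 t) (Y1 t) (\<gamma>1 t))
         + lift1 (vnabla M1 N1 \<phi>1 D1 (Y1 t) (U1 t) (\<gamma>1 t))
         + lift1 (oneill_A M1 N1 \<phi>1 D1 (Y1 t) (Y1 t) (\<gamma>1 t))
         + (2 * (dfun M1 f (\<gamma>1 t) (u1 t) / f (\<gamma>1 t))) *\<^sub>R lift2 (u2 t)
         + (2 * (dfun M1 f (\<gamma>1 t) (y1 t) / f (\<gamma>1 t))) *\<^sub>R lift2 (u2 t)
         - g t (lift2 (u2 t)) (lift2 (u2 t)) *\<^sub>R vproj M N \<phi> (\<gamma> t) (gradlnf t)
         - g t (lift2 (y2 t)) (lift2 (y2 t)) *\<^sub>R vproj M N \<phi> (\<gamma> t) (gradlnf t)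
         + lift2 (vnabla M2 N2 \<phi>2 D2 (U2 t) (U2 t) (\<gamma>2 t))
         + lift2 (oneill_T M2 N2 \<phi>2 D2 (U2 t) (Y2 t) (\<gamma>2 t))
         + lift2 (oneill_A M2 N2 \<phi>2 D2 (Y2 t) (Y2 t) (\<gamma>2 t))
         + lift2 (vnabla M2 N2 \<phi>2 D2 (Y2 t) (U2 t) (\<gamma>2 t))
         = vproj M N \<phi> (\<gamma> t) (?C (prod_chart c1 c2) t)"
        unfolding C[OF a] df g2
        by (simp add: V grad g lin C1 C2 u scaleR_add_left add_divide_distrib distrib_left)
      show "lift1 (oneill_T M1 N1 \<phi>1 D1 (U1 t) (U1 t) (\<gamma>1 t))
         + lift2 (oneill_T M2 N2 \<phi>2 D2 (U2 t) (U2 t) (\<gamma>2 t))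
         + lift1 (hnabla M1 N1 \<phi>1 D1 (U1 t) (Y1 t) (\<gamma>1 t))
         + lift2 (hnabla M2 N2 \<phi>2 D2 (U2 t) (Y2 t) (\<gamma>2 t))
         + lift1 (oneill_A M1 N1 \<phi>1 D1 (Y1 t) (U1 t) (\<gamma>1 t))
         + lift2 (oneill_A M2 N2 \<phi>2 D2 (Y2 t) (U2 t) (\<gamma>2 t))
         + lift1 (hnabla M1 N1 \<phi>1 D1 (Y1 t) (Y1 t) (\<gamma>1 t))
         + lift2 (hnabla M2 N2 \<phi>2 D2 (Y2 t) (Y2 t) (\<gamma>2 t))
         + (2 * (dfun M1 f (\<gamma>1 t) (u1 t) / f (\<gamma>1 t))) *\<^sub>R lift2 (y2 t)
         + (2 * (dfun M1 f (\<gamma>1 t) (y1 t) / f (\<gamma>1 t))) *\<^sub>R lift2 (y2 t)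
         - g t (lift2 (u2 t)) (lift2 (u2 t)) *\<^sub>R hproj M N \<phi> (\<gamma> t) (gradlnf t)
         - g t (lift2 (y2 t)) (lift2 (y2 t)) *\<^sub>R hproj M N \<phi> (\<gamma> t) (gradlnf t)
         = hproj M N \<phi> (\<gamma> t) (?C (prod_chart c1 c2) t)"
        unfolding C[OF a] df g2
        by (simp add: H grad g lin C1 C2 u scaleR_add_left add_divide_distrib distrib_left)
    qed
  qed
qed

end
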